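(* Let $X$ be a locally compact second countable space and $\alpha\in(0,1]$. Let $\Phi$ be a discrete $\alpha$-stable point process on $X$ with the Lévy measure supported by finite measures (equivalently, with a spectral measure $\sigma$ supported by the set $\mathbb{M}_1$ of probability measures on $X$). Then $\Phi$ can be represented (in distribution) as a cluster process with a Poisson centre process on $\mathbb{M}_1$ driven by the intensity measure $\sigma$ and daughter processes being Sibuya processes $\mathsf{Sib}(\alpha,\mu)$, $\mu\in\mathbb{M}_1$. Its probability generating functional is given by $$G_\Phi[u]=\exp\Bigl\{\int_{\mathbb{M}_1}\bigl(G_{\Upsilon(\mu)}[u]-1\bigr)\,\sigma(d\mu)\Bigr\},\qquad 1-u\in\mathrm{BM}(X),$$ where $G_{\Upsilon(\mu)}[u]=1-\langle1-u,\mu\rangle^\alpha$ is the probability generating functional of $\mathsf{Sib}(\alpha,\mu)$.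
   Context: $X$ is a locally compact second countable (Hausdorff) space with its Borel $\sigma$-algebra. $\mathbb{M}$ is the space of (non-negative) Radon measures on $X$ (finite on relatively compact Borel sets), with the $\sigma$-algebra generated by evaluations on Borel sets; $\mathbb{M}_1\subset\mathbb{M}$ is the set of probability measures. A point process is a random element of $\mathbb{M}$ whose realisations are locally finite counting measures (multiple points allowed). $\mathrm{BM}(X)$ is the set of non-negative bounded measurable functions on $X$ with compact support; $\langle h,\mu\rangle=\int_X h\,d\mu$. The probability generating functional (p.g.fl.) is $G_\Phi[u]=\mathbf{E}\exp\{\langle\log u,\Phi\rangle\}$ for measurable $u:X\to(0,1]$ with $1-u\in\mathrm{BM}(X)$. Thinning: $t\circ\Phi$ is obtained by retaining each unit mass of $\Phi$ with probability $t$ independently of the others. $\Phi$ is discrete $\alpha$-stable if $t^{1/\alpha}\circ\Phi'+(1-t)^{1/\alpha}\circ\Phi''\overset{\mathcal D}{=}\Phi$ for all $t\in[0,1]$, with $\Phi',\Phi''$ independent copies of $\Phi$ (and the two thinnings independent). Lévy and spectral measures of $\Phi$: fix a countable base $B_1,B_2,\dots$ of the topology of $X$ consisting of relatively compact sets and put $B_0=X$. For $\mu\in\mathbb{M}\setminus\{0\}$ let $i(\mu)$ be the smallest $i\ge0$ with $0<\mu(B_i)<\infty$, and let $\mathbb{S}=\{\mu\in\mathbb{M}\setminus\{0\}:\mu(B_{i(\mu)})=1\}$; the finite measures in $\mathbb{S}$ are exactly $\mathbb{M}_1$. Every discrete $\alpha$-stable $\Phi$ has p.g.fl. $G_\Phi[u]=\exp\{-\int_{\mathbb{S}}\langle1-u,\mu\rangle^\alpha\sigma(d\mu)\}$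 for a measure $\sigma$ on $\mathbb{S}$ (spectral measure) with $\int_{\mathbb{S}}\mu(B)^\alpha\sigma(d\mu)<\infty$ for all relatively compact Borel $B$. For $\alpha\in(0,1)$ this equals $\exp\{-\int_{\mathbb{M}\setminus\{0\}}(1-e^{-\langle1-u,\mu\rangle})\Lambda(d\mu)\}$, where the Lévy measure $\Lambda$ on $\mathbb{M}\setminus\{0\}$ is homogeneous, $\Lambda(tA)=t^{-\alpha}\Lambda(A)$, and $\sigma(A)=\Gamma(1-\alpha)\Lambda(\{t\mu:\mu\in A,t\ge1\})$ for measurable $A\subset\mathbb{S}$. For $\alpha=1$ (where no Lévy measure is defined) the hypothesis is read as the one on $\sigma$. "Supported by" a set means giving zero mass to its complement. Sibuya point process: for $\mu\in\mathbb{M}_1$, $\mathsf{Sib}(\alpha,\mu)$ is the distribution of the point process $\Upsilon(\mu)$ on $X$ with p.g.fl. $G_{\Upsilon(\mu)}[u]=1-\langle1-u,\mu\rangle^\alpha$. Cluster process: given a centre point process $N_c$ on a space $Y$ and independent daughter point processes $N(\cdot|y)$ on $X$ indexed by the points $y$ of $N_c$, the cluster process is the superposition of the daughter processes over all centres. *)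

theory Defs
  imports "HOL-Probability.Probability"
begin

definition rel_compact :: "'a::topological_space set \<Rightarrow> bool" where
  "rel_compact B \<longleftrightarrow> compact (closure B)"

(* The space of Radon measures with the sigma-algebra generated by the evaluations on Borel
   sets, in the style of subprob_algebra. *)
definition radon_space :: "'a::topological_space measure measure" where
  "radon_space =
     (SUP B \<in> sets borel.
        vimage_algebra
          {\<mu>. sets \<mu> = sets borel \<and> (\<forall>A\<in>sets borel. rel_compact A \<longrightarrow> emeasure \<mu> A < \<infinity>)}
          (\<lambda>\<mu>. emeasure \<mu> B) borel)"

abbreviation prob_measures :: "'a::topological_space measure set" where
  "prob_measures \<equiv> space (prob_algebra borel)"

definition superposition :: "'a measure \<Rightarrow> 'i set \<Rightarrow> ('i \<Rightarrow> 'a measure) \<Rightarrow> 'a measure" where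
  "superposition M I N =
     measure_of (space M) (sets M) (\<lambda>A. \<integral>\<^sup>+i. emeasure (N i) A \<partial>count_space I)"

definition dirac_sum :: "'a measure \<Rightarrow> nat set \<Rightarrow> (nat \<Rightarrow> 'a) \<Rightarrow> 'a measure" where
  "dirac_sum M I x = superposition M I (\<lambda>i. return M (x i))"

(* Locally finite counting measures; multiple points arise from repetitions in x. *)
definition counting_space :: "'a::topological_space measure measure" where
  "counting_space = restrict_space radon_space {\<mu>. \<exists>I x. \<mu> = dirac_sum borel I x}"

definition BM :: "('a::topological_space \<Rightarrow> real) set" where
  "BM = {h. h \<in> borel_measurable borel \<and> (\<forall>x. 0 \<le> h x) \<and> bounded (range h)
            \<and> compact (closure {x. h x \<noteq> 0})}"

definition test_functions :: "('a::topological_space \<Rightarrow> real) set" where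
  "test_functions =
     {u. u \<in> borel_measurable borel \<and> (\<forall>x. 0 < u x \<and> u x \<le> 1) \<and> (\<lambda>x. 1 - u x) \<in> BM}"

(* The probability generating functional of a point process with distribution L. *)
definition pgfl :: "'a::topological_space measure measure \<Rightarrow> ('a \<Rightarrow> real) \<Rightarrow> real" where
  "pgfl L u = (\<integral>\<mu>. exp (\<integral>x. ln (u x) \<partial>\<mu>) \<partial>L)"

(* Independent thinning of a fixed counting measure. The resulting distribution does not
   depend on the enumeration of the unit masses that is chosen here. *)
definition thinning_kernel ::
    "real \<Rightarrow> 'a::topological_space measure \<Rightarrow> 'a measure measure" where
  "thinning_kernel t \<mu> =
     (let (I, x) = (SOME (I, x). \<mu> = dirac_sum borel I x)
      in distr (\<Pi>\<^sub>M i\<in>UNIV. measure_pmf (bernoulli_pmf t)) counting_space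
           (\<lambda>b. dirac_sum borel {i\<in>I. b i} x))"

definition thinning :: "real \<Rightarrow> 'a::topological_space measure measure \<Rightarrow> 'a measure measure" where
  "thinning t L = L \<bind> thinning_kernel t"

(* The product measure carries two independent thinnings of independent copies. *)
definition discrete_stable :: "real \<Rightarrow> 'a::topological_space measure measure \<Rightarrow> bool" where
  "discrete_stable \<alpha> L \<longleftrightarrow>
     (\<forall>t\<in>{0..1}.
        distr (thinning (t powr (1 / \<alpha>)) L \<Otimes>\<^sub>M thinning ((1 - t) powr (1 / \<alpha>)) L) counting_space
          (\<lambda>(\<mu>, \<nu>). superposition borel UNIV (\<lambda>b::bool. if b then \<mu> else \<nu>)) = L)"

definition supported_by :: "'a measure \<Rightarrow> 'a set \<Rightarrow> bool" where
  "supported_by M A \<longleftrightarrow> space M - A \<in> null_sets M"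

definition rel_compact_base :: "(nat \<Rightarrow> 'a::topological_space set) \<Rightarrow> bool" where
  "rel_compact_base B \<longleftrightarrow>
     B 0 = UNIV \<and> topological_basis (B ` {1..}) \<and> (\<forall>i\<ge>1. rel_compact (B i))"

(* Since B 0 is the whole space, the finite elements of polar_sphere B are exactly the
   probability measures. *)
definition polar_index :: "(nat \<Rightarrow> 'a::topological_space set) \<Rightarrow> 'a measure \<Rightarrow> nat" where
  "polar_index B \<mu> = (LEAST i. 0 < emeasure \<mu> (B i) \<and> emeasure \<mu> (B i) < \<infinity>)"

definition polar_sphere :: "(nat \<Rightarrow> 'a::topological_space set) \<Rightarrow> 'a measure set" where
  "polar_sphere B =
     {\<mu> \<in> space radon_space. \<mu> \<noteq> null_measure borel \<and> emeasure \<mu> (B (polar_index B \<mu>)) = 1}"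

definition spectral_measure ::
    "(nat \<Rightarrow> 'a::topological_space set) \<Rightarrow> real \<Rightarrow> 'a measure measure \<Rightarrow> 'a measure measure \<Rightarrow> bool"
  where
  "spectral_measure B \<alpha> L \<sigma> \<longleftrightarrow>
     sets \<sigma> = sets (restrict_space radon_space (polar_sphere B)) \<and>
     (\<forall>A\<in>sets borel. rel_compact A \<longrightarrow> (\<integral>\<^sup>+\<mu>. ennreal (measure \<mu> A powr \<alpha>) \<partial>\<sigma>) < \<infinity>) \<and>
     (\<forall>u\<in>test_functions. pgfl L u = exp (- (\<integral>\<mu>. (\<integral>x. 1 - u x \<partial>\<mu>) powr \<alpha> \<partial>\<sigma>)))"

definition levy_measure ::
    "real \<Rightarrow> 'a::topological_space measure measure \<Rightarrow> 'a measure measure \<Rightarrow> bool" where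
  "levy_measure \<alpha> L \<Lambda> \<longleftrightarrow>
     sets \<Lambda> = sets (restrict_space radon_space (- {null_measure borel})) \<and>
     (\<forall>t>0. \<forall>A\<in>sets \<Lambda>.
        emeasure \<Lambda> (scale_measure (ennreal t) ` A) = ennreal (t powr (- \<alpha>)) * emeasure \<Lambda> A) \<and>
     (\<forall>h\<in>BM. integrable \<Lambda> (\<lambda>\<mu>. 1 - exp (- (\<integral>x. h x \<partial>\<mu>)))) \<and>
     (\<forall>u\<in>test_functions. pgfl L u = exp (- (\<integral>\<mu>. 1 - exp (- (\<integral>x. 1 - u x \<partial>\<mu>)) \<partial>\<Lambda>)))"

definition polar_part ::
    "(nat \<Rightarrow> 'a::topological_space set) \<Rightarrow> real \<Rightarrow> 'a measure measure \<Rightarrow> 'a measure measure \<Rightarrow> bool"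
  where
  "polar_part B \<alpha> \<Lambda> \<sigma> \<longleftrightarrow>
     (\<forall>A\<in>sets (restrict_space radon_space (polar_sphere B)).
        emeasure \<sigma> A =
          ennreal (Gamma (1 - \<alpha>)) *
          emeasure \<Lambda> {scale_measure (ennreal t) \<mu> | t \<mu>. \<mu> \<in> A \<and> 1 \<le> t})"

definition is_sibuya ::
    "real \<Rightarrow> 'a::topological_space measure \<Rightarrow> 'a measure measure \<Rightarrow> bool" where
  "is_sibuya \<alpha> \<mu> D \<longleftrightarrow>
     D \<in> space (prob_algebra counting_space) \<and>
     (\<forall>u\<in>test_functions. pgfl D u = 1 - (\<integral>x. 1 - u x \<partial>\<mu>) powr \<alpha>)"

definition Sib :: "real \<Rightarrow> 'a::topological_space measure \<Rightarrow> 'a measure measure" where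
  "Sib \<alpha> \<mu> = (THE D. is_sibuya \<alpha> \<mu> D)"

(* Poisson processes on an arbitrary measurable space, with an intensity measure that
   may be infinite. *)
definition poisson_process :: "'w measure \<Rightarrow> 'y measure \<Rightarrow> ('w \<Rightarrow> 'y measure) \<Rightarrow> bool" where
  "poisson_process P \<sigma> Nc \<longleftrightarrow>
     (\<forall>\<omega>\<in>space P. sets (Nc \<omega>) = sets \<sigma>) \<and>
     (\<forall>A\<in>sets \<sigma>. (\<lambda>\<omega>. emeasure (Nc \<omega>) A) \<in> borel_measurable P) \<and>
     (\<forall>A\<in>sets \<sigma>. emeasure \<sigma> A < \<infinity> \<longrightarrow>
        (\<forall>k::nat. measure P {\<omega>\<in>space P. emeasure (Nc \<omega>) A = of_nat k}
                    = exp (- measure \<sigma> A) * measure \<sigma> A ^ k / fact k)) \<and>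
     (\<forall>A\<in>sets \<sigma>. emeasure \<sigma> A = \<infinity> \<longrightarrow> (AE \<omega> in P. emeasure (Nc \<omega>) A = \<infinity>)) \<and>
     (\<forall>(n::nat) A. A ` {..<n} \<subseteq> sets \<sigma> \<and> disjoint_family_on A {..<n} \<longrightarrow>
        prob_space.indep_vars P (\<lambda>_. borel) (\<lambda>i \<omega>. emeasure (Nc \<omega>) (A i)) {..<n})"

(* N is a cluster process with centre process Nc on the measurable space Y and with
   daughter distributions \<kappa> y. The points of Nc are c i for i in the random index set J, and the
   daughter processes d i are conditionally independent given the centres (J, c), with
   conditional distributions \<kappa> (c i): this is the last clause. *)
definition cluster_process ::
    "'w measure \<Rightarrow> 'y measure \<Rightarrow> ('w \<Rightarrow> 'y measure) \<Rightarrow> ('y \<Rightarrow> 'a::topological_space measure measure)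
      \<Rightarrow> ('w \<Rightarrow> 'a measure) \<Rightarrow> bool" where
  "cluster_process P Y Nc \<kappa> N \<longleftrightarrow>
     \<kappa> \<in> Y \<rightarrow>\<^sub>M prob_algebra counting_space \<and>
     N \<in> P \<rightarrow>\<^sub>M counting_space \<and>
     (\<exists>(J :: 'w \<Rightarrow> nat set) c d.
        (\<forall>i. {\<omega>\<in>space P. i \<in> J \<omega>} \<in> sets P) \<and>
        (\<forall>i. c i \<in> P \<rightarrow>\<^sub>M Y) \<and>
        (\<forall>i. d i \<in> P \<rightarrow>\<^sub>M counting_space) \<and>
        (\<forall>\<omega>\<in>space P. Nc \<omega> = dirac_sum Y (J \<omega>) (\<lambda>i. c i \<omega>)) \<and>
        (AE \<omega> in P. N \<omega> = superposition borel (J \<omega>) (\<lambda>i. d i \<omega>)) \<and>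
        (\<forall>C \<in> sets (\<Pi>\<^sub>M i\<in>UNIV. count_space UNIV \<Otimes>\<^sub>M Y).
         \<forall>(n::nat) E. E ` {..<n} \<subseteq> sets counting_space \<longrightarrow>
           emeasure P {\<omega>\<in>space P. (\<lambda>i. (i \<in> J \<omega>, c i \<omega>)) \<in> C \<and> (\<forall>i<n. d i \<omega> \<in> E i)}
           = (\<integral>\<^sup>+\<omega>. indicator C (\<lambda>i. (i \<in> J \<omega>, c i \<omega>)) * (\<Prod>i<n. emeasure (\<kappa> (c i \<omega>)) (E i)) \<partial>P)))"

end

theory Submission
  imports Defs
begin

text \<open>
  A point process is determined by its probability generating functional: on indicator-type test
  functions it is the joint generating function of the counts of relatively compact sets, and the
  coefficients of that power series are the joint probabilities. So both the uniqueness of the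
  Sibuya process and the cluster representation reduce to computing generating functionals.

  A Sibuya process consists of \<open>K\<close> independent points with law \<open>\<mu>\<close>, where \<open>K\<close> has generating function
  \<open>1 - (1 - s) powr \<alpha>\<close>. Since every probability measure charges some set of the countable base with
  finite \<open>\<alpha>\<close>-moment, the spectral measure is sigma-finite, and the Poisson process on
  \<open>prob_measures\<close> is built block by block, with all marks drawn independently. Its Laplace functional,
  applied to the superposition of the marks, yields the spectral formula. The same formula for
  multiples \<open>r \<rightarrow> 0\<close> of an indicator shows that the superposition is locally finite almost surely.

  Functionals are written with \<open>exp_neg\<close>, the function \<open>exp (- x)\<close> on \<open>[0, \<infinity>]\<close> with value \<open>0\<close> at \<open>\<infinity>\<close>,
  so that no finiteness has to be known in advance.
\<close>

section \<open>Power series and joint laws of counts\<close>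

text \<open>The analytic content is one composition. With \<open>s\<close> the integral of
  \<open>u\<close> against \<open>\<mu>\<close>, a Sibuya number of independent points has
  generating functional \<open>1 - (1 - s) powr \<alpha>\<close>; a Poisson superposition turns one
  minus the daughter functional into the integrand of the exponent, which is the one of the spectral
  formula. What this computation does not show is the conditional independence of the daughters
  given the centres. It comes from the construction: every candidate point carries a daughter
  whether it is kept or not, and the set of kept indices depends only on the Poisson counts, which
  are independent of all candidates. With the counts frozen, only a product measure is left. Laplace
  transforms with positive parameters do not see the value infinity, which is reached as the
  complement of the countably many finite values. The equivalence of the two support hypotheses
  rests on homogeneity: the measures of infinite total mass form a cone exhausted by the dilates of
  one piece, and the Levy mass of that piece is, up to a Gamma factor, the spectral mass off
  \<open>prob_measures\<close>.\<close>

definition exp_neg :: "ennreal \<Rightarrow> real" where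
  "exp_neg x = (if x = \<top> then 0 else exp (- enn2real x))"

lemma exp_neg_nonneg [simp]: "0 \<le> exp_neg x"
  by (simp add: exp_neg_def)

lemma exp_neg_le_1 [simp]: "exp_neg x \<le> 1"
  by (simp add: exp_neg_def)

lemma exp_neg_0 [simp]: "exp_neg 0 = 1"
  by (simp add: exp_neg_def)

lemma exp_neg_top [simp]: "exp_neg \<top> = 0"
  by (simp add: exp_neg_def)

lemma exp_neg_ennreal: "0 \<le> r \<Longrightarrow> exp_neg (ennreal r) = exp (- r)"
  by (simp add: exp_neg_def)

lemma exp_neg_add: "exp_neg (a + b) = exp_neg a * exp_neg b"
  by (auto simp: exp_neg_def enn2real_plus less_top exp_add[symmetric])

lemma exp_neg_sum: "finite A \<Longrightarrow> exp_neg (\<Sum>i\<in>A. f i) = (\<Prod>i\<in>A. exp_neg (f i))"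
  by (induction A rule: finite_induct) (auto simp: exp_neg_add)

lemma exp_neg_measurable [measurable]: "exp_neg \<in> borel_measurable borel"
  unfolding exp_neg_def [abs_def] by measurable

lemma exp_neg_mult_of_nat: "0 \<le> r \<Longrightarrow> exp_neg (ennreal r * of_nat k) = exp (- r) ^ k"
  by (simp add: exp_neg_def ennreal_of_nat_eq_real_of_nat ennreal_mult'[symmetric] exp_of_nat_mult[symmetric]
      mult.commute)

text \<open>The point is continuity at \<open>\<top>\<close>, where \<open>enn2real\<close> jumps to
  0 and the other branch of \<open>exp_neg\<close> takes over. It allows limits of partial sums that
  may diverge.\<close>

lemma tendsto_exp_neg:
  assumes "(X \<longlongrightarrow> x) F"
  shows "((\<lambda>n. exp_neg (X n)) \<longlongrightarrow> exp_neg x) F"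
proof (cases "x = \<top>")
  case False
  have "eventually (\<lambda>n. X n < \<top>) F"
    using order_tendstoD(2)[OF assms] False by (simp add: less_top)
  then have "eventually (\<lambda>n. exp (- enn2real (X n)) = exp_neg (X n)) F"
    by eventually_elim (auto simp: exp_neg_def)
  moreover have "((\<lambda>n. exp (- enn2real (X n))) \<longlongrightarrow> exp (- enn2real x)) F"
    by (intro tendsto_exp tendsto_minus tendsto_enn2real) (use assms False in \<open>auto simp: less_top\<close>)
  ultimately show ?thesis
    using False by (auto simp: exp_neg_def intro: Lim_transform_eventually)
next
  case True
  have "eventually (\<lambda>n. exp_neg (X n) < e) F" if "0 < e" for e
  proof -
    have "eventually (\<lambda>n. ennreal (- ln e) < X n) F"
      using order_tendstoD(1)[OF assms] True by simp
    then show ?thesis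
    proof eventually_elim
      case (elim n)
      show ?case
      proof (cases "X n")
        case (real r)
        have "- ln e < r"
          using elim real by (metis ennreal_lessI ennreal_neg linorder_not_less ennreal_leI)
        then have "exp (- r) < exp (ln e)" by simp
        then show ?thesis using real \<open>0 < e\<close> by (simp add: exp_neg_def)
      qed (use \<open>0 < e\<close> in simp)
    qed
  qed
  then show ?thesis
    using True by (auto intro!: order_tendstoI elim: eventually_mono
      intro: always_eventually less_le_trans[OF _ exp_neg_nonneg])
qed

text \<open>Equality is available only for \<open>0 < s < 1\<close>, since \<open>s\<close> will be
  \<open>exp (- r)\<close> with \<open>0 < r\<close>; so coefficients are peeled off by letting
  \<open>s\<close> tend to 0. Once the lower coefficients of the difference vanish, coefficient
  \<open>m\<close> is minus \<open>s\<close> times a tail that stays bounded.\<close>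

lemma powser_eq_on_unit_interval_imp_eq:
  fixes a b :: "nat \<Rightarrow> real"
  assumes "summable a" "summable b" "\<And>k. 0 \<le> a k" "\<And>k. 0 \<le> b k"
    and eq: "\<And>s. 0 < s \<Longrightarrow> s < 1 \<Longrightarrow> (\<Sum>k. a k * s ^ k) = (\<Sum>k. b k * s ^ k)"
  shows "a = b"
proof -
  define c where "c k = a k - b k" for k
  have sc: "summable (\<lambda>k. norm (c k))"
    by (rule summable_comparison_test'[OF summable_add[OF assms(1,2)], of 0])
       (use assms(3,4) in \<open>auto simp: c_def abs_le_iff add_increasing add_increasing2\<close>)
  have ss: "summable (\<lambda>k. d k * s ^ k)" if "summable (\<lambda>k. norm (d k))" "0 < s" "s < 1" for s and d :: "nat \<Rightarrow> real"
    by (rule summable_comparison_test'[OF that(1), of 0])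
       (use that(2,3) in \<open>auto simp: abs_mult power_le_one mult_left_le\<close>)
  have c0: "(\<Sum>k. c k * s ^ k) = 0" if "0 < s" "s < 1" for s
  proof -
    have "(\<Sum>k. c k * s ^ k) = (\<Sum>k. a k * s ^ k) - (\<Sum>k. b k * s ^ k)"
      by (subst suminf_diff) (use assms that in \<open>auto intro!: ss simp: c_def algebra_simps\<close>)
    then show ?thesis using eq[OF that] by simp
  qed
  have "c m = 0" for m
  proof (induction m rule: less_induct)
    case (less m)
    define C where "C = (\<Sum>k. norm (c (k + Suc m)))"
    have sC: "summable (\<lambda>k. norm (c (k + Suc m)))" using sc by (subst summable_iff_shift)
    have "C \<ge> 0" unfolding C_def by (rule suminf_nonneg[OF sC]) simp
    have bound: "\<bar>c m\<bar> \<le> s * C" if s: "0 < s" "s < 1" for s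
    proof -
      have sumc: "summable (\<lambda>k. c k * s ^ k)" by (rule ss[OF sc s])
      have "0 = (\<Sum>k. c (k + Suc m) * s ^ (k + Suc m)) + (\<Sum>k<Suc m. c k * s ^ k)"
        using suminf_split_initial_segment[OF sumc, of "Suc m"] c0[OF s] by simp
      also have "(\<Sum>k<Suc m. c k * s ^ k) = c m * s ^ m"
        using less by (simp add: lessThan_Suc)
      also have "(\<Sum>k. c (k + Suc m) * s ^ (k + Suc m)) = s ^ Suc m * (\<Sum>k. c (k + Suc m) * s ^ k)"
        by (subst suminf_mult[symmetric]) (use ss[OF sC s] in \<open>auto simp: power_add ac_simps\<close>)
      finally have "s ^ m * c m = s ^ m * (- (s * (\<Sum>k. c (k + Suc m) * s ^ k)))"
        by (simp add: algebra_simps eq_neg_iff_add_eq_0)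
      then have cm: "c m = - (s * (\<Sum>k. c (k + Suc m) * s ^ k))" using s by (subst (asm) mult_left_cancel) simp_all
      have "norm (\<Sum>k. c (k + Suc m) * s ^ k) \<le> (\<Sum>k. norm (c (k + Suc m) * s ^ k))"
        by (rule summable_norm)
           (rule summable_comparison_test'[OF sC, of 0],
             use s in \<open>auto simp: abs_mult power_le_one mult_left_le\<close>)
      also have "\<dots> \<le> C"
        unfolding C_def
        by (rule suminf_le) (use s in \<open>auto intro!: sC summable_comparison_test'[OF sC, of 0]
            simp: abs_mult power_le_one mult_left_le\<close>)
      finally show ?thesis using cm s by (simp add: abs_mult)
    qed
    \<comment> \<open>The sample points \<open>s = 1 / (n + 2)\<close> lie strictly below 1, already
      for \<open>n = 0\<close>.\<close>
    have "(\<lambda>n. inverse (real (Suc (Suc n))) * C) \<longlonglongrightarrow> 0 * C"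
      by (intro tendsto_mult tendsto_const LIMSEQ_Suc[OF LIMSEQ_inverse_real_of_nat])
    moreover have "\<bar>c m\<bar> \<le> inverse (real (Suc (Suc n))) * C" for n
      by (rule bound) (auto simp: field_simps)
    ultimately have "\<bar>c m\<bar> \<le> 0 * C"
      by (intro LIMSEQ_le_const) auto
    then show ?case by simp
  qed
  then show ?thesis by (auto simp: c_def)
qed

text \<open>With \<open>s = exp (- r)\<close> the factor \<open>exp_neg\<close> is
  \<open>s ^ N\<close>, so the integral is a power series in \<open>s\<close> whose coefficients are
  the weighted masses of the events \<open>N = k\<close>. The weight \<open>f\<close> is there for
  the induction over several counts.\<close>

lemma nn_integral_exp_neg_eq_suminf:
  assumes [measurable]: "N \<in> borel_measurable M" "f \<in> borel_measurable M"
    and range: "\<And>\<omega>. \<omega> \<in> space M \<Longrightarrow> N \<omega> \<in> range of_nat \<union> {\<top>}" and "0 < r"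
  shows "(\<integral>\<^sup>+\<omega>. f \<omega> * ennreal (exp_neg (ennreal r * N \<omega>)) \<partial>M)
       = (\<Sum>k. (\<integral>\<^sup>+\<omega>. f \<omega> * indicator {\<omega>\<in>space M. N \<omega> = of_nat k} \<omega> \<partial>M) * ennreal (exp (- r) ^ k))"
proof -
  have "(\<integral>\<^sup>+\<omega>. f \<omega> * ennreal (exp_neg (ennreal r * N \<omega>)) \<partial>M)
      = (\<integral>\<^sup>+\<omega>. (\<Sum>k. f \<omega> * indicator {\<omega>\<in>space M. N \<omega> = of_nat k} \<omega> * ennreal (exp (- r) ^ k)) \<partial>M)"
  proof (rule nn_integral_cong)
    fix \<omega> assume \<omega>: "\<omega> \<in> space M"
    show "f \<omega> * ennreal (exp_neg (ennreal r * N \<omega>))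
      = (\<Sum>k. f \<omega> * indicator {\<omega>\<in>space M. N \<omega> = of_nat k} \<omega> * ennreal (exp (- r) ^ k))"
    proof (cases "N \<omega> = \<top>")
      case True
      \<comment> \<open>An infinite count contributes 0 on both sides: \<open>0 < r\<close> makes
        \<open>r * \<top>\<close> infinite, and no \<open>of_nat k\<close> equals
        \<open>\<top>\<close>.\<close>
      then show ?thesis using \<open>0 < r\<close> by (auto simp: ennreal_mult_top)
    next
      case False
      then obtain n where n: "N \<omega> = of_nat n" using range[OF \<omega>] by auto
      have "(\<Sum>k. f \<omega> * indicator {\<omega>\<in>space M. N \<omega> = of_nat k} \<omega> * ennreal (exp (- r) ^ k))
          = (\<Sum>k\<in>{n}. f \<omega> * indicator {\<omega>\<in>space M. N \<omega> = of_nat k} \<omega> * ennreal (exp (- r) ^ k))"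
        by (rule suminf_finite) (auto simp: n)
      then show ?thesis using n \<omega> \<open>0 < r\<close> by (simp add: exp_neg_mult_of_nat)
    qed
  qed
  also have "\<dots> = (\<Sum>k. \<integral>\<^sup>+\<omega>. f \<omega> * indicator {\<omega>\<in>space M. N \<omega> = of_nat k} \<omega> * ennreal (exp (- r) ^ k) \<partial>M)"
    by (rule nn_integral_suminf) measurable
  also have "\<dots> = (\<Sum>k. (\<integral>\<^sup>+\<omega>. f \<omega> * indicator {\<omega>\<in>space M. N \<omega> = of_nat k} \<omega> \<partial>M) * ennreal (exp (- r) ^ k))"
    by (intro suminf_cong nn_integral_multc) measurable
  finally show ?thesis .
qed

text \<open>Coefficient comparison for two power series in \<open>exp (- r)\<close>. Finite weights
  make both series summable at \<open>s = 1\<close>, as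
  \<open>powser_eq_on_unit_interval_imp_eq\<close> requires.\<close>

lemma laplace_eq_imp_weighted_eq:
  fixes f :: "'x \<Rightarrow> ennreal" and g :: "'y \<Rightarrow> ennreal"
  assumes [measurable]: "N \<in> borel_measurable M" "f \<in> borel_measurable M"
    and rM: "\<And>\<omega>. \<omega> \<in> space M \<Longrightarrow> N \<omega> \<in> range of_nat \<union> {\<top>}"
    and [measurable]: "N' \<in> borel_measurable M'" "g \<in> borel_measurable M'"
    and rM': "\<And>\<omega>. \<omega> \<in> space M' \<Longrightarrow> N' \<omega> \<in> range of_nat \<union> {\<top>}"
    and fin: "(\<integral>\<^sup>+\<omega>. f \<omega> \<partial>M) < \<top>" "(\<integral>\<^sup>+\<omega>. g \<omega> \<partial>M') < \<top>"
    and eq: "\<And>r. 0 < r \<Longrightarrow> (\<integral>\<^sup>+\<omega>. f \<omega> * ennreal (exp_neg (ennreal r * N \<omega>)) \<partial>M)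
           = (\<integral>\<^sup>+\<omega>. g \<omega> * ennreal (exp_neg (ennreal r * N' \<omega>)) \<partial>M')"
  shows "(\<integral>\<^sup>+\<omega>. f \<omega> * indicator {\<omega>\<in>space M. N \<omega> = of_nat k} \<omega> \<partial>M)
       = (\<integral>\<^sup>+\<omega>. g \<omega> * indicator {\<omega>\<in>space M'. N' \<omega> = of_nat k} \<omega> \<partial>M')"
proof -
  define A where "A k = (\<integral>\<^sup>+\<omega>. f \<omega> * indicator {\<omega>\<in>space M. N \<omega> = of_nat k} \<omega> \<partial>M)" for k
  define B where "B k = (\<integral>\<^sup>+\<omega>. g \<omega> * indicator {\<omega>\<in>space M'. N' \<omega> = of_nat k} \<omega> \<partial>M')" for k
  \<comment> \<open>The events \<open>n = of_nat k\<close> are disjoint in \<open>k\<close>, so the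
    coefficients of a series sum to at most the integral of its weight.\<close>
  have disj: "(\<Sum>k. (c::ennreal) * indicator {\<omega>\<in>X. n \<omega> = of_nat k} x) \<le> c"
    for c and n :: "'z \<Rightarrow> ennreal" and x X
  proof -
    have "(\<Sum>k. indicator {\<omega>\<in>X. n \<omega> = of_nat k} x :: ennreal) = indicator (\<Union>k. {\<omega>\<in>X. n \<omega> = of_nat k}) x"
      by (rule suminf_indicator) (auto simp: disjoint_family_on_def)
    then have "(\<Sum>k. c * indicator {\<omega>\<in>X. n \<omega> = of_nat k} x) = c * indicator (\<Union>k. {\<omega>\<in>X. n \<omega> = of_nat k}) x"
      by simp
    also have "\<dots> \<le> c" by (auto split: split_indicator)
    finally show ?thesis .
  qed
  have "(\<Sum>k. A k) = (\<integral>\<^sup>+\<omega>. (\<Sum>k. f \<omega> * indicator {\<omega>\<in>space M. N \<omega> = of_nat k} \<omega>) \<partial>M)"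
    unfolding A_def by (rule nn_integral_suminf[symmetric]) measurable
  also have "\<dots> \<le> (\<integral>\<^sup>+\<omega>. f \<omega> \<partial>M)" by (intro nn_integral_mono disj)
  finally have sA: "(\<Sum>k. A k) < \<top>" using fin(1) by (rule le_less_trans)
  have "(\<Sum>k. B k) = (\<integral>\<^sup>+\<omega>. (\<Sum>k. g \<omega> * indicator {\<omega>\<in>space M'. N' \<omega> = of_nat k} \<omega>) \<partial>M')"
    unfolding B_def by (rule nn_integral_suminf[symmetric]) measurable
  also have "\<dots> \<le> (\<integral>\<^sup>+\<omega>. g \<omega> \<partial>M')" by (intro nn_integral_mono disj)
  finally have sB: "(\<Sum>k. B k) < \<top>" using fin(2) by (rule le_less_trans)
  \<comment> \<open>Passage from series in \<open>ennreal\<close> to real series: every coefficient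
    is finite, and the factors \<open>s ^ k\<close> keep summability.\<close>
  have fact: "summable (\<lambda>k. enn2real (X k))" "X k < \<top>"
      "0 < s \<Longrightarrow> s < 1 \<Longrightarrow> ennreal (\<Sum>k. enn2real (X k) * s ^ k) = (\<Sum>k. X k * ennreal (s ^ k))"
    if X: "(\<Sum>k. X k) < \<top>" for X :: "nat \<Rightarrow> ennreal" and k s
  proof -
    have lt: "X k < \<top>" for k
    proof -
      have "X k = (\<Sum>j\<in>{k}. X j)" by simp
      also have "\<dots> \<le> (\<Sum>k. X k)" by (rule sum_le_suminf) auto
      finally show ?thesis using X by (rule le_less_trans)
    qed
    then show "X k < \<top>" .
    show sm: "summable (\<lambda>k. enn2real (X k))"
      by (rule summable_suminf_not_top) (use X lt in \<open>auto simp: less_top\<close>)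
    assume s: "0 < s" "s < 1"
    have "(\<Sum>k. X k * ennreal (s ^ k)) = (\<Sum>k. ennreal (enn2real (X k) * s ^ k))"
      using lt s by (intro suminf_cong) (simp add: ennreal_mult less_top)
    also have "\<dots> = ennreal (\<Sum>k. enn2real (X k) * s ^ k)"
      by (rule suminf_ennreal2) (use s in \<open>auto intro!: summable_comparison_test'[OF sm, of 0]
          simp: abs_mult power_le_one mult_left_le\<close>)
    finally show "ennreal (\<Sum>k. enn2real (X k) * s ^ k) = (\<Sum>k. X k * ennreal (s ^ k))" by simp
  qed
  have "(\<lambda>k. enn2real (A k)) = (\<lambda>k. enn2real (B k))"
  proof (rule powser_eq_on_unit_interval_imp_eq)
    fix s :: real assume s: "0 < s" "s < 1"
    define r where "r = - ln s"
    have r: "0 < r" "exp (- r) = s" using s by (auto simp: r_def)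
    have "(\<Sum>k. A k * ennreal (s ^ k)) = (\<Sum>k. B k * ennreal (s ^ k))"
      using eq[OF r(1)] nn_integral_exp_neg_eq_suminf[OF assms(1,2) rM r(1)]
        nn_integral_exp_neg_eq_suminf[OF assms(4,5) rM' r(1)] r
      by (simp add: A_def B_def)
    then have "ennreal (\<Sum>k. enn2real (A k) * s ^ k) = ennreal (\<Sum>k. enn2real (B k) * s ^ k)"
      using fact(3)[OF sA s] fact(3)[OF sB s] by simp
    moreover have "0 \<le> (\<Sum>k. enn2real (X k) * s ^ k)" if "(\<Sum>k. X k) < \<top>" for X
      by (rule suminf_nonneg) (use s in \<open>auto intro!: summable_comparison_test'[OF fact(1)[OF that], of 0]
          simp: abs_mult power_le_one mult_left_le\<close>)
    ultimately show "(\<Sum>k. enn2real (A k) * s ^ k) = (\<Sum>k. enn2real (B k) * s ^ k)"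
      using sA sB by (subst (asm) ennreal_inj) auto
  qed (use fact(1) sA sB in auto)
  then have "enn2real (A k) = enn2real (B k)" by metis
  then have "A k = B k" using fact(2)[OF sA, of k] fact(2)[OF sB, of k]
    by (metis ennreal_enn2real_if less_irrefl)
  then show ?thesis by (simp add: A_def B_def)
qed

text \<open>One coordinate is fixed at a time. The weights are arbitrary so that they can absorb the
  indicator of a coordinate already fixed and, in turn, the Laplace factors of the remaining
  ones.\<close>

lemma joint_laplace_eq_imp_weighted_eq:
  fixes f :: "'x \<Rightarrow> ennreal" and g :: "'y \<Rightarrow> ennreal"
  assumes "finite I"
    and "\<And>i. i \<in> I \<Longrightarrow> N i \<in> borel_measurable M"
    and "\<And>i \<omega>. i \<in> I \<Longrightarrow> \<omega> \<in> space M \<Longrightarrow> N i \<omega> \<in> range of_nat \<union> {\<top>}"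
    and "\<And>i. i \<in> I \<Longrightarrow> N' i \<in> borel_measurable M'"
    and "\<And>i \<omega>. i \<in> I \<Longrightarrow> \<omega> \<in> space M' \<Longrightarrow> N' i \<omega> \<in> range of_nat \<union> {\<top>}"
    and "f \<in> borel_measurable M" "g \<in> borel_measurable M'"
    and "(\<integral>\<^sup>+\<omega>. f \<omega> \<partial>M) < \<top>" "(\<integral>\<^sup>+\<omega>. g \<omega> \<partial>M') < \<top>"
    and "\<And>r. (\<And>i. i \<in> I \<Longrightarrow> 0 < r i) \<Longrightarrow>
             (\<integral>\<^sup>+\<omega>. f \<omega> * (\<Prod>i\<in>I. ennreal (exp_neg (ennreal (r i) * N i \<omega>))) \<partial>M)
           = (\<integral>\<^sup>+\<omega>. g \<omega> * (\<Prod>i\<in>I. ennreal (exp_neg (ennreal (r i) * N' i \<omega>))) \<partial>M')"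
  shows "(\<integral>\<^sup>+\<omega>. f \<omega> * (\<Prod>i\<in>I. indicator {\<omega>\<in>space M. N i \<omega> = of_nat (k i)} \<omega>) \<partial>M)
       = (\<integral>\<^sup>+\<omega>. g \<omega> * (\<Prod>i\<in>I. indicator {\<omega>\<in>space M'. N' i \<omega> = of_nat (k i)} \<omega>) \<partial>M')"
  using assms
proof (induction I arbitrary: f g rule: finite_induct)
  case empty
  then show ?case by simp
next
  case (insert j I)
  note [measurable] = insert.prems(5,6)
  have mI [measurable]: "N i \<in> borel_measurable M" "N' i \<in> borel_measurable M'" if "i \<in> I" for i
    using that insert.prems(1,3) by auto
  have mj [measurable]: "N j \<in> borel_measurable M" "N' j \<in> borel_measurable M'"
    using insert.prems(1,3) by auto
  let ?P = "\<lambda>r \<omega>. \<Prod>i\<in>I. ennreal (exp_neg (ennreal (r i) * N i \<omega>))"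
  let ?P' = "\<lambda>r \<omega>. \<Prod>i\<in>I. ennreal (exp_neg (ennreal (r i) * N' i \<omega>))"
  have le1: "(\<Prod>i\<in>I. ennreal (exp_neg (h i))) \<le> 1" for h :: "'a \<Rightarrow> ennreal"
    by (simp add: prod_ennreal prod_le_1)
  let ?f = "\<lambda>\<omega>. f \<omega> * indicator {\<omega>\<in>space M. N j \<omega> = of_nat (k j)} \<omega>"
  let ?g = "\<lambda>\<omega>. g \<omega> * indicator {\<omega>\<in>space M'. N' j \<omega> = of_nat (k j)} \<omega>"
  have "(\<integral>\<^sup>+\<omega>. ?f \<omega> * (\<Prod>i\<in>I. indicator {\<omega>\<in>space M. N i \<omega> = of_nat (k i)} \<omega>) \<partial>M)
       = (\<integral>\<^sup>+\<omega>. ?g \<omega> * (\<Prod>i\<in>I. indicator {\<omega>\<in>space M'. N' i \<omega> = of_nat (k i)} \<omega>) \<partial>M')"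
  proof (rule insert.IH)
    show "?f \<in> borel_measurable M" "?g \<in> borel_measurable M'" by measurable
    show "(\<integral>\<^sup>+\<omega>. ?f \<omega> \<partial>M) < \<top>"
      by (rule le_less_trans[OF nn_integral_mono insert.prems(7)]) (auto split: split_indicator)
    show "(\<integral>\<^sup>+\<omega>. ?g \<omega> \<partial>M') < \<top>"
      by (rule le_less_trans[OF nn_integral_mono insert.prems(8)]) (auto split: split_indicator)
    fix r :: "'a \<Rightarrow> real" assume r: "\<And>i. i \<in> I \<Longrightarrow> 0 < r i"
    have "(\<integral>\<^sup>+\<omega>. (f \<omega> * ?P r \<omega>) * indicator {\<omega>\<in>space M. N j \<omega> = of_nat (k j)} \<omega> \<partial>M)
        = (\<integral>\<^sup>+\<omega>. (g \<omega> * ?P' r \<omega>) * indicator {\<omega>\<in>space M'. N' j \<omega> = of_nat (k j)} \<omega> \<partial>M')"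
    \<comment> \<open>The Laplace factors of the other coordinates go into the weight, which leaves
      the one-variable statement for \<open>j\<close>.\<close>
    proof (rule laplace_eq_imp_weighted_eq)
      show "(\<lambda>\<omega>. f \<omega> * ?P r \<omega>) \<in> borel_measurable M" "(\<lambda>\<omega>. g \<omega> * ?P' r \<omega>) \<in> borel_measurable M'"
        by measurable
      show "(\<integral>\<^sup>+\<omega>. f \<omega> * ?P r \<omega> \<partial>M) < \<top>"
        by (rule le_less_trans[OF nn_integral_mono insert.prems(7)]) (use mult_left_mono[OF le1, where c="f _"] in auto)
      show "(\<integral>\<^sup>+\<omega>. g \<omega> * ?P' r \<omega> \<partial>M') < \<top>"
        by (rule le_less_trans[OF nn_integral_mono insert.prems(8)]) (use mult_left_mono[OF le1, where c="g _"] in auto)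
      fix s :: real assume s: "0 < s"
      define r' where "r' = r(j := s)"
      have *: "(\<Prod>i\<in>insert j I. ennreal (exp_neg (ennreal (r' i) * h i)))
            = ennreal (exp_neg (ennreal s * h j)) * (\<Prod>i\<in>I. ennreal (exp_neg (ennreal (r i) * h i)))"
        for h :: "'a \<Rightarrow> ennreal"
        using insert.hyps by (auto simp: r'_def intro!: arg_cong2[where f="(*)"] prod.cong)
      have pos: "0 < r' i" if "i \<in> insert j I" for i
        using that r s by (auto simp: r'_def)
      show "(\<integral>\<^sup>+\<omega>. f \<omega> * ?P r \<omega> * ennreal (exp_neg (ennreal s * N j \<omega>)) \<partial>M) =
        (\<integral>\<^sup>+\<omega>. g \<omega> * ?P' r \<omega> * ennreal (exp_neg (ennreal s * N' j \<omega>)) \<partial>M')"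
        using insert.prems(9)[of r', OF pos] unfolding * by (auto simp: r'_def ac_simps)
    qed (use insert.prems in auto)
    then show "(\<integral>\<^sup>+\<omega>. ?f \<omega> * ?P r \<omega> \<partial>M) = (\<integral>\<^sup>+\<omega>. ?g \<omega> * ?P' r \<omega> \<partial>M')"
      by (simp add: ac_simps)
  qed (use insert.prems in auto)
  then show ?case using insert.hyps by (simp add: ac_simps)
qed

text \<open>The two measures may live on different spaces, so one of them can serve as a reference
  model whose joint law is known: later the Poisson distribution and a product measure.\<close>

lemma joint_laplace_eq_imp_joint_law_eq:
  assumes M: "finite_measure M" "finite_measure M'"
    and "finite I"
    and m: "\<And>i. i \<in> I \<Longrightarrow> N i \<in> borel_measurable M"
    and range: "\<And>i \<omega>. i \<in> I \<Longrightarrow> \<omega> \<in> space M \<Longrightarrow> N i \<omega> \<in> range of_nat \<union> {\<top>}"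
    and m': "\<And>i. i \<in> I \<Longrightarrow> N' i \<in> borel_measurable M'"
    and range': "\<And>i \<omega>. i \<in> I \<Longrightarrow> \<omega> \<in> space M' \<Longrightarrow> N' i \<omega> \<in> range of_nat \<union> {\<top>}"
    and eq: "\<And>r. (\<And>i. i \<in> I \<Longrightarrow> 0 < r i) \<Longrightarrow>
             (\<integral>\<^sup>+\<omega>. ennreal (exp_neg (\<Sum>i\<in>I. ennreal (r i) * N i \<omega>)) \<partial>M)
           = (\<integral>\<^sup>+\<omega>. ennreal (exp_neg (\<Sum>i\<in>I. ennreal (r i) * N' i \<omega>)) \<partial>M')"
  shows "emeasure M {\<omega>\<in>space M. \<forall>i\<in>I. N i \<omega> = of_nat (k i)}
       = emeasure M' {\<omega>\<in>space M'. \<forall>i\<in>I. N' i \<omega> = of_nat (k i)}"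
proof -
  interpret M: finite_measure M by fact
  interpret M': finite_measure M' by fact
  note [measurable] = m m' \<open>finite I\<close>
  have "(\<integral>\<^sup>+\<omega>. 1 * (\<Prod>i\<in>I. indicator {\<omega>\<in>space M. N i \<omega> = of_nat (k i)} \<omega>) \<partial>M)
      = (\<integral>\<^sup>+\<omega>. 1 * (\<Prod>i\<in>I. indicator {\<omega>\<in>space M'. N' i \<omega> = of_nat (k i)} \<omega>) \<partial>M')"
    by (rule joint_laplace_eq_imp_weighted_eq)
       (use assms in \<open>auto simp: exp_neg_sum prod_ennreal M.emeasure_finite M'.emeasure_finite less_top[symmetric]\<close>)
  moreover have "(\<integral>\<^sup>+\<omega>. 1 * (\<Prod>i\<in>I. indicator {\<omega>\<in>space M. N i \<omega> = of_nat (k i)} \<omega>) \<partial>M)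
      = (\<integral>\<^sup>+\<omega>. indicator {\<omega>\<in>space M. \<forall>i\<in>I. N i \<omega> = of_nat (k i)} \<omega> \<partial>M)"
    by (intro nn_integral_cong) (use \<open>finite I\<close> in \<open>auto simp: indicator_def\<close>)
  moreover have "(\<integral>\<^sup>+\<omega>. 1 * (\<Prod>i\<in>I. indicator {\<omega>\<in>space M'. N' i \<omega> = of_nat (k i)} \<omega>) \<partial>M')
      = (\<integral>\<^sup>+\<omega>. indicator {\<omega>\<in>space M'. \<forall>i\<in>I. N' i \<omega> = of_nat (k i)} \<omega> \<partial>M')"
    by (intro nn_integral_cong) (use \<open>finite I\<close> in \<open>auto simp: indicator_def\<close>)
  ultimately show ?thesis by simp
qed

section \<open>Counting measures and generating functionals\<close>

lemma space_radon_space: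
  "space (radon_space :: 'a::topological_space measure measure)
    = {\<mu>. sets \<mu> = sets borel \<and> (\<forall>A\<in>sets borel. rel_compact A \<longrightarrow> emeasure \<mu> A < \<infinity>)}"
  by (auto simp add: radon_space_def space_Sup_eq_UN)

lemma measurable_emeasure_radon_space [measurable]:
  "A \<in> sets borel \<Longrightarrow> (\<lambda>\<mu>. emeasure \<mu> A) \<in> borel_measurable radon_space"
  by (auto intro!: measurable_Sup1 measurable_vimage_algebra1 simp: radon_space_def)

lemma measurable_radon_space:
  assumes "\<And>\<omega>. \<omega> \<in> space M \<Longrightarrow> f \<omega> \<in> space radon_space"
    and "\<And>A. A \<in> sets borel \<Longrightarrow> (\<lambda>\<omega>. emeasure (f \<omega>) A) \<in> borel_measurable M"
  shows "f \<in> M \<rightarrow>\<^sub>M radon_space"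
  unfolding radon_space_def
  by (rule measurable_Sup2)
     (use assms in \<open>auto intro!: measurable_vimage_algebra2 simp: space_radon_space\<close>)

lemma sets_radon_space: "\<mu> \<in> space radon_space \<Longrightarrow> sets \<mu> = sets borel"
  by (simp add: space_radon_space)

lemma space_counting_space:
  "space counting_space = space radon_space \<inter> {\<mu>. \<exists>I x. \<mu> = dirac_sum borel I x}"
  by (auto simp: counting_space_def space_restrict_space)

lemma sets_counting_space: "\<mu> \<in> space counting_space \<Longrightarrow> sets \<mu> = sets borel"
  by (simp add: space_counting_space space_radon_space)

lemma measurable_emeasure_counting_space [measurable]:
  "A \<in> sets borel \<Longrightarrow> (\<lambda>\<mu>. emeasure \<mu> A) \<in> borel_measurable counting_space"
  unfolding counting_space_def
  by (intro measurable_restrict_space1 measurable_emeasure_radon_space)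

lemma measurable_counting_space:
  assumes "\<And>\<omega>. \<omega> \<in> space M \<Longrightarrow> f \<omega> \<in> space counting_space"
    and "\<And>A. A \<in> sets borel \<Longrightarrow> (\<lambda>\<omega>. emeasure (f \<omega>) A) \<in> borel_measurable M"
  shows "f \<in> M \<rightarrow>\<^sub>M counting_space"
  unfolding counting_space_def
  by (rule measurable_restrict_space2)
     (use assms in \<open>auto intro!: measurable_radon_space simp: space_counting_space\<close>)

text \<open>The measures \<open>f \<omega>\<close> may be infinite; their evaluations are
  measurable, and \<open>h\<close> is built up from indicators by monotone approximation.\<close>

lemma measurable_nn_integral_kernel:
  assumes sets_f: "\<And>\<omega>. \<omega> \<in> space M \<Longrightarrow> sets (f \<omega>) = sets N"
    and em: "\<And>A. A \<in> sets N \<Longrightarrow> (\<lambda>\<omega>. emeasure (f \<omega>) A) \<in> borel_measurable M"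
    and h: "h \<in> borel_measurable N"
  shows "(\<lambda>\<omega>. \<integral>\<^sup>+x. h x \<partial>f \<omega>) \<in> borel_measurable M"
  using h
proof (induction h rule: borel_measurable_induct)
  case (cong g h)
  have "(\<integral>\<^sup>+x. g x \<partial>f \<omega>) = (\<integral>\<^sup>+x. h x \<partial>f \<omega>)" if "\<omega> \<in> space M" for \<omega>
    using cong sets_eq_imp_space_eq[OF sets_f[OF that]] by (intro nn_integral_cong) auto
  then show ?case using cong by (simp cong: measurable_cong)
next
  case (set A)
  have "(\<lambda>\<omega>. \<integral>\<^sup>+x. indicator A x \<partial>f \<omega>) \<in> borel_measurable M
    \<longleftrightarrow> (\<lambda>\<omega>. emeasure (f \<omega>) A) \<in> borel_measurable M"
    by (intro measurable_cong nn_integral_indicator) (simp add: sets_f set)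
  then show ?case using em[OF set] by simp
next
  case (mult u c)
  have "(\<lambda>\<omega>. \<integral>\<^sup>+x. c * u x \<partial>f \<omega>) \<in> borel_measurable M
    \<longleftrightarrow> (\<lambda>\<omega>. c * \<integral>\<^sup>+x. u x \<partial>f \<omega>) \<in> borel_measurable M"
    by (intro measurable_cong nn_integral_cmult)
       (use mult in \<open>simp add: sets_f cong: measurable_cong_sets\<close>)
  then show ?case using mult by simp
next
  case (add u v)
  have "(\<lambda>\<omega>. \<integral>\<^sup>+x. v x + u x \<partial>f \<omega>) \<in> borel_measurable M
    \<longleftrightarrow> (\<lambda>\<omega>. (\<integral>\<^sup>+x. v x \<partial>f \<omega>) + (\<integral>\<^sup>+x. u x \<partial>f \<omega>)) \<in> borel_measurable M"
    by (intro measurable_cong nn_integral_add)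
       (use add in \<open>simp_all add: sets_f cong: measurable_cong_sets\<close>)
  then show ?case using add by simp
next
  case (seq U)
  have "(\<lambda>\<omega>. \<integral>\<^sup>+x. (SUP i. U i) x \<partial>f \<omega>) \<in> borel_measurable M
    \<longleftrightarrow> (\<lambda>\<omega>. SUP i. \<integral>\<^sup>+x. U i x \<partial>f \<omega>) \<in> borel_measurable M"
    unfolding SUP_apply
    by (intro measurable_cong nn_integral_monotone_convergence_SUP)
       (use seq in \<open>simp_all add: sets_f cong: measurable_cong_sets\<close>)
  then show ?case using seq by simp
qed

lemma measurable_nn_integral_counting_space [measurable]:
  "h \<in> borel_measurable borel \<Longrightarrow> (\<lambda>\<mu>. \<integral>\<^sup>+x. h x \<partial>\<mu>) \<in> borel_measurable counting_space"
  by (rule measurable_nn_integral_kernel[where N=borel]) (auto simp: sets_counting_space)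

section \<open>Superpositions and sums of unit masses\<close>

lemma sets_superposition [simp, measurable_cong]: "sets (superposition M I N) = sets M"
  by (simp add: superposition_def)

lemma space_superposition [simp]: "space (superposition M I N) = space M"
  by (simp add: superposition_def space_measure_of_conv)

text \<open>Countable additivity is the exchange of two sums of nonnegative terms, one of them over
  an index set of any size.\<close>

lemma emeasure_superposition:
  assumes "\<And>i. i \<in> I \<Longrightarrow> sets (N i) = sets M" "A \<in> sets M"
  shows "emeasure (superposition M I N) A = (\<integral>\<^sup>+i. emeasure (N i) A \<partial>count_space I)"
  unfolding superposition_def
proof (rule emeasure_measure_of_sigma)
  show "countably_additive (sets M) (\<lambda>A. \<integral>\<^sup>+i. emeasure (N i) A \<partial>count_space I)"
  proof (rule countably_additiveI)
    fix A :: "nat \<Rightarrow> _ set"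
    assume A: "range A \<subseteq> sets M" "disjoint_family A" "(\<Union>i. A i) \<in> sets M"
    have "(\<Sum>k. \<integral>\<^sup>+i. emeasure (N i) (A k) \<partial>count_space I)
        = (\<integral>\<^sup>+i. (\<Sum>k. emeasure (N i) (A k)) \<partial>count_space I)"
      by (rule nn_integral_suminf[symmetric]) simp
    also have "\<dots> = (\<integral>\<^sup>+i. emeasure (N i) (\<Union>k. A k) \<partial>count_space I)"
      by (rule nn_integral_cong, rule suminf_emeasure) (use A assms(1) in auto)
    finally show "(\<Sum>k. \<integral>\<^sup>+i. emeasure (N i) (A k) \<partial>count_space I)
        = (\<integral>\<^sup>+i. emeasure (N i) (\<Union>k. A k) \<partial>count_space I)" .
  qed
qed (auto simp: positive_def assms sets.sigma_algebra_axioms)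

lemma nn_integral_superposition:
  assumes sets_N: "\<And>i. i \<in> I \<Longrightarrow> sets (N i) = sets M" and "h \<in> borel_measurable M"
  shows "(\<integral>\<^sup>+x. h x \<partial>superposition M I N) = (\<integral>\<^sup>+i. (\<integral>\<^sup>+x. h x \<partial>N i) \<partial>count_space I)"
  using assms(2)
proof (induction h rule: borel_measurable_induct)
  case (cong f g)
  have "(\<integral>\<^sup>+x. f x \<partial>N i) = (\<integral>\<^sup>+x. g x \<partial>N i)" if "i \<in> I" for i
    using cong sets_eq_imp_space_eq[OF sets_N[OF that]] by (intro nn_integral_cong) auto
  moreover have "(\<integral>\<^sup>+x. f x \<partial>superposition M I N) = (\<integral>\<^sup>+x. g x \<partial>superposition M I N)"
    using cong by (intro nn_integral_cong) auto
  ultimately show ?case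
    using cong(4) by (metis (mono_tags, lifting) nn_integral_cong space_count_space)
next
  case (set A)
  then show ?case
    by (simp add: emeasure_superposition[OF sets_N] sets_N cong: nn_integral_cong_simp)
next
  case (mult u c)
  have [measurable]: "i \<in> I \<Longrightarrow> u \<in> borel_measurable (N i)" for i
    using mult sets_N by (simp cong: measurable_cong_sets)
  show ?case using mult
    by (simp add: nn_integral_cmult cong: nn_integral_cong_simp)
next
  case (add u v)
  have [measurable]: "i \<in> I \<Longrightarrow> u \<in> borel_measurable (N i)" "i \<in> I \<Longrightarrow> v \<in> borel_measurable (N i)" for i
    using add sets_N by (simp_all cong: measurable_cong_sets)
  show ?case using add
    by (simp add: nn_integral_add cong: nn_integral_cong_simp)
next
  case (seq U)
  have [measurable]: "i \<in> I \<Longrightarrow> U k \<in> borel_measurable (N i)" for i k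
    using seq sets_N by (simp cong: measurable_cong_sets)
  have mono: "incseq (\<lambda>k. \<integral>\<^sup>+x. U k x \<partial>N i)" for i
    using \<open>incseq U\<close> by (auto simp: incseq_def le_fun_def intro!: nn_integral_mono)
  have "(\<integral>\<^sup>+x. (SUP k. U k) x \<partial>superposition M I N)
      = (SUP k. \<integral>\<^sup>+x. U k x \<partial>superposition M I N)"
    unfolding SUP_apply using seq
    by (intro nn_integral_monotone_convergence_SUP) auto
  also have "\<dots> = (SUP k. \<integral>\<^sup>+i. (\<integral>\<^sup>+x. U k x \<partial>N i) \<partial>count_space I)"
    using seq by simp
  also have "\<dots> = (\<integral>\<^sup>+i. (SUP k. \<integral>\<^sup>+x. U k x \<partial>N i) \<partial>count_space I)"
    using mono by (intro nn_integral_monotone_convergence_SUP[symmetric]) (auto simp: incseq_def le_fun_def)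
  also have "\<dots> = (\<integral>\<^sup>+i. (\<integral>\<^sup>+x. (SUP k. U k) x \<partial>N i) \<partial>count_space I)"
    unfolding SUP_apply using seq
    by (intro nn_integral_cong nn_integral_monotone_convergence_SUP[symmetric]) auto
  finally show ?case .
qed

lemma sets_dirac_sum [simp, measurable_cong]: "sets (dirac_sum M I x) = sets M"
  by (simp add: dirac_sum_def)

lemma emeasure_dirac_sum:
  "A \<in> sets M \<Longrightarrow> emeasure (dirac_sum M I x) A = (\<integral>\<^sup>+i. indicator A (x i) \<partial>count_space I)"
  by (simp add: dirac_sum_def emeasure_superposition)

lemma nn_integral_dirac_sum:
  assumes "h \<in> borel_measurable M" "\<And>i. i \<in> I \<Longrightarrow> x i \<in> space M"
  shows "(\<integral>\<^sup>+y. h y \<partial>dirac_sum M I x) = (\<integral>\<^sup>+i. h (x i) \<partial>count_space I)"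
  unfolding dirac_sum_def using assms
  by (subst nn_integral_superposition) (auto intro!: nn_integral_cong simp: nn_integral_return)

text \<open>A listing of pairs by natural numbers that serves twice: for superpositions of counting
  measures and for the blocks of the Poisson construction.\<close>

lemma nn_integral_count_space_prod_decode:
  fixes f :: "nat \<Rightarrow> nat \<Rightarrow> ennreal"
  shows "(\<integral>\<^sup>+k. f (fst (prod_decode k)) (snd (prod_decode k))
            \<partial>count_space {k. fst (prod_decode k) \<in> J \<and> snd (prod_decode k) \<in> I (fst (prod_decode k))})
       = (\<integral>\<^sup>+i. (\<integral>\<^sup>+j. f i j \<partial>count_space (I i)) \<partial>count_space J)"
proof -
  \<comment> \<open>Indicators extend both index sets to \<open>UNIV\<close>, where
    \<open>prod_decode\<close> is a bijection.\<close>
  let ?g = "\<lambda>p. f (fst p) (snd p) * indicator (I (fst p)) (snd p) * indicator J (fst p)"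
  have "(\<integral>\<^sup>+k. f (fst (prod_decode k)) (snd (prod_decode k))
            \<partial>count_space {k. fst (prod_decode k) \<in> J \<and> snd (prod_decode k) \<in> I (fst (prod_decode k))})
      = (\<integral>\<^sup>+k. ?g (prod_decode k) \<partial>count_space UNIV)"
    by (subst nn_integral_count_space_indicator)
       (auto intro!: nn_integral_cong split: split_indicator)
  also have "\<dots> = (\<integral>\<^sup>+p. ?g p \<partial>count_space UNIV)"
    by (rule nn_integral_bij_count_space[OF bij_prod_decode])
  also have "\<dots> = (\<integral>\<^sup>+i. (\<integral>\<^sup>+j. ?g (i, j) \<partial>count_space UNIV) \<partial>count_space UNIV)"
    by (rule nn_integral_fst_count_space[symmetric])
  also have "\<dots> = (\<integral>\<^sup>+i. (\<integral>\<^sup>+j. f i j \<partial>count_space (I i)) * indicator J i \<partial>count_space UNIV)"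
    by (intro nn_integral_cong)
       (simp add: nn_integral_multc nn_integral_count_space_indicator[of "I _"])
  finally show ?thesis by (simp add: nn_integral_count_space_indicator[of J])
qed

text \<open>\<open>dirac_sum\<close> takes indices in \<open>nat\<close>, so the points of all
  components are renumbered: \<open>k\<close> codes point \<open>snd (prod_decode k)\<close> of
  component \<open>fst (prod_decode k)\<close>.\<close>

lemma superposition_dirac_sum:
  fixes J :: "nat set"
  assumes "\<And>i. i \<in> J \<Longrightarrow> N i = dirac_sum M (I i) (x i)"
  shows "superposition M J N
    = dirac_sum M {k. fst (prod_decode k) \<in> J \<and> snd (prod_decode k) \<in> I (fst (prod_decode k))}
        (\<lambda>k. x (fst (prod_decode k)) (snd (prod_decode k)))"
proof (rule measure_eqI)
  fix A assume "A \<in> sets (superposition M J N)"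
  then have A: "A \<in> sets M" by simp
  have "emeasure (superposition M J N) A
      = (\<integral>\<^sup>+i. (\<integral>\<^sup>+j. indicator A (x i j) \<partial>count_space (I i)) \<partial>count_space J)"
    using A assms by (simp add: emeasure_superposition emeasure_dirac_sum cong: nn_integral_cong_simp)
  then show "emeasure (superposition M J N) A = emeasure (dirac_sum M {k. fst (prod_decode k) \<in> J
      \<and> snd (prod_decode k) \<in> I (fst (prod_decode k))}
        (\<lambda>k. x (fst (prod_decode k)) (snd (prod_decode k)))) A"
    using A nn_integral_count_space_prod_decode[where f="\<lambda>i j. indicator A (x i j)" and J=J and I=I]
    by (simp add: emeasure_dirac_sum)
qed simp

text \<open>The value is the number of indices \<open>i\<close> in \<open>I\<close> with
  \<open>x i\<close> in \<open>A\<close>. This is what makes power series in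
  \<open>exp (- r)\<close> available.\<close>

lemma emeasure_dirac_sum_range:
  assumes "A \<in> sets M"
  shows "emeasure (dirac_sum M I x) A \<in> range of_nat \<union> {\<top>}"
proof -
  have "emeasure (dirac_sum M I x) A = (\<integral>\<^sup>+i. indicator {i\<in>I. x i \<in> A} i \<partial>count_space I)"
    unfolding emeasure_dirac_sum[OF assms]
    by (intro nn_integral_cong) (auto split: split_indicator)
  also have "\<dots> = emeasure (count_space I) {i\<in>I. x i \<in> A}"
    by (rule nn_integral_indicator) auto
  finally show ?thesis by (auto simp: emeasure_count_space)
qed

lemma emeasure_counting_space_range:
  "\<mu> \<in> space counting_space \<Longrightarrow> A \<in> sets borel \<Longrightarrow> emeasure \<mu> A \<in> range of_nat \<union> {\<top>}"
  using emeasure_dirac_sum_range[of A borel] by (auto simp: space_counting_space)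

text \<open>Infinitely many locally finite summands can pile up, so local finiteness is assumed;
  only the form as a sum of unit masses is inherited.\<close>

lemma superposition_in_counting_space:
  fixes J :: "nat set"
  assumes N: "\<And>i. i \<in> J \<Longrightarrow> N i \<in> space counting_space"
    and "superposition borel J N \<in> space radon_space"
  shows "superposition borel J N \<in> space counting_space"
proof -
  have "\<forall>i\<in>J. \<exists>I x. N i = dirac_sum borel I x"
    using N by (auto simp: space_counting_space)
  then obtain I x where "\<And>i. i \<in> J \<Longrightarrow> N i = dirac_sum borel (I i) (x i)"
    by metis
  then show ?thesis
    using assms(2) superposition_dirac_sum[of J N borel I x] by (auto simp: space_counting_space)
qed

lemma dirac_sum_empty: "dirac_sum M {} x = null_measure M"
  by (rule measure_eqI) (auto simp: emeasure_dirac_sum nn_integral_count_space_finite)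

lemma null_measure_in_counting_space: "null_measure borel \<in> space counting_space"
  using dirac_sum_empty[of borel, symmetric] by (auto simp: space_counting_space space_radon_space)

section \<open>Relatively compact sets and local finiteness\<close>

lemma rel_compact_subset: "rel_compact A \<Longrightarrow> C \<subseteq> A \<Longrightarrow> rel_compact C"
  unfolding rel_compact_def
  using compact_Int_closed[of "closure A" "closure C"] closure_mono[of C A]
  by (simp add: Int_absorb1)

lemma rel_compact_UN: "finite I \<Longrightarrow> (\<And>i. i \<in> I \<Longrightarrow> rel_compact (A i)) \<Longrightarrow> rel_compact (\<Union>i\<in>I. A i)"
  unfolding rel_compact_def by (induction I rule: finite_induct) (auto simp: compact_Un)

lemma rel_compact_baseD:
  assumes "rel_compact_base B"
  shows "open (B i)" "B i \<in> sets borel" "(\<Union>i\<in>{1..}. B i) = UNIV" "1 \<le> i \<Longrightarrow> rel_compact (B i)"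
    "B 0 = UNIV"
proof -
  have B: "B 0 = UNIV" "topological_basis (B ` {1..})" "\<And>i. i \<ge> 1 \<Longrightarrow> rel_compact (B i)"
    using assms by (auto simp: rel_compact_base_def)
  show o: "open (B i)"
    using B(1) topological_basis_open[OF B(2)] by (cases i) auto
  then show "B i \<in> sets borel" by simp
  have "x \<in> (\<Union>i\<in>{1..}. B i)" for x
  proof -
    obtain C where "C \<in> B ` {1..}" "x \<in> C"
      by (rule topological_basisE[OF B(2) open_UNIV UNIV_I])
    then show ?thesis by blast
  qed
  then show "(\<Union>i\<in>{1..}. B i) = UNIV" by blast
  show "1 \<le> i \<Longrightarrow> rel_compact (B i)" "B 0 = UNIV" using B by auto
qed

lemma rel_compact_cover:
  assumes "rel_compact_base B" "rel_compact A"
  obtains F where "finite F" "F \<subseteq> {1..}" "A \<subseteq> (\<Union>i\<in>F. B i)"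
proof -
  have "compact (closure A)" "\<And>i. i \<in> {1..} \<Longrightarrow> open (B i)" "closure A \<subseteq> (\<Union>i\<in>{1..}. B i)"
    using assms(2) rel_compact_baseD(1,3)[OF assms(1)] by (simp_all add: rel_compact_def)
  then obtain F where F: "F \<subseteq> {1..}" "finite F" "closure A \<subseteq> (\<Union>i\<in>F. B i)"
    by (rule compactE_image)
  show thesis
    by (rule that[OF F(2,1) subset_trans[OF closure_subset F(3)]])
qed

text \<open>Each relatively compact set is covered by finitely many \<open>B i\<close>. Local
  finiteness thereby becomes countably many conditions, hence an event that can be shown to be
  almost sure one \<open>i\<close> at a time.\<close>

lemma radon_space_iff_finite_on_base:
  assumes B: "rel_compact_base B"
  shows "\<mu> \<in> space radon_space \<longleftrightarrow> sets \<mu> = sets borel \<and> (\<forall>i\<ge>1. emeasure \<mu> (B i) < \<top>)"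
proof (intro iffI conjI)
  assume *: "sets \<mu> = sets borel \<and> (\<forall>i\<ge>1. emeasure \<mu> (B i) < \<top>)"
  have "emeasure \<mu> A < \<top>" if A: "A \<in> sets borel" "rel_compact A" for A
  proof -
    obtain F where F: "finite F" "F \<subseteq> {1..}" "A \<subseteq> (\<Union>i\<in>F. B i)"
      by (rule rel_compact_cover[OF B A(2)])
    have "emeasure \<mu> A \<le> emeasure \<mu> (\<Union>i\<in>F. B i)"
      using F * rel_compact_baseD[OF B] by (intro emeasure_mono sets.finite_UN) auto
    also have "\<dots> \<le> (\<Sum>i\<in>F. emeasure \<mu> (B i))"
      using F * rel_compact_baseD[OF B] by (intro emeasure_subadditive_finite) auto
    also have "\<dots> < \<top>" using F * by (subst ennreal_sum_less_top) auto
    finally show ?thesis .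
  qed
  then show "\<mu> \<in> space radon_space" using * by (simp add: space_radon_space)
qed (use rel_compact_baseD[OF B] in \<open>auto simp: space_radon_space\<close>)

section \<open>The generating functional as a Laplace functional\<close>

lemma test_functionsD:
  assumes "u \<in> test_functions"
  shows "u \<in> borel_measurable borel" "0 < u x" "u x \<le> 1"
    "closure {x. u x \<noteq> 1} \<in> sets borel" "rel_compact (closure {x. u x \<noteq> 1})"
    "x \<notin> closure {x. u x \<noteq> 1} \<Longrightarrow> u x = 1"
proof -
  have *: "{x. 1 - u x \<noteq> 0} = {x. u x \<noteq> 1}" by auto
  show "rel_compact (closure {x. u x \<noteq> 1})"
    using assms unfolding test_functions_def BM_def rel_compact_def * by auto
  show "u x = 1" if "x \<notin> closure {x. u x \<noteq> 1}"
  proof (rule ccontr)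
    assume "u x \<noteq> 1"
    then have "x \<in> closure {x. u x \<noteq> 1}" by (intro subsetD[OF closure_subset]) simp
    with that show False ..
  qed
  show "closure {x. u x \<noteq> 1} \<in> sets borel" by simp
qed (use assms in \<open>auto simp: test_functions_def\<close>)

text \<open>A divergent Bochner integral of \<open>ln u\<close> would be 0 by convention, and then
  the two sides would differ. It is in fact a finite sum: only finitely many points of
  \<open>\<mu>\<close> lie in the closed support of \<open>1 - u\<close>.\<close>

lemma exp_integral_ln_eq_exp_neg:
  assumes \<mu>: "\<mu> \<in> space counting_space" and u: "u \<in> test_functions"
  shows "exp (\<integral>x. ln (u x) \<partial>\<mu>) = exp_neg (\<integral>\<^sup>+x. ennreal (- ln (u x)) \<partial>\<mu>)"
proof -
  note [measurable] = test_functionsD(1)[OF u]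
  have [measurable_cong]: "sets \<mu> = sets borel" by (rule sets_counting_space[OF \<mu>])
  define K where "K = closure {x. u x \<noteq> 1}"
  have K [measurable]: "K \<in> sets borel" and u1: "\<And>x. x \<notin> K \<Longrightarrow> u x = 1"
    using test_functionsD(4,6)[OF u] by (auto simp only: K_def)
  obtain I x where \<mu>_eq: "\<mu> = dirac_sum borel I x"
    using \<mu> by (auto simp: space_counting_space)
  have "emeasure \<mu> K < \<top>"
    using \<mu> test_functionsD(4,5)[OF u] by (auto simp: space_counting_space space_radon_space K_def)
  moreover have "emeasure \<mu> K = emeasure (count_space I) {i\<in>I. x i \<in> K}"
  proof -
    have "emeasure \<mu> K = (\<integral>\<^sup>+i. indicator {i\<in>I. x i \<in> K} i \<partial>count_space I)"
      unfolding \<mu>_eq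
      by (subst emeasure_dirac_sum[OF K], rule nn_integral_cong) (simp add: indicator_def)
    also have "\<dots> = emeasure (count_space I) {i\<in>I. x i \<in> K}"
      by (rule nn_integral_indicator) auto
    finally show ?thesis .
  qed
  ultimately have fin: "finite {i\<in>I. x i \<in> K}"
    by (auto simp: emeasure_count_space split: if_splits)
  have "(\<integral>\<^sup>+y. ennreal (- ln (u y)) \<partial>\<mu>) = (\<integral>\<^sup>+i. ennreal (- ln (u (x i))) \<partial>count_space I)"
    unfolding \<mu>_eq by (rule nn_integral_dirac_sum) auto
  also have "\<dots> = (\<Sum>i\<in>{i\<in>I. x i \<in> K}. ennreal (- ln (u (x i))))"
    by (rule nn_integral_count_space'[OF fin])
       (auto dest: u1)
  also have "\<dots> < \<top>" using fin by (subst ennreal_sum_less_top) auto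
  finally have less: "(\<integral>\<^sup>+y. ennreal (- ln (u y)) \<partial>\<mu>) < \<top>" .
  have "(\<lambda>y. - ln (u y)) \<in> borel_measurable \<mu>"
    unfolding measurable_cong_sets[OF sets_counting_space[OF \<mu>] refl] by measurable
  then have "(\<integral>y. - ln (u y) \<partial>\<mu>) = enn2real (\<integral>\<^sup>+y. ennreal (- ln (u y)) \<partial>\<mu>)"
    by (rule integral_eq_nn_integral) (use test_functionsD(2,3)[OF u] in \<open>simp_all add: ln_le_zero_iff\<close>)
  then have "(\<integral>y. ln (u y) \<partial>\<mu>) = - enn2real (\<integral>\<^sup>+y. ennreal (- ln (u y)) \<partial>\<mu>)"
    by simp
  then show ?thesis using less by (simp add: exp_neg_def)
qed

lemma pgfl_eq_nn_integral_exp_neg: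
  assumes L: "L \<in> space (prob_algebra counting_space)" and u: "u \<in> test_functions"
  shows "ennreal (pgfl L u) = (\<integral>\<^sup>+\<mu>. ennreal (exp_neg (\<integral>\<^sup>+x. ennreal (- ln (u x)) \<partial>\<mu>)) \<partial>L)"
    and "0 \<le> pgfl L u"
proof -
  note [measurable] = test_functionsD(1)[OF u]
  have [measurable_cong]: "sets L = sets counting_space" and "prob_space L"
    using L by (auto simp: space_prob_algebra)
  interpret L: prob_space L by fact
  have sp: "space L = space counting_space" by (rule sets_eq_imp_space_eq) fact
  have pg: "pgfl L u = (\<integral>\<mu>. exp_neg (\<integral>\<^sup>+x. ennreal (- ln (u x)) \<partial>\<mu>) \<partial>L)"
    unfolding pgfl_def by (intro Bochner_Integration.integral_cong refl exp_integral_ln_eq_exp_neg u) (simp add: sp)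
  have int: "integrable L (\<lambda>\<mu>. exp_neg (\<integral>\<^sup>+x. ennreal (- ln (u x)) \<partial>\<mu>))"
    by (rule L.integrable_const_bound[where B=1]) auto
  show "ennreal (pgfl L u) = (\<integral>\<^sup>+\<mu>. ennreal (exp_neg (\<integral>\<^sup>+x. ennreal (- ln (u x)) \<partial>\<mu>)) \<partial>L)"
    unfolding pg by (rule nn_integral_eq_integral[symmetric, OF int]) simp
  show "0 \<le> pgfl L u" unfolding pg by (rule integral_nonneg_AE) simp
qed

lemma pgfl_eqI:
  assumes "L \<in> space (prob_algebra counting_space)" "u \<in> test_functions" "0 \<le> c"
    "(\<integral>\<^sup>+\<mu>. ennreal (exp_neg (\<integral>\<^sup>+x. ennreal (- ln (u x)) \<partial>\<mu>)) \<partial>L) = ennreal c"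
  shows "pgfl L u = c"
  using pgfl_eq_nn_integral_exp_neg[OF assms(1,2)] assms(3,4) by simp

section \<open>The generating functional determines the law\<close>

lemma exp_neg_sum_indicators_test_function:
  fixes r :: "'i \<Rightarrow> real" and A :: "'i \<Rightarrow> 'a::{second_countable_topology, t2_space} set"
  assumes "finite I" "\<And>i. i \<in> I \<Longrightarrow> 0 < r i" "\<And>i. i \<in> I \<Longrightarrow> A i \<in> sets borel" "\<And>i. i \<in> I \<Longrightarrow> rel_compact (A i)"
  shows "(\<lambda>x. exp (- (\<Sum>i\<in>I. r i * indicator (A i) x))) \<in> test_functions"
proof -
  have nonneg: "0 \<le> (\<Sum>i\<in>I. r i * indicator (A i) x)" for x
    using assms(2) by (intro sum_nonneg) (auto simp: less_imp_le)
  have norm1: "norm (1 - exp (- (\<Sum>i\<in>I. r i * indicator (A i) x))) \<le> 1" for x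
  proof -
    have "0 < exp (- (\<Sum>i\<in>I. r i * indicator (A i) x))" "exp (- (\<Sum>i\<in>I. r i * indicator (A i) x)) \<le> 1"
      using nonneg[of x] by auto
    then show ?thesis by (simp only: real_norm_def abs_le_iff) linarith
  qed
  have "{x. (1::real) - exp (- (\<Sum>i\<in>I. r i * indicator (A i) x)) \<noteq> 0} \<subseteq> (\<Union>i\<in>I. A i)"
  proof safe
    fix x assume *: "(1::real) - exp (- (\<Sum>i\<in>I. r i * indicator (A i) x)) \<noteq> 0"
    show "x \<in> (\<Union>i\<in>I. A i)"
    proof (rule ccontr)
      assume "x \<notin> (\<Union>i\<in>I. A i)"
      then have "(\<Sum>i\<in>I. r i * indicator (A i) x) = 0" by (intro sum.neutral) auto
      with * show False by simp
    qed
  qed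
  then have "compact (closure {x. (1::real) - exp (- (\<Sum>i\<in>I. r i * indicator (A i) x)) \<noteq> 0})"
    using rel_compact_subset[OF rel_compact_UN[OF assms(1,4)]] by (simp add: rel_compact_def)
  moreover have "bounded (range (\<lambda>x. (1::real) - exp (- (\<Sum>i\<in>I. r i * indicator (A i) x))))"
    by (intro boundedI[where B=1]) (use norm1 in auto)
  ultimately show ?thesis
    using nonneg assms(3) by (auto simp: test_functions_def BM_def)
qed

text \<open>Events that fix finitely many counts of relatively compact sets are stable under
  intersection and generate \<open>counting_space\<close>; on them the two laws agree by coefficient
  comparison.\<close>

lemma counting_measure_eqI:
  fixes B :: "nat \<Rightarrow> 'a::{second_countable_topology, t2_space} set" and L L' :: "'a measure measure"
  assumes B: "rel_compact_base B"
    and L: "L \<in> space (prob_algebra counting_space)" and L': "L' \<in> space (prob_algebra counting_space)"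
    and eq: "\<And>u. u \<in> test_functions \<Longrightarrow> pgfl L u = pgfl L' u"
  shows "L = L'"
proof -
  have sL [measurable_cong]: "sets L = sets counting_space" and "prob_space L"
    and sL' [measurable_cong]: "sets L' = sets counting_space" and "prob_space L'"
    using L L' by (auto simp: space_prob_algebra)
  interpret L: prob_space L by fact
  interpret L': prob_space L' by fact
  have sp: "space L = space counting_space" "space L' = space counting_space"
    by (fact sets_eq_imp_space_eq[OF sL] sets_eq_imp_space_eq[OF sL'])+
  \<comment> \<open>The conditions form a finite set of pairs \<open>(A, k)\<close>, so that an
    intersection of events corresponds to the union of the condition sets. Contradictory pairs
    merely give the empty event.\<close>
  define E :: "'a measure set set"
    where "E = {{\<mu>\<in>space counting_space. \<forall>(A, k)\<in>F. emeasure \<mu> A = of_nat k} | F.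
                finite F \<and> (\<forall>(A, k)\<in>F. A \<in> sets borel \<and> rel_compact A)}"
  have E_sub: "E \<subseteq> Pow (space counting_space)" by (auto simp: E_def)
  have stable: "Int_stable E"
  proof (rule Int_stableI)
    fix a b assume "a \<in> E" "b \<in> E"
    then obtain F G where F: "finite F" "\<forall>(A, k)\<in>F. A \<in> sets borel \<and> rel_compact A"
        "a = {\<mu>\<in>space counting_space. \<forall>(A, k)\<in>F. emeasure \<mu> A = of_nat k}"
      and G: "finite G" "\<forall>(A, k)\<in>G. A \<in> sets borel \<and> rel_compact A"
        "b = {\<mu>\<in>space counting_space. \<forall>(A, k)\<in>G. emeasure \<mu> A = of_nat k}"
      by (auto simp: E_def)
    then show "a \<inter> b \<in> E"
      unfolding E_def by (intro CollectI exI[of _ "F \<union> G"]) auto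
  qed
  have top: "space counting_space \<in> E"
    unfolding E_def by (intro CollectI exI[of _ "{}"]) auto
  let ?S = "sigma (space counting_space) E"
  have ev1: "(\<lambda>\<mu>. emeasure \<mu> A) \<in> borel_measurable ?S" if A: "A \<in> sets borel" "rel_compact A" for A
  proof (rule measurableI)
    fix X :: "ennreal set" assume "X \<in> sets borel"
    \<comment> \<open>Relative compactness excludes the value \<open>\<top>\<close>, so preimages
      are countable unions of generators.\<close>
    have fin: "emeasure \<mu> A \<in> range of_nat" if "\<mu> \<in> space counting_space" for \<mu>
      using emeasure_counting_space_range[OF that A(1)] that A
      by (auto simp: space_counting_space space_radon_space)
    have "(\<lambda>\<mu>. emeasure \<mu> A) -` X \<inter> space ?S
        = (\<Union>k\<in>{k. of_nat k \<in> X}. {\<mu>\<in>space counting_space. emeasure \<mu> A = of_nat k})"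
      using fin E_sub by (fastforce simp: space_measure_of_conv)
    also have "\<dots> \<in> sets ?S"
    proof (intro sets.countable_UN')
      have "{\<mu>\<in>space counting_space. emeasure \<mu> A = of_nat k} \<in> E" for k
        unfolding E_def using A by (intro CollectI exI[of _ "{(A, k)}"]) auto
      then show "(\<lambda>k. {\<mu>\<in>space counting_space. emeasure \<mu> A = of_nat k}) ` {k. of_nat k \<in> X} \<subseteq> sets ?S"
        using E_sub by (auto simp: sets_measure_of)
    qed simp
    finally show "(\<lambda>\<mu>. emeasure \<mu> A) -` X \<inter> space ?S \<in> sets ?S" .
  qed simp
  \<comment> \<open>Measurability of the identity says that the generated sigma-algebra contains
    that of \<open>counting_space\<close>. An arbitrary Borel set is exhausted by its relatively
    compact pieces \<open>?A n\<close>.\<close>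
  have "(\<lambda>\<mu>. \<mu>) \<in> ?S \<rightarrow>\<^sub>M counting_space"
  proof (rule measurable_counting_space)
    fix A :: "'a set" assume A: "A \<in> sets borel"
    let ?A = "\<lambda>n. A \<inter> (\<Union>i\<in>{1..n}. B i)"
    have UN: "(\<Union>n. ?A n) = A"
    proof -
      have "x \<in> (\<Union>n. \<Union>i\<in>{1..n}. B i)" for x
        using rel_compact_baseD(3)[OF B] by (auto simp: set_eq_iff) (metis atLeastAtMost_iff atLeast_iff order_refl)
      then show ?thesis by blast
    qed
    have sA: "?A n \<in> sets borel" for n
      using A rel_compact_baseD(2)[OF B] by auto
    have "emeasure \<mu> A = (SUP n. emeasure \<mu> (?A n))" if "\<mu> \<in> space ?S" for \<mu>
    proof -
      have "sets \<mu> = sets borel"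
        using that E_sub by (simp add: space_measure_of_conv sets_counting_space)
      then have "(SUP n. emeasure \<mu> (?A n)) = emeasure \<mu> (\<Union>n. ?A n)"
        using sA by (intro SUP_emeasure_incseq) (force simp: incseq_def)+
      then show ?thesis by (simp only: UN)
    qed
    moreover have "(\<lambda>\<mu>. SUP n. emeasure \<mu> (?A n)) \<in> borel_measurable ?S"
    proof (intro borel_measurable_SUP ev1 sA)
      show "rel_compact (?A n)" for n
        by (rule rel_compact_subset[OF rel_compact_UN[of "{1..n}" B]])
           (use rel_compact_baseD(4)[OF B] in auto)
    qed simp
    ultimately show "(\<lambda>\<mu>. emeasure \<mu> A) \<in> borel_measurable ?S"
      by (simp cong: measurable_cong)
  qed (use E_sub in \<open>simp add: space_measure_of_conv\<close>)
  then have "sets counting_space \<subseteq> sets ?S"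
    by (intro subsetI) (drule measurable_sets, use E_sub sets.sets_into_space in
        \<open>auto simp: space_measure_of_conv Int_absorb2 vimage_def\<close>)
  moreover have "sigma_sets (space counting_space) E \<subseteq> sets counting_space"
  proof (rule sets.sigma_sets_subset)
    show "E \<subseteq> sets counting_space"
    proof
      fix X assume "X \<in> E"
      then obtain F where F: "finite F" "\<forall>(A, k)\<in>F. A \<in> sets borel \<and> rel_compact A"
        and X: "X = {\<mu>\<in>space counting_space. \<forall>p\<in>F. emeasure \<mu> (fst p) = of_nat (snd p)}"
        by (auto simp: E_def split_beta)
      have [measurable]: "p \<in> F \<Longrightarrow> fst p \<in> sets borel" for p using F by auto
      show "X \<in> sets counting_space"
        unfolding X
      proof (rule sets.sets_Collect_finite_All[OF _ F(1)])
        fix p assume "p \<in> F"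
        then have [measurable]: "(\<lambda>\<mu>. emeasure \<mu> (fst p)) \<in> borel_measurable counting_space"
          by (intro measurable_emeasure_counting_space) simp
        show "{\<mu>\<in>space counting_space. emeasure \<mu> (fst p) = of_nat (snd p)} \<in> sets counting_space"
          by measurable
      qed
    qed
  qed
  ultimately have sets_eq: "sets counting_space = sigma_sets (space counting_space) E"
    using E_sub by (auto simp: sets_measure_of)
  show ?thesis
  proof (rule measure_eqI_generator_eq[where E=E and \<Omega>="space counting_space" and A="\<lambda>_::nat. space counting_space", OF stable E_sub])
    show "sets L = sigma_sets (space counting_space) E" "sets L' = sigma_sets (space counting_space) E"
      using sL sL' sets_eq by auto
    show "range (\<lambda>_. space counting_space) \<subseteq> E" using top by auto
    fix X assume "X \<in> E"
    then obtain F where F: "finite F" "\<forall>(A, k)\<in>F. A \<in> sets borel \<and> rel_compact A"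
      and X: "X = {\<mu>\<in>space counting_space. \<forall>p\<in>F. emeasure \<mu> (fst p) = of_nat (snd p)}"
      by (auto simp: E_def split_beta)
    have [measurable]: "p \<in> F \<Longrightarrow> fst p \<in> sets borel" for p using F by auto
    have "emeasure L {\<mu>\<in>space L. \<forall>p\<in>F. emeasure \<mu> (fst p) = of_nat (snd p)}
        = emeasure L' {\<mu>\<in>space L'. \<forall>p\<in>F. emeasure \<mu> (fst p) = of_nat (snd p)}"
    \<comment> \<open>The index set is \<open>F\<close> itself: the pair \<open>p\<close>
      contributes the count of \<open>fst p\<close> and the target value \<open>snd p\<close>. The
      sets may overlap or repeat.\<close>
    proof (rule joint_laplace_eq_imp_joint_law_eq[OF L.finite_measure_axioms L'.finite_measure_axioms F(1)])
      fix r :: "'a set \<times> nat \<Rightarrow> real" assume r: "\<And>p. p \<in> F \<Longrightarrow> 0 < r p"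
      define u where "u x = exp (- (\<Sum>p\<in>F. r p * indicator (fst p) x))" for x
      have u: "u \<in> test_functions"
        unfolding u_def by (rule exp_neg_sum_indicators_test_function) (use F r in auto)
      have *: "(\<integral>\<^sup>+x. ennreal (- ln (u x)) \<partial>\<mu>) = (\<Sum>p\<in>F. ennreal (r p) * emeasure \<mu> (fst p))"
        if "\<mu> \<in> space counting_space" for \<mu>
      proof -
        have [measurable_cong]: "sets \<mu> = sets borel" by (rule sets_counting_space[OF that])
        have "ennreal (- ln (u x)) = (\<Sum>p\<in>F. ennreal (r p) * indicator (fst p) x)" for x
        proof -
          have "ennreal (- ln (u x)) = ennreal (\<Sum>p\<in>F. r p * indicator (fst p) x)" by (simp add: u_def)
          also have "\<dots> = (\<Sum>p\<in>F. ennreal (r p * indicator (fst p) x))"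
            using r by (intro sum_ennreal[symmetric]) (auto simp: less_imp_le)
          also have "\<dots> = (\<Sum>p\<in>F. ennreal (r p) * indicator (fst p) x)"
            by (intro sum.cong) (auto split: split_indicator)
          finally show ?thesis .
        qed
        then have "(\<integral>\<^sup>+x. ennreal (- ln (u x)) \<partial>\<mu>) = (\<integral>\<^sup>+x. (\<Sum>p\<in>F. ennreal (r p) * indicator (fst p) x) \<partial>\<mu>)"
          by simp
        also have "\<dots> = (\<Sum>p\<in>F. \<integral>\<^sup>+x. ennreal (r p) * indicator (fst p) x \<partial>\<mu>)"
          by (rule nn_integral_sum) measurable
        also have "\<dots> = (\<Sum>p\<in>F. ennreal (r p) * emeasure \<mu> (fst p))"
          by (intro sum.cong refl nn_integral_cmult_indicator) measurable
        finally show ?thesis .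
      qed
      have "(\<integral>\<^sup>+\<mu>. ennreal (exp_neg (\<Sum>p\<in>F. ennreal (r p) * emeasure \<mu> (fst p))) \<partial>M) = ennreal (pgfl M u)"
        if "M \<in> space (prob_algebra counting_space)" for M
        unfolding pgfl_eq_nn_integral_exp_neg(1)[OF that u]
        using sets_eq_imp_space_eq[of M counting_space] that
        by (intro nn_integral_cong) (simp add: * space_prob_algebra)
      then show "(\<integral>\<^sup>+\<mu>. ennreal (exp_neg (\<Sum>p\<in>F. ennreal (r p) * emeasure \<mu> (fst p))) \<partial>L)
          = (\<integral>\<^sup>+\<mu>. ennreal (exp_neg (\<Sum>p\<in>F. ennreal (r p) * emeasure \<mu> (fst p))) \<partial>L')"
        using L L' eq[OF u] by simp
    next
      fix p \<mu> assume "p \<in> F"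
      then have "fst p \<in> sets borel" by simp
      then show "\<mu> \<in> space L \<Longrightarrow> emeasure \<mu> (fst p) \<in> range of_nat \<union> {\<top>}"
          "\<mu> \<in> space L' \<Longrightarrow> emeasure \<mu> (fst p) \<in> range of_nat \<union> {\<top>}"
        unfolding sp by (blast dest: emeasure_counting_space_range)+
    qed measurable
    then show "emeasure L X = emeasure L' X" by (simp add: X sp)
  next
    show "(\<Union>i::nat. space counting_space) = space (counting_space :: 'a measure measure)" by simp
    show "emeasure L (space counting_space) \<noteq> \<infinity>" using L.emeasure_finite by simp
  qed
qed

section \<open>Sibuya processes\<close>

text \<open>Coefficient of \<open>s ^ k\<close> in \<open>1 - (1 - s) powr \<alpha>\<close>, from
  the binomial series at \<open>- s\<close>. For \<open>\<alpha> = 1\<close> all the mass sits at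
  \<open>k = 1\<close>.\<close>

definition sibuya_weight :: "real \<Rightarrow> nat \<Rightarrow> real" where
  "sibuya_weight \<alpha> k = (if k = 0 then 0 else (- 1) ^ Suc k * (\<alpha> gchoose k))"

text \<open>From \<open>k = 1\<close> on, where the weight is \<open>\<alpha>\<close>, each step
  multiplies the weight by \<open>(k - \<alpha>) / (k + 1)\<close>, which is nonnegative because
  \<open>\<alpha> \<le> 1\<close>.\<close>

lemma sibuya_weight_nonneg:
  assumes "0 < \<alpha>" "\<alpha> \<le> 1"
  shows "0 \<le> sibuya_weight \<alpha> k"
proof (induction k)
  case 0
  then show ?case by (simp add: sibuya_weight_def)
next
  case (Suc k)
  show ?case
  proof (cases "k = 0")
    case True
    then show ?thesis using assms by (simp add: sibuya_weight_def)
  next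
    case False
    have "\<alpha> gchoose Suc k = (\<alpha> gchoose k) * (\<alpha> - real k) / real (Suc k)"
      by (simp add: gbinomial_prod_rev field_simps)
    then have "sibuya_weight \<alpha> (Suc k) = (- 1) ^ Suc (Suc k) * ((\<alpha> gchoose k) * (\<alpha> - real k) / real (Suc k))"
      by (simp only: sibuya_weight_def) simp
    also have "\<dots> = sibuya_weight \<alpha> k * ((real k - \<alpha>) / real (Suc k))"
      using False by (simp add: sibuya_weight_def field_simps)
    also have "\<dots> \<ge> 0" using Suc False assms by (intro mult_nonneg_nonneg divide_nonneg_nonneg) auto
    finally show ?thesis .
  qed
qed

lemma sibuya_weight_power_sums:
  assumes "0 \<le> s" "s < 1"
  shows "(\<lambda>k. sibuya_weight \<alpha> k * s ^ k) sums (1 - (1 - s) powr \<alpha>)"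
proof -
  have "(\<lambda>k. (if k = 0 then 1 else 0) - (\<alpha> gchoose k) * (- s) ^ k) sums (1 - (1 - s) powr \<alpha>)"
    using gen_binomial_real[of "- s" \<alpha>] assms sums_single[of 0 "\<lambda>_. 1 :: real"]
    by (intro sums_diff) auto
  moreover have "(if k = 0 then 1 else 0) - (\<alpha> gchoose k) * (- s) ^ k = sibuya_weight \<alpha> k * s ^ k" for k
    by (auto simp: sibuya_weight_def power_minus[of s])
  ultimately show ?thesis by simp
qed

text \<open>The power series identity holds for \<open>s < 1\<close> only. Nonnegativity takes the
  place of Abel's theorem: finite sums stay below 1 as \<open>s\<close> increases to 1, and
  \<open>(1 - s) powr \<alpha>\<close> tends to 0 by \<open>0 < \<alpha>\<close>, which forces the
  total up to 1.\<close>

lemma sibuya_weight_sums: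
  assumes \<alpha>: "0 < \<alpha>" "\<alpha> \<le> 1"
  shows "sibuya_weight \<alpha> sums 1"
proof -
  note w = sibuya_weight_nonneg[OF \<alpha>]
  have part: "(\<Sum>k<n. sibuya_weight \<alpha> k) \<le> 1" for n
  proof (rule tendsto_le[OF trivial_limit_at_left_real tendsto_const[of 1]])
    show "((\<lambda>s. \<Sum>k<n. sibuya_weight \<alpha> k * s ^ k) \<longlongrightarrow> (\<Sum>k<n. sibuya_weight \<alpha> k)) (at_left 1)"
      by (auto intro!: tendsto_eq_intros)
    have "eventually (\<lambda>s. s \<in> {0<..<1::real}) (at_left 1)"
      by (rule eventually_at_leftI[of 0]) auto
    then show "\<forall>\<^sub>F s in at_left 1. (\<Sum>k<n. sibuya_weight \<alpha> k * s ^ k) \<le> 1"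
    proof eventually_elim
      case (elim s)
      have sums: "(\<lambda>k. sibuya_weight \<alpha> k * s ^ k) sums (1 - (1 - s) powr \<alpha>)"
        using sibuya_weight_power_sums[of s \<alpha>] elim by simp
      have "(\<Sum>k<n. sibuya_weight \<alpha> k * s ^ k) \<le> (\<Sum>k. sibuya_weight \<alpha> k * s ^ k)"
        by (rule sum_le_suminf[OF sums_summable[OF sums]]) (use elim w in auto)
      also have "\<dots> = 1 - (1 - s) powr \<alpha>"
        using sums by (simp add: sums_iff)
      also have "\<dots> \<le> 1" by simp
      finally show ?case .
    qed
  qed
  have sm: "summable (sibuya_weight \<alpha>)"
    by (rule bounded_imp_summable[OF w, of _ 1]) (use part[of "Suc _"] in \<open>simp add: lessThan_Suc_atMost\<close>)
  have "suminf (sibuya_weight \<alpha>) \<le> 1"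
    by (rule suminf_le_const[OF sm part])
  moreover have "1 \<le> suminf (sibuya_weight \<alpha>)"
  proof (rule tendsto_le[OF trivial_limit_at_left_real tendsto_const])
    have "((\<lambda>s::real. 1 - (1 - s) powr \<alpha>) \<longlongrightarrow> 1 - 0) (at_left 1)"
    proof (intro tendsto_diff tendsto_const)
      have "((\<lambda>s::real. 1 - s) \<longlongrightarrow> 1 - 1) (at_left 1)" by (intro tendsto_intros)
      then show "((\<lambda>s::real. (1 - s) powr \<alpha>) \<longlongrightarrow> 0) (at_left 1)"
        using \<alpha> by (intro tendsto_zero_powrI[where b=\<alpha>])
          (auto intro!: tendsto_const eventually_at_leftI[of 0])
    qed
    then show "((\<lambda>s::real. 1 - (1 - s) powr \<alpha>) \<longlongrightarrow> 1) (at_left 1)" by simp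
    have "eventually (\<lambda>s. s \<in> {0<..<1::real}) (at_left 1)"
      by (rule eventually_at_leftI[of 0]) auto
    then show "\<forall>\<^sub>F s in at_left 1. 1 - (1 - s) powr \<alpha> \<le> suminf (sibuya_weight \<alpha>)"
    proof eventually_elim
      case (elim s)
      have sums: "(\<lambda>k. sibuya_weight \<alpha> k * s ^ k) sums (1 - (1 - s) powr \<alpha>)"
        using sibuya_weight_power_sums[of s \<alpha>] elim by simp
      have "(\<Sum>k. sibuya_weight \<alpha> k * s ^ k) \<le> suminf (sibuya_weight \<alpha>)"
        by (rule suminf_le[OF _ sums_summable[OF sums] sm]) (use elim w in \<open>auto intro!: mult_left_le power_le_one\<close>)
      then show ?case using sums by (simp add: sums_iff)
    qed
  qed
  ultimately show ?thesis using sm by (simp add: sums_iff)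
qed

definition sibuya_pmf :: "real \<Rightarrow> nat pmf" where
  "sibuya_pmf \<alpha> = embed_pmf (sibuya_weight \<alpha>)"

lemma pmf_sibuya:
  assumes "0 < \<alpha>" "\<alpha> \<le> 1"
  shows "pmf (sibuya_pmf \<alpha>) k = sibuya_weight \<alpha> k"
  unfolding sibuya_pmf_def
proof (rule pmf_embed_pmf[OF sibuya_weight_nonneg[OF assms]])
  show "(\<integral>\<^sup>+k. ennreal (sibuya_weight \<alpha> k) \<partial>count_space UNIV) = 1"
    using suminf_ennreal_eq[OF sibuya_weight_nonneg[OF assms] sibuya_weight_sums[OF assms]]
    by (simp add: nn_integral_count_space_nat)
qed

lemma nn_integral_sibuya_pmf_power:
  assumes "0 < \<alpha>" "\<alpha> \<le> 1" "0 \<le> s" "s \<le> 1"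
  shows "(\<integral>\<^sup>+k. ennreal s ^ k \<partial>sibuya_pmf \<alpha>) = ennreal (1 - (1 - s) powr \<alpha>)"
proof -
  have "(\<lambda>k. sibuya_weight \<alpha> k * s ^ k) sums (1 - (1 - s) powr \<alpha>)"
    using sibuya_weight_power_sums[of s \<alpha>] sibuya_weight_sums[of \<alpha>] assms
    by (cases "s = 1") auto
  then have "(\<Sum>k. ennreal (sibuya_weight \<alpha> k * s ^ k)) = ennreal (1 - (1 - s) powr \<alpha>)"
    using sibuya_weight_nonneg assms by (intro suminf_ennreal_eq) auto
  then show ?thesis
    using assms sibuya_weight_nonneg[OF assms(1,2)]
    by (simp add: nn_integral_measure_pmf nn_integral_count_space_nat pmf_sibuya ennreal_mult ennreal_power)
qed

text \<open>Written as a superposition over natural indices, so that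
  \<open>superposition_in_counting_space\<close> applies.\<close>

definition add_point :: "'a::topological_space \<Rightarrow> 'a measure \<Rightarrow> 'a measure" where
  "add_point x \<nu> = superposition borel {0, 1 :: nat} (\<lambda>i. if i = 0 then return borel x else \<nu>)"

lemma emeasure_add_point:
  assumes "\<nu> \<in> space counting_space" "A \<in> sets borel"
  shows "emeasure (add_point x \<nu>) A = indicator A x + emeasure \<nu> A"
  unfolding add_point_def using assms
  by (subst emeasure_superposition) (auto simp: sets_counting_space nn_integral_count_space_finite)

lemma nn_integral_add_point:
  assumes "\<nu> \<in> space counting_space" "h \<in> borel_measurable borel"
  shows "(\<integral>\<^sup>+y. h y \<partial>add_point x \<nu>) = h x + (\<integral>\<^sup>+y. h y \<partial>\<nu>)"
  unfolding add_point_def using assms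
  by (subst nn_integral_superposition)
     (auto simp: sets_counting_space nn_integral_count_space_finite nn_integral_return)

lemma return_in_counting_space: "return borel x \<in> space counting_space"
proof -
  have "return borel x = dirac_sum borel {0} (\<lambda>_. x)"
    by (rule measure_eqI) (auto simp: emeasure_dirac_sum nn_integral_count_space_finite)
  moreover have "return borel x \<in> space radon_space"
    by (auto simp: space_radon_space split: split_indicator)
  ultimately show ?thesis by (auto simp: space_counting_space)
qed

lemma add_point_in_counting_space:
  assumes "\<nu> \<in> space counting_space"
  shows "add_point x \<nu> \<in> space counting_space"
proof -
  have "add_point x \<nu> \<in> space radon_space"
    using assms emeasure_add_point[OF assms, of _ x]
    by (auto simp: space_radon_space space_counting_space add_point_def split: split_indicator)
  then show ?thesis
    unfolding add_point_def using assms return_in_counting_space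
    by (intro superposition_in_counting_space) auto
qed

lemma measurable_add_point [measurable (raw)]:
  assumes f: "f \<in> M \<rightarrow>\<^sub>M borel" and g: "g \<in> M \<rightarrow>\<^sub>M counting_space"
  shows "(\<lambda>\<omega>. add_point (f \<omega>) (g \<omega>)) \<in> M \<rightarrow>\<^sub>M counting_space"
proof (rule measurable_counting_space)
  fix A :: "'b set" assume A [measurable]: "A \<in> sets borel"
  note [measurable] = f measurable_compose[OF g measurable_emeasure_counting_space[OF A]]
  have "(\<lambda>\<omega>. emeasure (add_point (f \<omega>) (g \<omega>)) A) \<in> borel_measurable M
    \<longleftrightarrow> (\<lambda>\<omega>. indicator A (f \<omega>) + emeasure (g \<omega>) A) \<in> borel_measurable M"
    by (intro measurable_cong emeasure_add_point A measurable_space[OF g])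
  then show "(\<lambda>\<omega>. emeasure (add_point (f \<omega>) (g \<omega>)) A) \<in> borel_measurable M"
    by simp
qed (simp add: add_point_in_counting_space measurable_space[OF g])

text \<open>The recursion by \<open>bind\<close>, in place of an image of a product measure, makes
  measurability in \<open>\<mu>\<close> a composition of kernels.\<close>

fun iid_points :: "nat \<Rightarrow> 'a::topological_space measure \<Rightarrow> 'a measure measure" where
  "iid_points 0 \<mu> = return counting_space (null_measure borel)"
| "iid_points (Suc n) \<mu> =
     \<mu> \<bind> (\<lambda>x. iid_points n \<mu> \<bind> (\<lambda>\<nu>. return counting_space (add_point x \<nu>)))"

lemma measurable_iid_points [measurable]:
  "iid_points n \<in> prob_algebra borel \<rightarrow>\<^sub>M prob_algebra counting_space"
proof (induction n)
  case 0
  have "return counting_space (null_measure borel) \<in> space (prob_algebra counting_space)"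
    by (simp add: space_prob_algebra prob_space_return null_measure_in_counting_space)
  then have "(\<lambda>\<mu>. return counting_space (null_measure borel)) \<in> prob_algebra borel \<rightarrow>\<^sub>M prob_algebra counting_space"
    by (rule measurable_const)
  moreover have "iid_points 0 = (\<lambda>\<mu>. return counting_space (null_measure borel))"
    by (simp add: fun_eq_iff)
  ultimately show ?case by simp
next
  case (Suc n)
  note [measurable] = Suc
  show ?case unfolding iid_points.simps by measurable
qed

text \<open>A further point at \<open>x\<close> multiplies the functional by
  \<open>exp_neg (h x)\<close>, and it is drawn independently of the others.\<close>

lemma nn_integral_exp_neg_iid_points:
  assumes \<mu>: "\<mu> \<in> prob_measures" and [measurable]: "h \<in> borel_measurable borel"
  shows "(\<integral>\<^sup>+\<nu>. ennreal (exp_neg (\<integral>\<^sup>+x. h x \<partial>\<nu>)) \<partial>iid_points n \<mu>) = (\<integral>\<^sup>+x. ennreal (exp_neg (h x)) \<partial>\<mu>) ^ n"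
proof (induction n)
  case 0
  show ?case
    by (simp add: nn_integral_return null_measure_in_counting_space nn_integral_null_measure)
next
  case (Suc n)
  have [measurable_cong]: "sets \<mu> = sets borel" using \<mu> by (simp add: space_prob_algebra)
  have p: "iid_points n \<mu> \<in> space (prob_algebra counting_space)"
    by (rule measurable_space[OF measurable_iid_points \<mu>])
  then have sp [measurable_cong]: "sets (iid_points n \<mu>) = sets counting_space"
    by (simp add: space_prob_algebra)
  have sub: "(\<lambda>x. iid_points n \<mu> \<bind> (\<lambda>\<nu>. return counting_space (add_point x \<nu>)))
      \<in> \<mu> \<rightarrow>\<^sub>M subprob_algebra counting_space"
    using p by (intro measurable_prob_algebraD) measurable
  have sub2: "(\<lambda>\<nu>. return counting_space (add_point x \<nu>)) \<in> iid_points n \<mu> \<rightarrow>\<^sub>M subprob_algebra counting_space" for x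
    by (intro measurable_prob_algebraD) measurable
  have "(\<integral>\<^sup>+\<nu>. ennreal (exp_neg (\<integral>\<^sup>+y. h y \<partial>\<nu>)) \<partial>iid_points (Suc n) \<mu>)
      = (\<integral>\<^sup>+x. (\<integral>\<^sup>+\<nu>. ennreal (exp_neg (\<integral>\<^sup>+y. h y \<partial>\<nu>))
            \<partial>(iid_points n \<mu> \<bind> (\<lambda>\<nu>. return counting_space (add_point x \<nu>)))) \<partial>\<mu>)"
    unfolding iid_points.simps by (rule nn_integral_bind[OF _ sub]) measurable
  also have "\<dots> = (\<integral>\<^sup>+x. (\<integral>\<^sup>+\<nu>. ennreal (exp_neg (h x)) * ennreal (exp_neg (\<integral>\<^sup>+y. h y \<partial>\<nu>)) \<partial>iid_points n \<mu>) \<partial>\<mu>)"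
  proof (rule nn_integral_cong)
    fix x
    have "(\<integral>\<^sup>+\<nu>. ennreal (exp_neg (\<integral>\<^sup>+y. h y \<partial>\<nu>))
            \<partial>(iid_points n \<mu> \<bind> (\<lambda>\<nu>. return counting_space (add_point x \<nu>))))
        = (\<integral>\<^sup>+\<nu>. (\<integral>\<^sup>+\<nu>'. ennreal (exp_neg (\<integral>\<^sup>+y. h y \<partial>\<nu>')) \<partial>return counting_space (add_point x \<nu>)) \<partial>iid_points n \<mu>)"
      by (rule nn_integral_bind[OF _ sub2]) measurable
    also have "\<dots> = (\<integral>\<^sup>+\<nu>. ennreal (exp_neg (h x)) * ennreal (exp_neg (\<integral>\<^sup>+y. h y \<partial>\<nu>)) \<partial>iid_points n \<mu>)"
      using sets_eq_imp_space_eq[OF sp]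
      by (intro nn_integral_cong)
         (simp add: nn_integral_return add_point_in_counting_space nn_integral_add_point exp_neg_add ennreal_mult)
    finally show "(\<integral>\<^sup>+\<nu>. ennreal (exp_neg (\<integral>\<^sup>+y. h y \<partial>\<nu>))
            \<partial>(iid_points n \<mu> \<bind> (\<lambda>\<nu>. return counting_space (add_point x \<nu>))))
        = (\<integral>\<^sup>+\<nu>. ennreal (exp_neg (h x)) * ennreal (exp_neg (\<integral>\<^sup>+y. h y \<partial>\<nu>)) \<partial>iid_points n \<mu>)" .
  qed
  also have "\<dots> = (\<integral>\<^sup>+x. ennreal (exp_neg (h x)) * (\<integral>\<^sup>+x. ennreal (exp_neg (h x)) \<partial>\<mu>) ^ n \<partial>\<mu>)"
    by (intro nn_integral_cong) (simp add: nn_integral_cmult Suc)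
  also have "\<dots> = (\<integral>\<^sup>+x. ennreal (exp_neg (h x)) \<partial>\<mu>) ^ Suc n"
    by (simp add: nn_integral_multc)
  finally show ?case .
qed

definition sibuya_kernel :: "real \<Rightarrow> 'a::topological_space measure \<Rightarrow> 'a measure measure" where
  "sibuya_kernel \<alpha> \<mu> = measure_pmf (sibuya_pmf \<alpha>) \<bind> (\<lambda>n. iid_points n \<mu>)"

lemma measurable_sibuya_kernel [measurable]:
  "sibuya_kernel \<alpha> \<in> prob_algebra borel \<rightarrow>\<^sub>M prob_algebra counting_space"
proof -
  have "measure_pmf (sibuya_pmf \<alpha>) \<in> space (prob_algebra (count_space UNIV))"
    by (simp add: space_prob_algebra measure_pmf.prob_space_axioms)
  then have "(\<lambda>_. measure_pmf (sibuya_pmf \<alpha>)) \<in> prob_algebra borel \<rightarrow>\<^sub>M prob_algebra (count_space UNIV)"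
    by simp
  moreover have "(\<lambda>(\<mu>, n). iid_points n \<mu>) \<in> prob_algebra borel \<Otimes>\<^sub>M count_space UNIV \<rightarrow>\<^sub>M prob_algebra counting_space"
    unfolding split_beta by (rule measurable_compose_countable) measurable
  ultimately show ?thesis
    unfolding sibuya_kernel_def [abs_def] by (rule measurable_bind_prob_space2)
qed

text \<open>Composition of generating functions: \<open>n\<close> points give the
  \<open>n\<close>-th power of \<open>s\<close>, the mean of \<open>exp_neg (h x)\<close>, and
  averaging over \<open>n\<close> gives the Sibuya generating function at \<open>s\<close>. Infinite
  values of \<open>h\<close> are included.\<close>

lemma nn_integral_exp_neg_sibuya_kernel:
  assumes \<alpha>: "0 < \<alpha>" "\<alpha> \<le> 1" and \<mu>: "\<mu> \<in> prob_measures" and [measurable]: "h \<in> borel_measurable borel"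
  shows "(\<integral>\<^sup>+\<nu>. ennreal (exp_neg (\<integral>\<^sup>+x. h x \<partial>\<nu>)) \<partial>sibuya_kernel \<alpha> \<mu>)
       = ennreal (1 - (\<integral>x. 1 - exp_neg (h x) \<partial>\<mu>) powr \<alpha>)"
    and "0 \<le> (\<integral>x. 1 - exp_neg (h x) \<partial>\<mu>)" "(\<integral>x. 1 - exp_neg (h x) \<partial>\<mu>) \<le> 1"
proof -
  have [measurable_cong]: "sets \<mu> = sets borel" and "prob_space \<mu>" using \<mu> by (auto simp: space_prob_algebra)
  interpret prob_space \<mu> by fact
  have int: "integrable \<mu> (\<lambda>x. exp_neg (h x))" by (rule integrable_const_bound[where B=1]) auto
  define s where "s = (\<integral>x. exp_neg (h x) \<partial>\<mu>)"
  have s: "0 \<le> s" "s \<le> 1" "(\<integral>\<^sup>+x. ennreal (exp_neg (h x)) \<partial>\<mu>) = ennreal s"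
    unfolding s_def using integral_le_const[OF int, of 1]
    by (auto intro!: nn_integral_eq_integral int integral_nonneg_AE)
  have 1: "(\<integral>x. 1 - exp_neg (h x) \<partial>\<mu>) = 1 - s"
    unfolding s_def using int by (subst Bochner_Integration.integral_diff) (auto simp: prob_space)
  show "0 \<le> (\<integral>x. 1 - exp_neg (h x) \<partial>\<mu>)" "(\<integral>x. 1 - exp_neg (h x) \<partial>\<mu>) \<le> 1"
    using s by (auto simp: 1)
  have "(\<lambda>n. iid_points n \<mu>) \<in> measure_pmf (sibuya_pmf \<alpha>) \<rightarrow>\<^sub>M subprob_algebra counting_space"
    using measurable_space[OF measurable_prob_algebraD[OF measurable_iid_points] \<mu>] by (auto simp: measurable_def)
  then have "(\<integral>\<^sup>+\<nu>. ennreal (exp_neg (\<integral>\<^sup>+x. h x \<partial>\<nu>)) \<partial>sibuya_kernel \<alpha> \<mu>)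
      = (\<integral>\<^sup>+n. (\<integral>\<^sup>+\<nu>. ennreal (exp_neg (\<integral>\<^sup>+x. h x \<partial>\<nu>)) \<partial>iid_points n \<mu>) \<partial>sibuya_pmf \<alpha>)"
    unfolding sibuya_kernel_def by (rule nn_integral_bind[rotated]) measurable
  also have "\<dots> = (\<integral>\<^sup>+n. ennreal s ^ n \<partial>sibuya_pmf \<alpha>)"
    by (simp add: nn_integral_exp_neg_iid_points[OF \<mu>] s)
  also have "\<dots> = ennreal (1 - (1 - s) powr \<alpha>)"
    by (rule nn_integral_sibuya_pmf_power[OF \<alpha> s(1,2)])
  finally show "(\<integral>\<^sup>+\<nu>. ennreal (exp_neg (\<integral>\<^sup>+x. h x \<partial>\<nu>)) \<partial>sibuya_kernel \<alpha> \<mu>)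
       = ennreal (1 - (\<integral>x. 1 - exp_neg (h x) \<partial>\<mu>) powr \<alpha>)"
    by (simp add: 1)
qed

lemma exp_neg_minus_ln: "0 < u \<Longrightarrow> u \<le> 1 \<Longrightarrow> exp_neg (ennreal (- ln u)) = u"
  by (simp add: exp_neg_ennreal ln_le_zero_iff)

lemma is_sibuya_sibuya_kernel:
  assumes \<alpha>: "0 < \<alpha>" "\<alpha> \<le> 1" and \<mu>: "\<mu> \<in> prob_measures"
  shows "is_sibuya \<alpha> \<mu> (sibuya_kernel \<alpha> \<mu>)"
  unfolding is_sibuya_def
proof (intro conjI ballI)
  show k: "sibuya_kernel \<alpha> \<mu> \<in> space (prob_algebra counting_space)"
    by (rule measurable_space[OF measurable_sibuya_kernel \<mu>])
  fix u :: "'a \<Rightarrow> real" assume u: "u \<in> test_functions"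
  note [measurable] = test_functionsD(1)[OF u]
  have "(\<lambda>x. ennreal (- ln (u x))) \<in> borel_measurable borel" by measurable
  note * = nn_integral_exp_neg_sibuya_kernel[OF \<alpha> \<mu> this]
  show "pgfl (sibuya_kernel \<alpha> \<mu>) u = 1 - (\<integral>x. 1 - u x \<partial>\<mu>) powr \<alpha>"
    using * test_functionsD(2,3)[OF u] \<alpha>
    by (intro pgfl_eqI[OF k u]) (auto simp: exp_neg_minus_ln powr_le1)
qed

text \<open>Beyond resolving the \<open>THE\<close>, this gives \<open>Sib\<close> the measurable
  dependence on \<open>\<mu>\<close> that its definition does not exhibit.\<close>

lemma Sib_eq_sibuya_kernel:
  fixes B :: "nat \<Rightarrow> 'a::{second_countable_topology, t2_space} set"
  assumes B: "rel_compact_base B" and \<alpha>: "0 < \<alpha>" "\<alpha> \<le> 1" and \<mu>: "(\<mu> :: 'a measure) \<in> prob_measures"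
  shows "Sib \<alpha> \<mu> = sibuya_kernel \<alpha> \<mu>"
  unfolding Sib_def
proof (rule the_equality)
  show k: "is_sibuya \<alpha> \<mu> (sibuya_kernel \<alpha> \<mu>)" by (rule is_sibuya_sibuya_kernel[OF \<alpha> \<mu>])
  show "D = sibuya_kernel \<alpha> \<mu>" if "is_sibuya \<alpha> \<mu> D" for D
    using that k by (intro counting_measure_eqI[OF B]) (auto simp: is_sibuya_def)
qed

section \<open>Marked Poisson processes\<close>

lemma nn_integral_PiM_UNIV_prod:
  fixes M :: "'i \<Rightarrow> 'x measure"
  assumes "\<And>i. prob_space (M i)" "finite K" and f: "\<And>i. i \<in> K \<Longrightarrow> f i \<in> borel_measurable (M i)"
  shows "(\<integral>\<^sup>+x. (\<Prod>i\<in>K. f i (x i)) \<partial>PiM UNIV M) = (\<Prod>i\<in>K. \<integral>\<^sup>+y. f i y \<partial>M i)"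
proof -
  interpret M: prob_space "M i" for i by (rule assms(1))
  interpret product_prob_space M UNIV by unfold_locales
  have meas: "(\<lambda>x. \<Prod>i\<in>K. f i (x i)) \<in> borel_measurable (PiM K M)"
    using f by (intro borel_measurable_prod_ennreal measurable_compose[OF measurable_component_singleton]) auto
  have "(\<integral>\<^sup>+x. (\<Prod>i\<in>K. f i (x i)) \<partial>PiM UNIV M)
      = (\<integral>\<^sup>+x. (\<Prod>i\<in>K. f i (restrict x K i)) \<partial>PiM UNIV M)"
    by (intro nn_integral_cong prod.cong) auto
  also have "\<dots> = (\<integral>\<^sup>+x. (\<Prod>i\<in>K. f i (x i)) \<partial>distr (PiM UNIV M) (PiM K M) (\<lambda>x. restrict x K))"
    by (rule nn_integral_distr[OF measurable_restrict_subset[OF subset_UNIV], symmetric]) (use meas in simp)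
  also have "\<dots> = (\<integral>\<^sup>+x. (\<Prod>i\<in>K. f i (x i)) \<partial>PiM K M)"
    using distr_PiM_restrict_finite[OF \<open>finite K\<close>] by simp
  also have "\<dots> = (\<Prod>i\<in>K. \<integral>\<^sup>+y. f i y \<partial>M i)"
    by (rule product_nn_integral_prod[OF \<open>finite K\<close> f])
  finally show ?thesis .
qed

text \<open>The library requires a positive rate for its Poisson distribution.\<close>

definition poisson_law :: "real \<Rightarrow> nat pmf" where
  "poisson_law r = (if r = 0 then return_pmf 0 else poisson_pmf r)"

lemma pmf_poisson_law: "0 \<le> r \<Longrightarrow> pmf (poisson_law r) k = r ^ k / fact k * exp (- r)"
  by (auto simp: poisson_law_def indicator_def power_0_left)

lemma nn_integral_poisson_law_power:
  assumes "0 \<le> r" "0 \<le> p"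
  shows "(\<integral>\<^sup>+n. ennreal p ^ n \<partial>poisson_law r) = ennreal (exp (- (r * (1 - p))))"
proof -
  have "(\<lambda>n. (r * p) ^ n /\<^sub>R fact n) sums exp (r * p)"
    by (rule exp_converges)
  then have "(\<lambda>n. exp (- r) * ((r * p) ^ n /\<^sub>R fact n)) sums (exp (- r) * exp (r * p))"
    by (rule sums_mult)
  moreover have "exp (- r) * ((r * p) ^ n /\<^sub>R fact n) = pmf (poisson_law r) n * p ^ n" for n
    using assms by (simp add: pmf_poisson_law power_mult_distrib field_simps)
  moreover have "exp (- r) * exp (r * p) = exp (- (r * (1 - p)))"
    by (simp add: exp_add[symmetric] algebra_simps)
  ultimately have "(\<lambda>n. pmf (poisson_law r) n * p ^ n) sums exp (- (r * (1 - p)))" by simp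
  then have "(\<Sum>n. ennreal (pmf (poisson_law r) n * p ^ n)) = ennreal (exp (- (r * (1 - p))))"
    using assms by (intro suminf_ennreal_eq) auto
  then show ?thesis
    using assms by (simp add: nn_integral_measure_pmf nn_integral_count_space_nat ennreal_mult ennreal_power)
qed

locale marked_blocks =
  fixes Z :: "'z measure" and Q :: "nat \<Rightarrow> 'z measure" and rate :: "nat \<Rightarrow> real"
  assumes prob_Q: "prob_space (Q m)" and sets_Q: "sets (Q m) = sets Z" and rate_nonneg: "0 \<le> rate m"
begin

definition counts :: "(nat \<Rightarrow> nat) measure" where
  "counts = PiM UNIV (\<lambda>m. measure_pmf (poisson_law (rate m)))"

definition marks :: "(nat \<Rightarrow> 'z) measure" where
  "marks = PiM UNIV (\<lambda>i. Q (fst (prod_decode i)))"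

text \<open>Counts and marks are zipped into one sequence. The two components at index
  \<open>i\<close> are unrelated: the count belongs to block \<open>i\<close>, the mark to a
  candidate of block \<open>fst (prod_decode i)\<close>.\<close>

definition block_space :: "(nat \<Rightarrow> nat \<times> 'z) measure" where
  "block_space = distr (counts \<Otimes>\<^sub>M marks) (PiM UNIV (\<lambda>_. count_space UNIV \<Otimes>\<^sub>M Z)) (\<lambda>(k, z) i. (k i, z i))"

text \<open>The index \<^term>\<open>prod_encode (m, j)\<close> stands for the \<open>j\<close>-th candidate point of block \<open>m\<close>, which is
  kept if \<open>j\<close> is below the Poisson variable of the block. The latter is the first component of \<^term>\<open>\<omega> m\<close>.\<close>

definition kept :: "(nat \<Rightarrow> nat \<times> 'z) \<Rightarrow> nat set" where
  "kept \<omega> = {i. snd (prod_decode i) < fst (\<omega> (fst (prod_decode i)))}"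

lemma sets_marks [measurable_cong]: "sets marks = sets (PiM UNIV (\<lambda>_. Z))"
  unfolding marks_def by (intro sets_PiM_cong refl sets_Q)

lemma sets_counts [measurable_cong]: "sets counts = sets (PiM UNIV (\<lambda>_. count_space UNIV))"
  unfolding counts_def by (intro sets_PiM_cong) auto

lemma prob_space_marks: "prob_space marks"
  unfolding marks_def by (intro prob_space_PiM prob_Q)

lemma prob_space_counts: "prob_space counts"
  unfolding counts_def by (intro prob_space_PiM measure_pmf.prob_space_axioms)

lemma sets_block_space [measurable_cong]:
  "sets block_space = sets (PiM UNIV (\<lambda>_. count_space UNIV \<Otimes>\<^sub>M Z))"
  by (simp add: block_space_def)

lemma measurable_zip:
  "(\<lambda>(k, z) i. (k i, z i)) \<in> counts \<Otimes>\<^sub>M marks \<rightarrow>\<^sub>M PiM UNIV (\<lambda>_. count_space UNIV \<Otimes>\<^sub>M Z)"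
  unfolding split_beta
proof (rule measurable_PiM_single')
  show "(\<lambda>p. (fst p i, snd p i)) \<in> counts \<Otimes>\<^sub>M marks \<rightarrow>\<^sub>M count_space UNIV \<Otimes>\<^sub>M Z" for i
    by measurable
qed (auto simp: space_pair_measure space_PiM sets_eq_imp_space_eq[OF sets_counts] sets_eq_imp_space_eq[OF sets_marks])

lemma prob_space_block_space: "prob_space block_space"
proof -
  interpret pair_prob_space counts marks
    by (simp add: pair_prob_space_def pair_sigma_finite_def prob_space_counts prob_space_marks
        prob_space_imp_sigma_finite)
  show ?thesis
    unfolding block_space_def by (rule prob_space_distr[OF measurable_zip])
qed

text \<open>Counts outside, marks inside: in the inner integral the set of kept indices is
  constant.\<close>

lemma nn_integral_block_space:
  assumes "F \<in> borel_measurable block_space"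
  shows "(\<integral>\<^sup>+\<omega>. F \<omega> \<partial>block_space) = (\<integral>\<^sup>+k. (\<integral>\<^sup>+z. F (\<lambda>i. (k i, z i)) \<partial>marks) \<partial>counts)"
proof -
  have F: "F \<in> borel_measurable (PiM UNIV (\<lambda>_. count_space UNIV \<Otimes>\<^sub>M Z))"
    using assms unfolding measurable_cong_sets[OF sets_block_space refl] .
  interpret marks: prob_space marks by (rule prob_space_marks)
  have "(\<integral>\<^sup>+\<omega>. F \<omega> \<partial>block_space) = (\<integral>\<^sup>+p. F (\<lambda>i. (fst p i, snd p i)) \<partial>(counts \<Otimes>\<^sub>M marks))"
    unfolding block_space_def using F by (subst nn_integral_distr[OF measurable_zip]) (simp_all add: split_beta)
  also have "\<dots> = (\<integral>\<^sup>+k. (\<integral>\<^sup>+z. F (\<lambda>i. (fst (k, z) i, snd (k, z) i)) \<partial>marks) \<partial>counts)"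
    using measurable_compose[OF measurable_zip F]
    by (intro marks.nn_integral_fst[symmetric]) (simp add: split_beta)
  finally show ?thesis by simp
qed

lemma measurable_fst_block_space [measurable]: "(\<lambda>\<omega>. fst (\<omega> i)) \<in> block_space \<rightarrow>\<^sub>M count_space UNIV"
  by measurable

lemma measurable_snd_block_space [measurable]: "(\<lambda>\<omega>. snd (\<omega> i)) \<in> block_space \<rightarrow>\<^sub>M Z"
  by measurable

lemma pred_kept [measurable]: "Measurable.pred block_space (\<lambda>\<omega>. i \<in> kept \<omega>)"
  unfolding kept_def mem_Collect_eq by measurable

lemma measurable_nn_integral_kept [measurable (raw)]:
  assumes "\<And>i. h i \<in> borel_measurable block_space"
  shows "(\<lambda>\<omega>. \<integral>\<^sup>+i. h i \<omega> \<partial>count_space (kept \<omega>)) \<in> borel_measurable block_space"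
proof -
  note [measurable] = assms
  have "(\<integral>\<^sup>+i. h i \<omega> \<partial>count_space (kept \<omega>)) = (\<Sum>i. if i \<in> kept \<omega> then h i \<omega> else 0)" for \<omega>
    by (subst nn_integral_count_space_indicator)
       (auto simp: nn_integral_count_space_nat intro!: suminf_cong)
  then show ?thesis by simp
qed

lemma nn_integral_kept:
  "(\<integral>\<^sup>+i. h (snd (\<omega> i)) \<partial>count_space (kept \<omega>))
    = (\<Sum>m. \<Sum>j<fst (\<omega> m). h (snd (\<omega> (prod_encode (m, j)))))"
proof -
  have kept: "kept \<omega> = {i. fst (prod_decode i) \<in> UNIV \<and> snd (prod_decode i) \<in> {..<fst (\<omega> (fst (prod_decode i)))}}"
    by (auto simp: kept_def)
  have "(\<integral>\<^sup>+i. h (snd (\<omega> i)) \<partial>count_space (kept \<omega>))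
      = (\<integral>\<^sup>+i. h (snd (\<omega> (prod_encode (fst (prod_decode i), snd (prod_decode i))))) \<partial>count_space (kept \<omega>))"
    by simp
  also have "\<dots> = (\<integral>\<^sup>+m. (\<integral>\<^sup>+j. h (snd (\<omega> (prod_encode (m, j)))) \<partial>count_space {..<fst (\<omega> m)}) \<partial>count_space UNIV)"
    unfolding kept
    by (rule nn_integral_count_space_prod_decode[where f="\<lambda>m j. h (snd (\<omega> (prod_encode (m, j))))"])
  finally show ?thesis
    by (simp add: nn_integral_count_space_nat nn_integral_count_space_finite)
qed

text \<open>After truncation to \<open>M\<close> blocks only the finitely many coordinates in
  \<open>K\<close> occur, and independence of the marks gives one factor per point.\<close>

lemma nn_integral_exp_neg_marks:
  assumes [measurable]: "h \<in> borel_measurable Z"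
  shows "(\<integral>\<^sup>+z. ennreal (exp_neg (\<Sum>m<M. \<Sum>j<k m. h (z (prod_encode (m, j))))) \<partial>marks)
    = (\<Prod>m<M. (\<integral>\<^sup>+z. ennreal (exp_neg (h z)) \<partial>Q m) ^ k m)"
proof -
  define K where "K = prod_encode ` Sigma {..<M} (\<lambda>m. {..<k m})"
  have K: "(\<Prod>i\<in>K. g (fst (prod_decode i)) i) = (\<Prod>m<M. \<Prod>j<k m. g m (prod_encode (m, j)))" for g :: "nat \<Rightarrow> nat \<Rightarrow> ennreal"
    unfolding K_def
    by (subst prod.reindex) (auto simp: prod.Sigma split_beta inj_prod_encode intro!: prod.cong)
  have "(\<integral>\<^sup>+z. ennreal (exp_neg (\<Sum>m<M. \<Sum>j<k m. h (z (prod_encode (m, j))))) \<partial>marks)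
      = (\<integral>\<^sup>+z. (\<Prod>i\<in>K. ennreal (exp_neg (h (z i)))) \<partial>marks)"
    by (intro nn_integral_cong) (simp add: K[of "\<lambda>_ i. ennreal (exp_neg (h (_ i)))"] exp_neg_sum prod_ennreal prod_nonneg)
  also have "\<dots> = (\<Prod>i\<in>K. \<integral>\<^sup>+z. ennreal (exp_neg (h z)) \<partial>Q (fst (prod_decode i)))"
    unfolding marks_def
  proof (rule nn_integral_PiM_UNIV_prod[OF prob_Q])
    show "finite K" unfolding K_def by (intro finite_imageI finite_SigmaI) auto
    show "(\<lambda>z. ennreal (exp_neg (h z))) \<in> borel_measurable (Q (fst (prod_decode i)))" for i
      unfolding measurable_cong_sets[OF sets_Q refl] by measurable
  qed
  also have "\<dots> = (\<Prod>m<M. (\<integral>\<^sup>+z. ennreal (exp_neg (h z)) \<partial>Q m) ^ k m)"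
    using K[of "\<lambda>m i. \<integral>\<^sup>+z. ennreal (exp_neg (h z)) \<partial>Q m"] by simp
  finally show ?thesis .
qed

text \<open>Given the counts, block \<open>m\<close> contributes \<open>p m ^ k m\<close>, whose
  Poisson mean is \<open>exp (- (rate m * (1 - p m)))\<close>. All blocks together are reached by
  dominated convergence with bound 1, once over the marks and once over the counts.\<close>

lemma nn_integral_exp_neg_block_space:
  assumes [measurable]: "h \<in> borel_measurable Z"
  shows "(\<integral>\<^sup>+\<omega>. ennreal (exp_neg (\<integral>\<^sup>+i. h (snd (\<omega> i)) \<partial>count_space (kept \<omega>))) \<partial>block_space)
    = ennreal (exp_neg (\<Sum>m. ennreal (rate m) * (\<integral>\<^sup>+z. ennreal (1 - exp_neg (h z)) \<partial>Q m)))"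
proof -
  interpret marks: prob_space marks by (rule prob_space_marks)
  interpret counts: prob_space counts by (rule prob_space_counts)
  define S where "S k z = (\<Sum>m. \<Sum>j<k m. h (z (prod_encode (m, j))))" for k :: "nat \<Rightarrow> nat" and z
  define p where "p m = (\<integral>z. exp_neg (h z) \<partial>Q m)" for m
  have hQ [measurable]: "h \<in> borel_measurable (Q m)" for m
    unfolding measurable_cong_sets[OF sets_Q refl] by measurable
  have p: "0 \<le> p m" "p m \<le> 1" "(\<integral>\<^sup>+z. ennreal (exp_neg (h z)) \<partial>Q m) = ennreal (p m)"
    "(\<integral>\<^sup>+z. ennreal (1 - exp_neg (h z)) \<partial>Q m) = ennreal (1 - p m)" for m
  proof -
    interpret prob_space "Q m" by (rule prob_Q)
    have int: "integrable (Q m) (\<lambda>z. exp_neg (h z))" by (rule integrable_const_bound[where B=1]) auto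
    show "0 \<le> p m" "p m \<le> 1" "(\<integral>\<^sup>+z. ennreal (exp_neg (h z)) \<partial>Q m) = ennreal (p m)"
      unfolding p_def using integral_le_const[OF int, of 1]
      by (auto intro!: nn_integral_eq_integral int integral_nonneg_AE)
    have "(\<integral>\<^sup>+z. ennreal (1 - exp_neg (h z)) \<partial>Q m) = ennreal (\<integral>z. 1 - exp_neg (h z) \<partial>Q m)"
      using int by (intro nn_integral_eq_integral) auto
    also have "(\<integral>z. 1 - exp_neg (h z) \<partial>Q m) = 1 - p m"
      unfolding p_def using int by (subst Bochner_Integration.integral_diff) (auto simp: prob_space)
    finally show "(\<integral>\<^sup>+z. ennreal (1 - exp_neg (h z)) \<partial>Q m) = ennreal (1 - p m)" .
  qed
  have inner: "(\<lambda>M. \<Prod>m<M. ennreal (p m) ^ k m) \<longlonglongrightarrow> (\<integral>\<^sup>+z. ennreal (exp_neg (S k z)) \<partial>marks)" for k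
  proof -
    have "(\<lambda>M. \<integral>\<^sup>+z. ennreal (exp_neg (\<Sum>m<M. \<Sum>j<k m. h (z (prod_encode (m, j))))) \<partial>marks)
        \<longlonglongrightarrow> (\<integral>\<^sup>+z. ennreal (exp_neg (S k z)) \<partial>marks)"
    proof (rule nn_integral_dominated_convergence[where w="\<lambda>_. 1"])
      show "AE z in marks. (\<lambda>M. ennreal (exp_neg (\<Sum>m<M. \<Sum>j<k m. h (z (prod_encode (m, j))))))
          \<longlonglongrightarrow> ennreal (exp_neg (S k z))"
        unfolding S_def by (intro AE_I2 tendsto_ennrealI tendsto_exp_neg summable_LIMSEQ summableI)
      show "(\<lambda>z. ennreal (exp_neg (S k z))) \<in> borel_measurable marks"
        unfolding S_def by measurable
    qed (auto simp: marks.emeasure_space_1)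
    then show ?thesis by (simp add: nn_integral_exp_neg_marks p)
  qed
  have "(\<integral>\<^sup>+\<omega>. ennreal (exp_neg (\<integral>\<^sup>+i. h (snd (\<omega> i)) \<partial>count_space (kept \<omega>))) \<partial>block_space)
      = (\<integral>\<^sup>+k. (\<integral>\<^sup>+z. ennreal (exp_neg (S k z)) \<partial>marks) \<partial>counts)"
    using nn_integral_kept[where h=h and \<omega>="\<lambda>i. (k i, z i)" for k z]
    by (subst nn_integral_block_space) (auto simp: S_def)
  moreover have "(\<lambda>M. \<integral>\<^sup>+k. (\<Prod>m<M. ennreal (p m) ^ k m) \<partial>counts)
      \<longlonglongrightarrow> (\<integral>\<^sup>+k. (\<integral>\<^sup>+z. ennreal (exp_neg (S k z)) \<partial>marks) \<partial>counts)"
  proof (rule nn_integral_dominated_convergence[where w="\<lambda>_. 1"])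
    show m: "(\<lambda>k. \<Prod>m<M. ennreal (p m) ^ k m) \<in> borel_measurable counts" for M
      by measurable
    show "(\<lambda>k. \<integral>\<^sup>+z. ennreal (exp_neg (S k z)) \<partial>marks) \<in> borel_measurable counts"
      by (rule borel_measurable_LIMSEQ_order[OF inner m])
    show "AE k in counts. (\<Prod>m<M. ennreal (p m) ^ k m) \<le> 1" for M
      using p(1,2) by (intro AE_I2 prod_le_1) (auto simp: power_le_one ennreal_power)
  qed (auto simp: counts.emeasure_space_1 inner)
  moreover have "(\<integral>\<^sup>+k. (\<Prod>m<M. ennreal (p m) ^ k m) \<partial>counts)
      = ennreal (exp_neg (\<Sum>m<M. ennreal (rate m) * ennreal (1 - p m)))" for M
  proof -
    have "(\<integral>\<^sup>+k. (\<Prod>m<M. ennreal (p m) ^ k m) \<partial>counts) = (\<Prod>m<M. \<integral>\<^sup>+n. ennreal (p m) ^ n \<partial>poisson_law (rate m))"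
      unfolding counts_def by (rule nn_integral_PiM_UNIV_prod) (auto intro: measure_pmf.prob_space_axioms)
    also have "\<dots> = (\<Prod>m<M. ennreal (exp_neg (ennreal (rate m) * ennreal (1 - p m))))"
      using p rate_nonneg
      by (intro prod.cong) (auto simp: nn_integral_poisson_law_power exp_neg_ennreal ennreal_mult[symmetric])
    finally show ?thesis by (simp add: exp_neg_sum prod_ennreal)
  qed
  moreover have "(\<lambda>M. ennreal (exp_neg (\<Sum>m<M. ennreal (rate m) * ennreal (1 - p m))))
      \<longlonglongrightarrow> ennreal (exp_neg (\<Sum>m. ennreal (rate m) * ennreal (1 - p m)))"
    by (intro tendsto_ennrealI tendsto_exp_neg summable_LIMSEQ summableI)
  \<comment> \<open>Both sides are limits of the same truncated integrals.\<close>
  ultimately show ?thesis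
    by (simp add: p LIMSEQ_unique)
qed

end

text \<open>The space is cut into disjoint pieces of finite measure; \<open>rate m\<close> is the
  mass of a piece and \<open>q m\<close> its normalised restriction.\<close>

lemma (in sigma_finite_measure) exists_prob_mixture:
  assumes "space M \<noteq> {}"
  obtains q rate where "\<And>m::nat. prob_space (q m)" "\<And>m. sets (q m) = sets M" "\<And>m. 0 \<le> rate m"
    "\<And>g. g \<in> borel_measurable M \<Longrightarrow> (\<Sum>m. ennreal (rate m) * (\<integral>\<^sup>+x. g x \<partial>q m)) = (\<integral>\<^sup>+x. g x \<partial>M)"
proof -
  obtain A :: "nat \<Rightarrow> 'a set" where A: "range A \<subseteq> sets M" "(\<Union>i. A i) = space M"
      "\<And>i. emeasure M (A i) \<noteq> \<infinity>" "disjoint_family A"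
    by (rule sigma_finite_disjoint) blast
  have [measurable]: "A m \<in> sets M" for m using A(1) by auto
  obtain x0 where x0: "x0 \<in> space M" using assms by auto
  \<comment> \<open>A null piece cannot be normalised. Its rate is 0, so a point mass at
    \<open>x0\<close> serves as a placeholder.\<close>
  define q where "q m = (if emeasure M (A m) = 0 then return M x0 else uniform_measure M (A m))" for m
  show thesis
  proof
    show "prob_space (q m)" for m
      using A(3) x0 by (auto simp: q_def intro!: prob_space_return prob_space_uniform_measure)
    show "sets (q m) = sets M" for m by (simp add: q_def)
    show "0 \<le> measure M (A m)" for m by simp
    fix g :: "'a \<Rightarrow> ennreal" assume [measurable]: "g \<in> borel_measurable M"
    have "ennreal (measure M (A m)) * (\<integral>\<^sup>+x. g x \<partial>q m) = (\<integral>\<^sup>+x. g x * indicator (A m) x \<partial>M)" for m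
    proof (cases "emeasure M (A m) = 0")
      case True
      then have "(\<integral>\<^sup>+x. g x * indicator (A m) x \<partial>M) = 0"
        by (intro nn_integral_null_set) auto
      with True show ?thesis by (simp add: measure_def)
    next
      case False
      then show ?thesis using A(3)[of m] ennreal_mult_divide_eq[of "emeasure M (A m)" "\<integral>\<^sup>+x. g x * indicator (A m) x \<partial>M"]
        by (simp add: q_def nn_integral_uniform_measure emeasure_eq_ennreal_measure[symmetric]
            ennreal_times_divide mult.commute[of "emeasure M (A m)"])
    qed
    then have "(\<Sum>m. ennreal (measure M (A m)) * (\<integral>\<^sup>+x. g x \<partial>q m)) = (\<Sum>m. \<integral>\<^sup>+x. g x * indicator (A m) x \<partial>M)"
      by simp
    also have "\<dots> = (\<integral>\<^sup>+x. (\<Sum>m. g x * indicator (A m) x) \<partial>M)"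
      by (rule nn_integral_suminf[symmetric]) measurable
    also have "\<dots> = (\<integral>\<^sup>+x. g x \<partial>M)"
    proof (rule nn_integral_cong)
      fix x assume "x \<in> space M"
      then have "(\<Sum>m. indicator (A m) x :: ennreal) = 1"
        using suminf_indicator[OF A(4), of x] A(2) by simp
      then show "(\<Sum>m. g x * indicator (A m) x) = g x" by simp
    qed
    finally show "(\<Sum>m. ennreal (measure M (A m)) * (\<integral>\<^sup>+x. g x \<partial>q m)) = (\<integral>\<^sup>+x. g x \<partial>M)" .
  qed
qed

section \<open>From the Laplace functional to the Poisson property\<close>

lemma exp_neg_sum_disjoint_indicators:
  assumes "finite I" "disjoint_family_on A I" "\<And>i. i \<in> I \<Longrightarrow> 0 < r i"
  shows "ennreal (1 - exp_neg (\<Sum>i\<in>I. ennreal (r i) * indicator (A i) y))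
    = (\<Sum>i\<in>I. ennreal (1 - exp (- r i)) * indicator (A i) y)"
proof (cases "\<exists>i\<in>I. y \<in> A i")
  case True
  then obtain j where j: "j \<in> I" "y \<in> A j" by auto
  have other: "y \<notin> A i" if "i \<in> I" "i \<noteq> j" for i
    using assms(2) that j unfolding disjoint_family_on_def by blast
  \<comment> \<open>By disjointness only the summand of \<open>j\<close> is nonzero at
    \<open>y\<close>. Hence \<open>1 - exp_neg\<close> of the sum is linear in the indicators, which
    lets the joint Laplace transform in \<open>poisson_processI\<close> factorise.\<close>
  have s: "(\<Sum>i\<in>I. g i * indicator (A i) y) = g j" for g :: "_ \<Rightarrow> ennreal"
  proof -
    have "(\<Sum>i\<in>I. g i * indicator (A i) y) = (\<Sum>i\<in>{j}. g i * indicator (A i) y)"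
      by (rule sum.mono_neutral_right) (use assms(1) j other in auto)
    then show ?thesis using j by simp
  qed
  show ?thesis unfolding s using assms(3)[OF j(1)] by (simp add: exp_neg_ennreal)
next
  case False
  then show ?thesis by simp
qed

text \<open>At combinations of indicators of disjoint sets the Laplace functional gives the joint
  Laplace transform of the counts as a product. It is compared with two reference models: the
  Poisson distribution for one set, a product of copies of \<open>P\<close> for several.\<close>

lemma poisson_processI:
  assumes "prob_space P"
    and sets_Nc: "\<And>\<omega>. \<omega> \<in> space P \<Longrightarrow> sets (Nc \<omega>) = sets \<sigma>"
    and range: "\<And>\<omega> A. \<omega> \<in> space P \<Longrightarrow> A \<in> sets \<sigma> \<Longrightarrow> emeasure (Nc \<omega>) A \<in> range of_nat \<union> {\<top>}"
    and meas: "\<And>A. A \<in> sets \<sigma> \<Longrightarrow> (\<lambda>\<omega>. emeasure (Nc \<omega>) A) \<in> borel_measurable P"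
    and laplace: "\<And>h. h \<in> borel_measurable \<sigma> \<Longrightarrow> (\<integral>\<^sup>+\<omega>. ennreal (exp_neg (\<integral>\<^sup>+y. h y \<partial>Nc \<omega>)) \<partial>P)
        = ennreal (exp_neg (\<integral>\<^sup>+y. ennreal (1 - exp_neg (h y)) \<partial>\<sigma>))"
  shows "poisson_process P \<sigma> Nc"
proof -
  interpret prob_space P by fact
  have joint: "(\<integral>\<^sup>+\<omega>. ennreal (exp_neg (\<Sum>i\<in>I. ennreal (r i) * emeasure (Nc \<omega>) (A i))) \<partial>P)
      = ennreal (\<Prod>i\<in>I. exp_neg (ennreal (1 - exp (- r i)) * emeasure \<sigma> (A i)))"
    if I: "finite I" "disjoint_family_on A I" and r: "\<And>i. i \<in> I \<Longrightarrow> 0 < r i"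
      and A: "\<And>i. i \<in> I \<Longrightarrow> A i \<in> sets \<sigma>"
    for I :: "nat set" and A and r :: "nat \<Rightarrow> real"
  proof -
    have m: "(\<lambda>y. \<Sum>i\<in>I. g i * indicator (A i) y) \<in> borel_measurable \<sigma>" for g :: "nat \<Rightarrow> ennreal"
      using A by (intro borel_measurable_sum borel_measurable_times_ennreal) auto
    have int: "(\<integral>\<^sup>+y. (\<Sum>i\<in>I. g i * indicator (A i) y) \<partial>N) = (\<Sum>i\<in>I. g i * emeasure N (A i))"
      if "sets N = sets \<sigma>" for g :: "nat \<Rightarrow> ennreal" and N
    proof -
      have "(\<integral>\<^sup>+y. (\<Sum>i\<in>I. g i * indicator (A i) y) \<partial>N) = (\<Sum>i\<in>I. \<integral>\<^sup>+y. g i * indicator (A i) y \<partial>N)"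
        by (rule nn_integral_sum) (use A that in auto)
      also have "\<dots> = (\<Sum>i\<in>I. g i * emeasure N (A i))"
        by (intro sum.cong nn_integral_cmult_indicator) (use A that in auto)
      finally show ?thesis .
    qed
    have "(\<integral>\<^sup>+\<omega>. ennreal (exp_neg (\<Sum>i\<in>I. ennreal (r i) * emeasure (Nc \<omega>) (A i))) \<partial>P)
        = (\<integral>\<^sup>+\<omega>. ennreal (exp_neg (\<integral>\<^sup>+y. (\<Sum>i\<in>I. ennreal (r i) * indicator (A i) y) \<partial>Nc \<omega>)) \<partial>P)"
      by (intro nn_integral_cong) (simp add: int sets_Nc)
    also have "\<dots> = ennreal (exp_neg (\<integral>\<^sup>+y. (\<Sum>i\<in>I. ennreal (1 - exp (- r i)) * indicator (A i) y) \<partial>\<sigma>))"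
      by (subst laplace[OF m]) (simp add: exp_neg_sum_disjoint_indicators[OF I r])
    finally show ?thesis by (simp add: int exp_neg_sum[OF I(1)])
  qed
  have single: "(\<integral>\<^sup>+\<omega>. ennreal (exp_neg (ennreal r * emeasure (Nc \<omega>) A)) \<partial>P)
      = ennreal (exp_neg (ennreal (1 - exp (- r)) * emeasure \<sigma> A))" if "0 < r" "A \<in> sets \<sigma>" for r A
    using joint[of "{0}" "\<lambda>_. A" "\<lambda>_. r"] that by (simp add: disjoint_family_on_def)
  show ?thesis
    unfolding poisson_process_def
  proof (intro conjI ballI impI allI)
    show "\<omega> \<in> space P \<Longrightarrow> sets (Nc \<omega>) = sets \<sigma>" for \<omega> by (rule sets_Nc)
    show "A \<in> sets \<sigma> \<Longrightarrow> (\<lambda>\<omega>. emeasure (Nc \<omega>) A) \<in> borel_measurable P" for A by (rule meas)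
  next
    fix A k assume A: "A \<in> sets \<sigma>" "emeasure \<sigma> A < \<infinity>"
    define l where "l = measure \<sigma> A"
    have l: "emeasure \<sigma> A = ennreal l" "0 \<le> l"
      using A by (auto simp: l_def emeasure_eq_ennreal_measure)
    have "emeasure P {\<omega>\<in>space P. \<forall>i\<in>{0::nat}. emeasure (Nc \<omega>) A = of_nat k}
        = emeasure (measure_pmf (poisson_law l)) {n\<in>space (measure_pmf (poisson_law l)). \<forall>i\<in>{0::nat}. of_nat n = (of_nat k :: ennreal)}"
    proof (rule joint_laplace_eq_imp_joint_law_eq)
      fix r :: "nat \<Rightarrow> real" assume "\<And>i. i \<in> {0} \<Longrightarrow> 0 < r i"
      then have r: "0 < r 0" by simp
      have "(\<integral>\<^sup>+n. ennreal (exp_neg (ennreal (r 0) * of_nat n)) \<partial>poisson_law l) = (\<integral>\<^sup>+n. ennreal (exp (- r 0)) ^ n \<partial>poisson_law l)"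
        using r by (simp add: exp_neg_mult_of_nat ennreal_power)
      also have "\<dots> = ennreal (exp_neg (ennreal (1 - exp (- r 0)) * emeasure \<sigma> A))"
        using r l by (simp add: nn_integral_poisson_law_power exp_neg_ennreal ennreal_mult[symmetric] mult.commute)
      finally show "(\<integral>\<^sup>+\<omega>. ennreal (exp_neg (\<Sum>i\<in>{0}. ennreal (r i) * emeasure (Nc \<omega>) A)) \<partial>P)
          = (\<integral>\<^sup>+n. ennreal (exp_neg (\<Sum>i\<in>{0}. ennreal (r i) * of_nat n)) \<partial>poisson_law l)"
        using single[OF r A(1)] by simp
    qed (use meas[OF A(1)] range[OF _ A(1)] in \<open>auto intro: finite_measure_axioms measure_pmf.finite_measure_axioms\<close>)
    also have "{n\<in>space (measure_pmf (poisson_law l)). \<forall>i\<in>{0::nat}. of_nat n = (of_nat k :: ennreal)} = {k}"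
      by auto
    finally have "emeasure P {\<omega>\<in>space P. emeasure (Nc \<omega>) A = of_nat k} = ennreal (l ^ k / fact k * exp (- l))"
      using l by (simp add: emeasure_pmf_single pmf_poisson_law)
    then show "prob {\<omega>\<in>space P. emeasure (Nc \<omega>) A = of_nat k} = exp (- measure \<sigma> A) * measure \<sigma> A ^ k / fact k"
      using l by (simp add: measure_def l_def[symmetric])
  next
    fix A assume A: "A \<in> sets \<sigma>" "emeasure \<sigma> A = \<infinity>"
    have "(\<integral>\<^sup>+\<omega>. ennreal (exp_neg (ennreal 1 * emeasure (Nc \<omega>) A)) \<partial>P) = 0"
      by (subst single) (use A in \<open>auto simp: ennreal_mult_top\<close>)
    \<comment> \<open>With parameter 1 the exponent \<open>(1 - exp (- 1)) * \<infinity>\<close> is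
      infinite, so a nonnegative integrand has integral 0 and vanishes almost surely;
      \<open>exp_neg\<close> vanishes only at \<open>\<top>\<close>.\<close>
    then have "AE \<omega> in P. ennreal (exp_neg (ennreal 1 * emeasure (Nc \<omega>) A)) = 0"
      using meas[OF A(1)] by (subst (asm) nn_integral_0_iff_AE) auto
    then show "AE \<omega> in P. emeasure (Nc \<omega>) A = \<infinity>"
      by eventually_elim (auto simp: exp_neg_def ennreal_eq_0_iff split: if_splits)
  next
    fix n :: nat and A assume "A ` {..<n} \<subseteq> sets \<sigma> \<and> disjoint_family_on A {..<n}"
    then have A: "\<And>i. i < n \<Longrightarrow> A i \<in> sets \<sigma>" and disj: "disjoint_family_on A {..<n}" by auto
    define X where "X i \<omega> = emeasure (Nc \<omega>) (A i)" for i \<omega>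
    have X [measurable]: "i < n \<Longrightarrow> X i \<in> borel_measurable P" for i
      using meas[OF A] by (simp add: X_def[abs_def])
    \<comment> \<open>Only finite values generate, since the comparison of Laplace transforms
      reaches only these. The empty set is added for stability under intersection.\<close>
    define F where "F i = insert {} (range (\<lambda>k. {\<omega>\<in>space P. X i \<omega> = of_nat k}))" for i
    have "indep_sets F {..<n}"
    proof (rule indep_setsI)
      show "i \<in> {..<n} \<Longrightarrow> F i \<subseteq> events" for i by (auto simp: F_def)
      fix E J assume J: "J \<noteq> {}" "J \<subseteq> {..<n}" "finite J" "\<forall>j\<in>J. E j \<in> F j"
      show "prob (\<Inter>j\<in>J. E j) = (\<Prod>j\<in>J. prob (E j))"
      proof (cases "\<exists>j\<in>J. E j = {}")
        case True
        then have "(\<Inter>j\<in>J. E j) = {}" by auto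
        moreover have "\<exists>j\<in>J. prob (E j) = 0" using True measure_empty[of P] by metis
        ultimately show ?thesis using J(3) by (simp add: prod_zero_iff)
      next
        case False
        then have "\<forall>j\<in>J. \<exists>k. E j = {\<omega>\<in>space P. X j \<omega> = of_nat k}"
          using J(4) unfolding F_def by fastforce
        then obtain k where k: "\<And>j. j \<in> J \<Longrightarrow> E j = {\<omega>\<in>space P. X j \<omega> = of_nat (k j)}" by metis
        have E [measurable]: "E j \<in> events" if "j \<in> J" for j using J that k by auto
        \<comment> \<open>Reference model: one independent copy of \<open>P\<close> for each
          count.\<close>
        let ?M = "PiM J (\<lambda>_. P)"
        interpret prod: product_prob_space "\<lambda>_. P" J by unfold_locales
        have XJ: "j \<in> J \<Longrightarrow> X j \<in> borel_measurable P" for j using J by auto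
        have "emeasure P {\<omega>\<in>space P. \<forall>j\<in>J. X j \<omega> = of_nat (k j)}
            = emeasure ?M {\<omega>\<in>space ?M. \<forall>j\<in>J. X j (\<omega> j) = of_nat (k j)}"
        proof (rule joint_laplace_eq_imp_joint_law_eq[OF _ _ J(3)])
          show "(\<lambda>\<omega>. X j (\<omega> j)) \<in> borel_measurable ?M" if "j \<in> J" for j
            by (rule measurable_compose[OF measurable_component_singleton[OF that] XJ[OF that]])
          show "X j \<omega> \<in> range of_nat \<union> {\<top>}" if "j \<in> J" "\<omega> \<in> space P" for j \<omega>
            unfolding X_def using that J by (intro range A) auto
          show "X j (\<omega> j) \<in> range of_nat \<union> {\<top>}" if "j \<in> J" "\<omega> \<in> space ?M" for j \<omega>
            unfolding X_def using that J by (intro range A) (auto simp: space_PiM PiE_iff)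
          fix r :: "nat \<Rightarrow> real" assume r: "\<And>j. j \<in> J \<Longrightarrow> 0 < r j"
          have "(\<integral>\<^sup>+\<omega>. ennreal (exp_neg (\<Sum>j\<in>J. ennreal (r j) * X j (\<omega> j))) \<partial>?M)
              = (\<integral>\<^sup>+\<omega>. (\<Prod>j\<in>J. ennreal (exp_neg (ennreal (r j) * X j (\<omega> j)))) \<partial>?M)"
            by (simp add: exp_neg_sum[OF J(3)] prod_ennreal)
          also have "\<dots> = (\<Prod>j\<in>J. \<integral>\<^sup>+\<omega>. ennreal (exp_neg (ennreal (r j) * X j \<omega>)) \<partial>P)"
            by (rule prod.product_nn_integral_prod[OF J(3)]) (use XJ in measurable)
          also have "\<dots> = (\<Prod>j\<in>J. ennreal (exp_neg (ennreal (1 - exp (- r j)) * emeasure \<sigma> (A j))))"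
            unfolding X_def using J A r by (intro prod.cong single) auto
          also have "\<dots> = (\<integral>\<^sup>+\<omega>. ennreal (exp_neg (\<Sum>j\<in>J. ennreal (r j) * X j \<omega>)) \<partial>P)"
            unfolding X_def using J A r disjoint_family_on_mono[OF J(2) disj]
            by (subst joint) (auto simp: prod_ennreal)
          finally show "(\<integral>\<^sup>+\<omega>. ennreal (exp_neg (\<Sum>j\<in>J. ennreal (r j) * X j \<omega>)) \<partial>P)
              = (\<integral>\<^sup>+\<omega>. ennreal (exp_neg (\<Sum>j\<in>J. ennreal (r j) * X j (\<omega> j))) \<partial>?M)" ..
        qed (use XJ in \<open>auto intro: finite_measure_axioms prod.P.finite_measure_axioms\<close>)
        also have "{\<omega>\<in>space P. \<forall>j\<in>J. X j \<omega> = of_nat (k j)} = (\<Inter>j\<in>J. E j)"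
          using k J(1) by auto
        also have "{\<omega>\<in>space ?M. \<forall>j\<in>J. X j (\<omega> j) = of_nat (k j)} = Pi\<^sub>E J E"
          using k by (auto simp: space_PiM PiE_iff extensional_def)
        also have "emeasure ?M (Pi\<^sub>E J E) = (\<Prod>j\<in>J. emeasure P (E j))"
          by (rule prod.emeasure_PiM[OF J(3) E])
        finally show ?thesis
          by (simp add: emeasure_eq_measure prod_ennreal prod_nonneg)
      qed
    qed
    moreover have "Int_stable (F i)" for i
      unfolding F_def by (rule Int_stableI) auto
    ultimately have "indep_sets (\<lambda>i. sigma_sets (space P) (F i)) {..<n}"
      by (rule indep_sets_sigma)
    then have "indep_sets (\<lambda>i. {X i -` S \<inter> space P | S. S \<in> sets borel}) {..<n}"
    proof (rule indep_sets_mono_sets)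
      fix i assume i: "i \<in> {..<n}"
      interpret S: sigma_algebra "space P" "sigma_sets (space P) (F i)"
        by (rule sigma_algebra_sigma_sets) (auto simp: F_def)
      have single_in: "{\<omega>\<in>space P. X i \<omega> = of_nat k} \<in> sigma_sets (space P) (F i)" for k
        by (rule sigma_sets.Basic) (auto simp: F_def)
      have fin: "(\<Union>k\<in>K. {\<omega>\<in>space P. X i \<omega> = of_nat k}) \<in> sigma_sets (space P) (F i)" for K
        by (rule S.countable_UN') (use single_in in auto)
      have rng: "X i \<omega> \<in> range of_nat \<union> {\<top>}" if "\<omega> \<in> space P" for \<omega>
        unfolding X_def using that i by (intro range A) auto
      have "X i -` S \<inter> space P \<in> sigma_sets (space P) (F i)" for S
      proof (cases "\<top> \<in> S")
        \<comment> \<open>The value \<open>\<top>\<close> is reached through the complement of a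
          countable union of finite values.\<close>
        case True
        have "X i -` S \<inter> space P = space P - (\<Union>k\<in>{k. of_nat k \<notin> S}. {\<omega>\<in>space P. X i \<omega> = of_nat k})"
          using rng True by fastforce
        then show ?thesis using sigma_sets.Compl[OF fin] by simp
      next
        case False
        have "X i -` S \<inter> space P = (\<Union>k\<in>{k. of_nat k \<in> S}. {\<omega>\<in>space P. X i \<omega> = of_nat k})"
          using rng False by fastforce
        then show ?thesis using fin by simp
      qed
      then show "{X i -` S \<inter> space P | S. S \<in> sets borel} \<subseteq> sigma_sets (space P) (F i)" by auto
    qed
    then show "indep_vars (\<lambda>_. borel) (\<lambda>i \<omega>. emeasure (Nc \<omega>) (A i)) {..<n}"
      unfolding indep_vars_def2 X_def[symmetric, abs_def] using X by auto
  qed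
qed

section \<open>Daughters conditionally independent given the centres\<close>

context marked_blocks
begin

lemma nn_integral_marks_prod_indicator_eq:
  assumes f: "\<And>i. i < n \<Longrightarrow> f i \<in> borel_measurable Z" and g: "\<And>i. i < n \<Longrightarrow> g i \<in> borel_measurable Z"
    and le: "\<And>i z. i < n \<Longrightarrow> z \<in> space Z \<Longrightarrow> f i z \<le> 1" "\<And>i z. i < n \<Longrightarrow> z \<in> space Z \<Longrightarrow> g i z \<le> 1"
    and p: "p \<in> Z \<rightarrow>\<^sub>M Y"
    and eq: "\<And>i A m. i < n \<Longrightarrow> A \<in> sets Y \<Longrightarrow>
      (\<integral>\<^sup>+z. f i z * indicator A (p z) \<partial>Q m) = (\<integral>\<^sup>+z. g i z * indicator A (p z) \<partial>Q m)"
    and C: "C \<in> sets (PiM UNIV (\<lambda>_. count_space (UNIV :: bool set) \<Otimes>\<^sub>M Y))"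
  shows "(\<integral>\<^sup>+z. indicator C (\<lambda>i. (b i, p (z i))) * (\<Prod>i<n. f i (z i)) \<partial>marks)
       = (\<integral>\<^sup>+z. indicator C (\<lambda>i. (b i, p (z i))) * (\<Prod>i<n. g i (z i)) \<partial>marks)"
proof -
  let ?S = "PiM (UNIV :: nat set) (\<lambda>_. count_space (UNIV :: bool set) \<Otimes>\<^sub>M Y)"
  define T where "T z = (\<lambda>i. (b i, p (z i)))" for z :: "nat \<Rightarrow> 'z"
  interpret marks: prob_space marks by (rule prob_space_marks)
  have sp: "z i \<in> space Z" if "z \<in> space marks" for z i
    using that sets_eq_imp_space_eq[OF sets_marks] by (auto simp: space_PiM)
  have T [measurable]: "T \<in> marks \<rightarrow>\<^sub>M ?S"
    unfolding T_def
  proof (rule measurable_PiM_single')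
    have "(\<lambda>z. z i) \<in> marks \<rightarrow>\<^sub>M Z" for i by measurable
    from measurable_compose[OF this p]
    show "(\<lambda>z. (b i, p (z i))) \<in> marks \<rightarrow>\<^sub>M count_space UNIV \<Otimes>\<^sub>M Y" for i
      by simp
  qed (auto simp: space_PiM space_pair_measure sp measurable_space[OF p])
  have F: "(\<lambda>z. \<Prod>i<n. h i (z i)) \<in> borel_measurable marks"
    if "\<And>i. i < n \<Longrightarrow> h i \<in> borel_measurable Z" for h :: "nat \<Rightarrow> 'z \<Rightarrow> ennreal"
  proof (rule borel_measurable_prod_ennreal)
    fix i assume "i \<in> {..<n}"
    then have "h i \<in> borel_measurable Z" using that by auto
    moreover have "(\<lambda>z. z i) \<in> marks \<rightarrow>\<^sub>M Z" by measurable
    ultimately show "(\<lambda>z. h i (z i)) \<in> borel_measurable marks" by (rule measurable_compose[rotated])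
  qed
  \<comment> \<open>Each side as a measure in \<open>C\<close>: the image under \<open>T\<close> of
    \<open>marks\<close> weighted by the product. The bound of \<open>f i\<close> by 1 makes
    \<open>N f\<close> finite.\<close>
  define N where "N h = distr (density marks (\<lambda>z. \<Prod>i<n. h i (z i))) ?S T" for h :: "nat \<Rightarrow> 'z \<Rightarrow> ennreal"
  have N: "emeasure (N h) X = (\<integral>\<^sup>+z. indicator X (T z) * (\<Prod>i<n. h i (z i)) \<partial>marks)"
    if h: "\<And>i. i < n \<Longrightarrow> h i \<in> borel_measurable Z" and X [measurable]: "X \<in> sets ?S" for h X
  proof -
    note [measurable] = F[of h, OF h]
    have "emeasure (N h) X = emeasure (density marks (\<lambda>z. \<Prod>i<n. h i (z i))) (T -` X \<inter> space marks)"
      unfolding N_def by (subst emeasure_distr) auto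
    also have "\<dots> = (\<integral>\<^sup>+z. (\<Prod>i<n. h i (z i)) * indicator (T -` X \<inter> space marks) z \<partial>marks)"
      by (rule emeasure_density) measurable
    also have "\<dots> = (\<integral>\<^sup>+z. indicator X (T z) * (\<Prod>i<n. h i (z i)) \<partial>marks)"
      by (intro nn_integral_cong) (auto split: split_indicator)
    finally show ?thesis .
  qed
  have fin: "finite_measure (N f)"
  proof (rule finite_measureI)
    have "emeasure (N f) (space (N f)) = (\<integral>\<^sup>+z. indicator (space ?S) (T z) * (\<Prod>i<n. f i (z i)) \<partial>marks)"
      using N[of f "space ?S", OF f] by (simp add: N_def)
    also have "\<dots> \<le> (\<integral>\<^sup>+z. 1 \<partial>marks)"
    proof (rule nn_integral_mono)
      fix z assume "z \<in> space marks"
      then have "(\<Prod>i<n. f i (z i)) \<le> 1" using le(1) sp by (intro prod_le_1) auto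
      then show "indicator (space ?S) (T z) * (\<Prod>i<n. f i (z i)) \<le> 1"
        by (auto split: split_indicator)
    qed
    finally show "emeasure (N f) (space (N f)) \<noteq> \<infinity>"
      by (auto simp: marks.emeasure_space_1 top_unique)
  qed
  have "N f = N g"
  proof (rule measure_eqI_PiM_infinite[OF _ _ _ fin])
    fix A and K :: "nat set"
    assume K: "finite K" and A: "\<And>i. i \<in> K \<Longrightarrow> A i \<in> sets (count_space (UNIV :: bool set) \<Otimes>\<^sub>M Y)"
    let ?X = "prod_emb UNIV (\<lambda>_. count_space (UNIV :: bool set) \<Otimes>\<^sub>M Y) K (Pi\<^sub>E K A)"
    have X: "?X \<in> sets ?S" using K A by (intro sets_PiM_I) auto
    \<comment> \<open>The cylinder coordinates \<open>K\<close> and the weight coordinates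
      \<open>{..<n}\<close> may differ; missing factors are 1.\<close>
    let ?f = "\<lambda>h i z. (if i < n then h i z else 1) * (if i \<in> K then indicator (A i) (b i, p z) else (1 :: ennreal))"
    have expand: "emeasure (N h) ?X = (\<Prod>i\<in>K \<union> {..<n}. \<integral>\<^sup>+z. ?f h i z \<partial>Q (fst (prod_decode i)))"
      if h: "\<And>i. i < n \<Longrightarrow> h i \<in> borel_measurable Z" for h :: "nat \<Rightarrow> 'z \<Rightarrow> ennreal"
    proof -
      have "emeasure (N h) ?X = (\<integral>\<^sup>+z. indicator ?X (T z) * (\<Prod>i<n. h i (z i)) \<partial>marks)"
        by (rule N[OF h X])
      also have "\<dots> = (\<integral>\<^sup>+z. (\<Prod>i\<in>K \<union> {..<n}. ?f h i (z i)) \<partial>marks)"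
      proof (rule nn_integral_cong)
        fix z assume z: "z \<in> space marks"
        have "(\<Prod>i\<in>K. indicator (A i) (b i, p (z i)) :: ennreal) = indicator ?X (T z)"
        proof -
          have "T z \<in> space ?S" using measurable_space[OF T z] .
          then have "T z \<in> ?X \<longleftrightarrow> (\<forall>i\<in>K. (b i, p (z i)) \<in> A i)"
            by (auto simp: prod_emb_def space_PiM T_def PiE_iff)
          then show ?thesis
            using K by (auto simp: indicator_def)
        qed
        moreover have "(\<Prod>i\<in>K \<union> {..<n}. ?f h i (z i))
            = (\<Prod>i\<in>K \<union> {..<n}. if i < n then h i (z i) else 1)
              * (\<Prod>i\<in>K \<union> {..<n}. if i \<in> K then indicator (A i) (b i, p (z i)) else 1)"
          by (rule prod.distrib)
        moreover have "(\<Prod>i\<in>K \<union> {..<n}. if i < n then h i (z i) else 1) = (\<Prod>i<n. h i (z i))"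
          by (rule prod.mono_neutral_cong_right) (use K in auto)
        moreover have "(\<Prod>i\<in>K \<union> {..<n}. if i \<in> K then indicator (A i) (b i, p (z i)) else 1 :: ennreal)
            = (\<Prod>i\<in>K. indicator (A i) (b i, p (z i)))"
          by (rule prod.mono_neutral_cong_right) (use K in auto)
        ultimately show "indicator ?X (T z) * (\<Prod>i<n. h i (z i)) = (\<Prod>i\<in>K \<union> {..<n}. ?f h i (z i))"
          by (simp add: mult.commute)
      qed
      also have "\<dots> = (\<Prod>i\<in>K \<union> {..<n}. \<integral>\<^sup>+z. ?f h i z \<partial>Q (fst (prod_decode i)))"
        unfolding marks_def
      proof (rule nn_integral_PiM_UNIV_prod[OF prob_Q])
        fix i
        have "(\<lambda>z. (b i, p z)) \<in> Z \<rightarrow>\<^sub>M count_space UNIV \<Otimes>\<^sub>M Y" using p by simp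
        then have "(\<lambda>z. indicator (A i) (b i, p z) :: ennreal) \<in> borel_measurable Z" if "i \<in> K"
          using A[OF that] by (rule measurable_compose[OF _ borel_measurable_indicator])
        then show "?f h i \<in> borel_measurable (Q (fst (prod_decode i)))"
          unfolding measurable_cong_sets[OF sets_Q refl] using h[of i]
          by (cases "i < n"; cases "i \<in> K") (simp_all add: borel_measurable_times_ennreal)
      qed (use K in auto)
      finally show ?thesis .
    qed
    have "(\<integral>\<^sup>+z. ?f f i z \<partial>Q m) = (\<integral>\<^sup>+z. ?f g i z \<partial>Q m)" for i m
    proof (cases "i < n")
      case True
      show ?thesis
      proof (cases "i \<in> K")
        case True
        \<comment> \<open>Since \<open>b i\<close> is fixed, only the section of \<open>A i\<close>
          at \<open>b i\<close> is seen, a set in \<open>Y\<close> to which \<open>eq\<close>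
          applies.\<close>
        have "Pair (b i) -` A i \<in> sets Y"
          by (rule sets_Pair1[OF A[OF True]])
        from eq[OF \<open>i < n\<close> this, of m] show ?thesis
          using True \<open>i < n\<close> by (simp add: indicator_def)
      next
        \<comment> \<open>A coordinate without cylinder condition is the case
          \<open>A = space Y\<close> of \<open>eq\<close>.\<close>
        case False
        have "(\<integral>\<^sup>+z. h z * indicator (space Y) (p z) \<partial>Q m) = (\<integral>\<^sup>+z. h z \<partial>Q m)" for h :: "'z \<Rightarrow> ennreal"
          using measurable_space[OF p] sets_eq_imp_space_eq[OF sets_Q]
          by (intro nn_integral_cong) (auto split: split_indicator)
        then show ?thesis
          using eq[OF \<open>i < n\<close> sets.top, of m] False True by simp
      qed
    qed simp
    then show "emeasure (N f) ?X = emeasure (N g) ?X"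
      by (simp only: expand[OF f] expand[OF g])
  qed (simp_all add: N_def)
  then show ?thesis
    using N[of f C, OF f C] N[of g C, OF g C] by (simp add: T_def)
qed

end

text \<open>The points of the block construction are pairs of a centre and a daughter. Every
  candidate has its daughter, kept or not, so the last property holds for all \<open>i < n\<close>
  and not only for indices in \<open>J \<omega>\<close>.\<close>

lemma exists_marked_poisson_process:
  fixes Y :: "'y measure" and D :: "'d measure"
  assumes sf: "sigma_finite_measure Y" and "space Y \<noteq> {}" and \<kappa>: "\<kappa> \<in> Y \<rightarrow>\<^sub>M prob_algebra D"
  obtains P :: "(nat \<Rightarrow> nat \<times> 'y \<times> 'd) measure"
    and J :: "(nat \<Rightarrow> nat \<times> 'y \<times> 'd) \<Rightarrow> nat set" and c d where
    "prob_space P"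
    "\<And>i. {\<omega>\<in>space P. i \<in> J \<omega>} \<in> sets P"
    "\<And>i. c i \<in> P \<rightarrow>\<^sub>M Y" "\<And>i. d i \<in> P \<rightarrow>\<^sub>M D"
    "\<And>h. (\<And>i. h i \<in> borel_measurable P) \<Longrightarrow>
      (\<lambda>\<omega>. \<integral>\<^sup>+i. h i \<omega> \<partial>count_space (J \<omega>)) \<in> borel_measurable P"
    "\<And>h. h \<in> borel_measurable (Y \<Otimes>\<^sub>M D) \<Longrightarrow>
      (\<integral>\<^sup>+\<omega>. ennreal (exp_neg (\<integral>\<^sup>+i. h (c i \<omega>, d i \<omega>) \<partial>count_space (J \<omega>))) \<partial>P)
      = ennreal (exp_neg (\<integral>\<^sup>+y. (\<integral>\<^sup>+x. ennreal (1 - exp_neg (h (y, x))) \<partial>\<kappa> y) \<partial>Y))"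
    "\<And>C n E. C \<in> sets (PiM UNIV (\<lambda>_. count_space UNIV \<Otimes>\<^sub>M Y)) \<Longrightarrow> E ` {..<n} \<subseteq> sets D \<Longrightarrow>
      emeasure P {\<omega>\<in>space P. (\<lambda>i. (i \<in> J \<omega>, c i \<omega>)) \<in> C \<and> (\<forall>i<n. d i \<omega> \<in> E i)}
      = (\<integral>\<^sup>+\<omega>. indicator C (\<lambda>i. (i \<in> J \<omega>, c i \<omega>)) * (\<Prod>i<n. emeasure (\<kappa> (c i \<omega>)) (E i)) \<partial>P)"
proof -
  interpret Y: sigma_finite_measure Y by fact
  obtain q rate where q: "\<And>m::nat. prob_space (q m)" "\<And>m. sets (q m) = sets Y" and rate: "\<And>m. 0 \<le> rate m"
    and mix: "\<And>g. g \<in> borel_measurable Y \<Longrightarrow> (\<Sum>m. ennreal (rate m) * (\<integral>\<^sup>+y. g y \<partial>q m)) = (\<integral>\<^sup>+y. g y \<partial>Y)"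
    using Y.exists_prob_mixture[OF \<open>space Y \<noteq> {}\<close>] by metis
  define Z where "Z = Y \<Otimes>\<^sub>M D"
  \<comment> \<open>\<open>R y\<close> is the law of the pair of \<open>y\<close> and a daughter
    drawn from \<open>\<kappa> y\<close>; averaging over the centre law \<open>q m\<close> gives the
    joint law \<open>Q m\<close>.\<close>
  define R where "R y = \<kappa> y \<bind> (\<lambda>x. return Z (y, x))" for y
  define Q where "Q m = q m \<bind> R" for m
  note [measurable] = \<kappa>
  have R [measurable]: "R \<in> Y \<rightarrow>\<^sub>M prob_algebra Z"
    unfolding R_def[abs_def] Z_def by measurable
  have q_in: "q m \<in> space (prob_algebra Y)" for m
    using q by (simp add: space_prob_algebra)
  have Q_in: "Q m \<in> space (prob_algebra Z)" for m
    using prob_space_bind'[OF q_in R] sets_bind'[OF q_in R] by (simp add: space_prob_algebra Q_def)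
  have \<kappa>_sets: "sets (\<kappa> y) = sets D" "prob_space (\<kappa> y)" if "y \<in> space Y" for y
    using measurable_space[OF \<kappa> that] by (auto simp: space_prob_algebra)
  have int_R: "(\<integral>\<^sup>+z. g z \<partial>R y) = (\<integral>\<^sup>+x. g (y, x) \<partial>\<kappa> y)"
    if [measurable]: "g \<in> borel_measurable Z" and y: "y \<in> space Y" for g :: "'y \<times> 'd \<Rightarrow> ennreal" and y
  proof -
    have "Pair y \<in> \<kappa> y \<rightarrow>\<^sub>M Z"
      unfolding Z_def measurable_cong_sets[OF \<kappa>_sets(1)[OF y] refl] using y by simp
    then have m: "(\<lambda>x. return Z (y, x)) \<in> \<kappa> y \<rightarrow>\<^sub>M subprob_algebra Z"
      by (rule measurable_compose[OF _ return_measurable])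
    have "(\<integral>\<^sup>+z. g z \<partial>R y) = (\<integral>\<^sup>+x. (\<integral>\<^sup>+z. g z \<partial>return Z (y, x)) \<partial>\<kappa> y)"
      unfolding R_def by (rule nn_integral_bind[OF _ m]) measurable
    also have "\<dots> = (\<integral>\<^sup>+x. g (y, x) \<partial>\<kappa> y)"
      using y sets_eq_imp_space_eq[OF \<kappa>_sets(1)[OF y]]
      by (intro nn_integral_cong nn_integral_return) (auto simp: Z_def space_pair_measure that[unfolded Z_def])
    finally show ?thesis .
  qed
  have int_Q: "(\<integral>\<^sup>+z. g z \<partial>Q m) = (\<integral>\<^sup>+y. (\<integral>\<^sup>+x. g (y, x) \<partial>\<kappa> y) \<partial>q m)"
    if g [measurable]: "g \<in> borel_measurable Z" for g :: "'y \<times> 'd \<Rightarrow> ennreal" and m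
  proof -
    have "R \<in> q m \<rightarrow>\<^sub>M subprob_algebra Z"
      unfolding measurable_cong_sets[OF q(2) refl] by (rule measurable_prob_algebraD[OF R])
    then have "(\<integral>\<^sup>+z. g z \<partial>Q m) = (\<integral>\<^sup>+y. (\<integral>\<^sup>+z. g z \<partial>R y) \<partial>q m)"
      unfolding Q_def by (rule nn_integral_bind[OF g])
    also have "\<dots> = (\<integral>\<^sup>+y. (\<integral>\<^sup>+x. g (y, x) \<partial>\<kappa> y) \<partial>q m)"
      using sets_eq_imp_space_eq[OF q(2)] by (intro nn_integral_cong int_R) auto
    finally show ?thesis .
  qed
  have Q: "prob_space (Q m)" "sets (Q m) = sets Z" for m
    using Q_in[of m] by (simp_all add: space_prob_algebra)
  interpret blocks: marked_blocks Z Q rate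
    by (intro marked_blocks.intro Q rate)
  define J where "J = (blocks.kept :: (nat \<Rightarrow> nat \<times> 'y \<times> 'd) \<Rightarrow> nat set)"
  define c where "c i \<omega> = fst (snd (\<omega> i))" for i :: nat and \<omega> :: "nat \<Rightarrow> nat \<times> 'y \<times> 'd"
  define d where "d i \<omega> = snd (snd (\<omega> i))" for i :: nat and \<omega> :: "nat \<Rightarrow> nat \<times> 'y \<times> 'd"
  have c [measurable]: "c i \<in> blocks.block_space \<rightarrow>\<^sub>M Y" for i
    unfolding c_def [abs_def] by (rule measurable_compose[OF blocks.measurable_snd_block_space]) (simp add: Z_def)
  have d [measurable]: "d i \<in> blocks.block_space \<rightarrow>\<^sub>M D" for i
    unfolding d_def [abs_def] by (rule measurable_compose[OF blocks.measurable_snd_block_space]) (simp add: Z_def)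
  have J [measurable]: "Measurable.pred blocks.block_space (\<lambda>\<omega>. i \<in> J \<omega>)" for i
    unfolding J_def by (rule blocks.pred_kept)
  show thesis
  proof (rule that[of blocks.block_space J c d])
    show "prob_space blocks.block_space" by (rule blocks.prob_space_block_space)
    show "{\<omega>\<in>space blocks.block_space. i \<in> J \<omega>} \<in> sets blocks.block_space" for i by measurable
    show "c i \<in> blocks.block_space \<rightarrow>\<^sub>M Y" "d i \<in> blocks.block_space \<rightarrow>\<^sub>M D" for i by measurable
    show "(\<lambda>\<omega>. \<integral>\<^sup>+i. h i \<omega> \<partial>count_space (J \<omega>)) \<in> borel_measurable blocks.block_space"
      if "\<And>i. h i \<in> borel_measurable blocks.block_space" for h
      unfolding J_def using that by (rule blocks.measurable_nn_integral_kept)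
  next
    fix h :: "'y \<times> 'd \<Rightarrow> ennreal" assume "h \<in> borel_measurable (Y \<Otimes>\<^sub>M D)"
    then have h [measurable]: "h \<in> borel_measurable Z" by (simp add: Z_def)
    have "(\<lambda>y. \<integral>\<^sup>+z. ennreal (1 - exp_neg (h z)) \<partial>R y) \<in> borel_measurable Y"
      by (rule measurable_compose[OF measurable_prob_algebraD[OF R] nn_integral_measurable_subprob_algebra]) measurable
    then have m: "(\<lambda>y. \<integral>\<^sup>+x. ennreal (1 - exp_neg (h (y, x))) \<partial>\<kappa> y) \<in> borel_measurable Y"
      by (simp add: int_R cong: measurable_cong)
    have "(\<integral>\<^sup>+\<omega>. ennreal (exp_neg (\<integral>\<^sup>+i. h (c i \<omega>, d i \<omega>) \<partial>count_space (J \<omega>))) \<partial>blocks.block_space)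
        = ennreal (exp_neg (\<Sum>m. ennreal (rate m) * (\<integral>\<^sup>+z. ennreal (1 - exp_neg (h z)) \<partial>Q m)))"
      using blocks.nn_integral_exp_neg_block_space[OF h] by (simp add: c_def d_def J_def)
    also have "(\<Sum>m. ennreal (rate m) * (\<integral>\<^sup>+z. ennreal (1 - exp_neg (h z)) \<partial>Q m))
        = (\<integral>\<^sup>+y. (\<integral>\<^sup>+x. ennreal (1 - exp_neg (h (y, x))) \<partial>\<kappa> y) \<partial>Y)"
      by (subst int_Q) (simp_all add: mix[OF m])
    finally show "(\<integral>\<^sup>+\<omega>. ennreal (exp_neg (\<integral>\<^sup>+i. h (c i \<omega>, d i \<omega>) \<partial>count_space (J \<omega>))) \<partial>blocks.block_space)
        = ennreal (exp_neg (\<integral>\<^sup>+y. (\<integral>\<^sup>+x. ennreal (1 - exp_neg (h (y, x))) \<partial>\<kappa> y) \<partial>Y))" .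
  next
    fix C :: "(nat \<Rightarrow> bool \<times> 'y) set" and n :: nat and E :: "nat \<Rightarrow> 'd set"
    assume C [measurable]: "C \<in> sets (PiM UNIV (\<lambda>_. count_space UNIV \<Otimes>\<^sub>M Y))" and E: "E ` {..<n} \<subseteq> sets D"
    let ?T = "\<lambda>\<omega>. (\<lambda>i. (i \<in> J \<omega>, c i \<omega>))"
    have T: "?T \<in> blocks.block_space \<rightarrow>\<^sub>M PiM UNIV (\<lambda>_. count_space UNIV \<Otimes>\<^sub>M Y)"
      by (rule measurable_PiM_single') (auto simp: space_PiM space_pair_measure measurable_space[OF c])
    note [measurable] = measurable_compose[OF T borel_measurable_indicator[OF C]]
    have E' [measurable]: "E i \<in> sets D" if "i \<in> {..<n}" for i using E that by auto
    have ind_d: "(\<lambda>\<omega>. indicator (E i) (d i \<omega>) :: ennreal) \<in> borel_measurable blocks.block_space" if "i \<in> {..<n}" for i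
      by (rule measurable_compose[OF d borel_measurable_indicator[OF E'[OF that]]])
    have \<kappa>_E: "(\<lambda>y. emeasure (\<kappa> y) (E i)) \<in> borel_measurable Y" if "i \<in> {..<n}" for i
      by (rule measurable_compose[OF measurable_prob_algebraD[OF \<kappa>] measurable_emeasure_subprob_algebra[OF E'[OF that]]])
    have "{\<omega>\<in>space blocks.block_space. ?T \<omega> \<in> C \<and> (\<forall>i<n. d i \<omega> \<in> E i)} \<in> sets blocks.block_space"
    proof -
      have "{\<omega>\<in>space blocks.block_space. ?T \<omega> \<in> C \<and> (\<forall>i<n. d i \<omega> \<in> E i)}
          = (?T -` C \<inter> space blocks.block_space) \<inter> {\<omega>\<in>space blocks.block_space. \<forall>i\<in>{..<n}. d i \<omega> \<in> E i}"
        by auto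
      moreover have "{\<omega>\<in>space blocks.block_space. \<forall>i\<in>{..<n}. d i \<omega> \<in> E i} \<in> sets blocks.block_space"
      proof (rule sets.sets_Collect_finite_All)
        show "{\<omega>\<in>space blocks.block_space. d i \<omega> \<in> E i} \<in> sets blocks.block_space" if "i \<in> {..<n}" for i
          using measurable_sets[OF d E'[OF that]] by (simp add: vimage_def Int_def conj_commute)
      qed simp
      ultimately show ?thesis using measurable_sets[OF T C] by auto
    qed
    then have "emeasure blocks.block_space {\<omega>\<in>space blocks.block_space. ?T \<omega> \<in> C \<and> (\<forall>i<n. d i \<omega> \<in> E i)}
        = (\<integral>\<^sup>+\<omega>. indicator {\<omega>\<in>space blocks.block_space. ?T \<omega> \<in> C \<and> (\<forall>i<n. d i \<omega> \<in> E i)} \<omega> \<partial>blocks.block_space)"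
      by (rule nn_integral_indicator[symmetric])
    also have "\<dots> = (\<integral>\<^sup>+\<omega>. indicator C (?T \<omega>) * (\<Prod>i<n. indicator (E i) (d i \<omega>)) \<partial>blocks.block_space)"
      by (intro nn_integral_cong) (auto simp: indicator_def)
    also have "\<dots> = (\<integral>\<^sup>+k. (\<integral>\<^sup>+z. indicator C (\<lambda>i. (i \<in> J (\<lambda>i. (k i, z i)), fst (z i)))
        * (\<Prod>i<n. indicator (E i) (snd (z i))) \<partial>blocks.marks) \<partial>blocks.counts)"
      by (subst blocks.nn_integral_block_space)
         (auto simp: c_def d_def intro!: borel_measurable_times_ennreal borel_measurable_prod_ennreal
           ind_d[unfolded d_def] measurable_compose[OF T[unfolded c_def] borel_measurable_indicator[OF C]])
    also have "\<dots> = (\<integral>\<^sup>+k. (\<integral>\<^sup>+z. indicator C (\<lambda>i. (i \<in> J (\<lambda>i. (k i, z i)), fst (z i)))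
        * (\<Prod>i<n. emeasure (\<kappa> (fst (z i))) (E i)) \<partial>blocks.marks) \<partial>blocks.counts)"
    proof (rule nn_integral_cong)
      fix k
      \<comment> \<open>The kept indices depend on the counts \<open>k\<close> alone. With
        \<open>k\<close> fixed they supply the sequence \<open>b\<close> of
        \<open>nn_integral_marks_prod_indicator_eq\<close>.\<close>
      have J_eq: "J (\<lambda>i. (k i, z i)) = {i. snd (prod_decode i) < k (fst (prod_decode i))}" for z
        by (simp add: J_def blocks.kept_def)
      show "(\<integral>\<^sup>+z. indicator C (\<lambda>i. (i \<in> J (\<lambda>i. (k i, z i)), fst (z i)))
            * (\<Prod>i<n. indicator (E i) (snd (z i))) \<partial>blocks.marks)
          = (\<integral>\<^sup>+z. indicator C (\<lambda>i. (i \<in> J (\<lambda>i. (k i, z i)), fst (z i)))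
            * (\<Prod>i<n. emeasure (\<kappa> (fst (z i))) (E i)) \<partial>blocks.marks)"
        unfolding J_eq
      proof (rule blocks.nn_integral_marks_prod_indicator_eq[where Y=Y])
        have fstm: "fst \<in> Z \<rightarrow>\<^sub>M Y" and sndm: "snd \<in> Z \<rightarrow>\<^sub>M D" unfolding Z_def by measurable
        show "fst \<in> Z \<rightarrow>\<^sub>M Y" by fact
        show E1: "(\<lambda>z. indicator (E i) (snd z) :: ennreal) \<in> borel_measurable Z" if "i < n" for i
          by (rule measurable_compose[OF sndm borel_measurable_indicator[OF E']]) (use that in simp)
        show E2: "(\<lambda>z. emeasure (\<kappa> (fst z)) (E i)) \<in> borel_measurable Z" if "i < n" for i
          by (rule measurable_compose[OF fstm \<kappa>_E]) (use that in simp)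
        show "emeasure (\<kappa> (fst z)) (E i) \<le> 1" if "z \<in> space Z" for i z
        proof -
          have "fst z \<in> space Y" using that by (auto simp: Z_def space_pair_measure)
          then show ?thesis
            by (intro prob_space.emeasure_le_1 \<kappa>_sets)
        qed
        show "indicator (E i) (snd z) \<le> (1 :: ennreal)" for i z by (simp split: split_indicator)
        fix i A m assume i: "i < n" and A: "A \<in> sets Y"
        have mA: "(\<lambda>z. indicator A (fst z) :: ennreal) \<in> borel_measurable Z"
          by (rule measurable_compose[OF fstm borel_measurable_indicator[OF A]])
        have "(\<integral>\<^sup>+z. indicator (E i) (snd z) * indicator A (fst z) \<partial>Q m)
            = (\<integral>\<^sup>+y. (\<integral>\<^sup>+x. indicator (E i) x * indicator A y \<partial>\<kappa> y) \<partial>q m)"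
          using E1[OF i] mA by (subst int_Q) auto
        also have "\<dots> = (\<integral>\<^sup>+y. (\<integral>\<^sup>+x. emeasure (\<kappa> y) (E i) * indicator A y \<partial>\<kappa> y) \<partial>q m)"
        \<comment> \<open>Given the centre \<open>y\<close>, the daughter is integrated out. The
          integrand on the right is constant in \<open>x\<close>, which brings it into the form
          needed for \<open>int_Q\<close>.\<close>
        proof (rule nn_integral_cong)
          fix y assume "y \<in> space (q m)"
          then have y: "y \<in> space Y" using sets_eq_imp_space_eq[OF q(2)] by simp
          have Ei: "E i \<in> sets (\<kappa> y)" using E'[of i] i \<kappa>_sets(1)[OF y] by simp
          show "(\<integral>\<^sup>+x. indicator (E i) x * indicator A y \<partial>\<kappa> y)
              = (\<integral>\<^sup>+x. emeasure (\<kappa> y) (E i) * indicator A y \<partial>\<kappa> y)"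
            using Ei prob_space.emeasure_space_1[OF \<kappa>_sets(2)[OF y]] by (simp add: nn_integral_multc)
        qed
        also have "\<dots> = (\<integral>\<^sup>+z. emeasure (\<kappa> (fst z)) (E i) * indicator A (fst z) \<partial>Q m)"
          using E2[OF i] mA by (subst int_Q) auto
        finally show "(\<integral>\<^sup>+z. indicator (E i) (snd z) * indicator A (fst z) \<partial>Q m)
            = (\<integral>\<^sup>+z. emeasure (\<kappa> (fst z)) (E i) * indicator A (fst z) \<partial>Q m)" .
      qed (rule C)
    qed
    also have "\<dots> = (\<integral>\<^sup>+\<omega>. indicator C (?T \<omega>) * (\<Prod>i<n. emeasure (\<kappa> (c i \<omega>)) (E i)) \<partial>blocks.block_space)"
      by (subst blocks.nn_integral_block_space)
         (auto simp: c_def intro!: borel_measurable_times_ennreal borel_measurable_prod_ennreal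
           measurable_compose[OF c[unfolded c_def] \<kappa>_E] measurable_compose[OF T[unfolded c_def] borel_measurable_indicator[OF C]])
    finally show "emeasure blocks.block_space {\<omega>\<in>space blocks.block_space. ?T \<omega> \<in> C \<and> (\<forall>i<n. d i \<omega> \<in> E i)}
        = (\<integral>\<^sup>+\<omega>. indicator C (?T \<omega>) * (\<Prod>i<n. emeasure (\<kappa> (c i \<omega>)) (E i)) \<partial>blocks.block_space)" .
  qed
qed

section \<open>The support of the Levy measure\<close>

lemma prob_measures_subset_radon_space:
  "\<mu> \<in> prob_measures \<Longrightarrow> \<mu> \<in> space radon_space"
  by (auto simp: space_prob_algebra space_radon_space
      intro: le_less_trans[OF prob_space.emeasure_le_1 ennreal_one_less_top])

lemma emeasure_UNIV_pos:
  assumes "\<mu> \<in> space radon_space" "\<mu> \<noteq> null_measure borel"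
  shows "0 < emeasure \<mu> UNIV"
proof (rule ccontr)
  assume "\<not> 0 < emeasure \<mu> UNIV"
  then have 0: "emeasure \<mu> UNIV = 0" by simp
  have sets: "sets \<mu> = sets borel" using assms(1) by (simp add: space_radon_space)
  have "\<mu> = null_measure borel"
  proof (rule measure_eqI)
    fix A assume "A \<in> sets \<mu>"
    then have "emeasure \<mu> A \<le> emeasure \<mu> UNIV" by (intro emeasure_mono) (auto simp: sets)
    then show "emeasure \<mu> A = emeasure (null_measure borel) A" using 0 by simp
  qed (simp add: sets)
  then show False using assms(2) by simp
qed

text \<open>The \<open>B i\<close> with \<open>1 \<le> i\<close> cover the space, so a nonzero
  measure charges one of them, and local finiteness gives the upper bound. Hence the
  \<open>LEAST\<close> in \<open>polar_index\<close> is attained.\<close>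

lemma exists_base_emeasure_pos:
  assumes B: "rel_compact_base B" and \<mu>: "\<mu> \<in> space radon_space" "\<mu> \<noteq> null_measure borel"
  shows "\<exists>i\<ge>1. 0 < emeasure \<mu> (B i) \<and> emeasure \<mu> (B i) < \<infinity>"
proof (rule ccontr)
  assume *: "\<not> ?thesis"
  have sets: "sets \<mu> = sets borel" using \<mu>(1) by (simp add: space_radon_space)
  have "emeasure \<mu> (B (Suc i)) = 0" for i
    using * \<mu>(1) unfolding radon_space_iff_finite_on_base[OF B] by (auto dest!: spec[of _ "Suc i"])
  then have "emeasure \<mu> (\<Union>i. B (Suc i)) = 0"
    using rel_compact_baseD(2)[OF B] by (intro emeasure_UN_eq_0) (auto simp: sets)
  moreover have "(\<Union>i. B (Suc i)) = UNIV"
    using rel_compact_baseD(3)[OF B] by (auto simp: set_eq_iff) (metis atLeast_iff Suc_le_D)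
  ultimately show False using emeasure_UNIV_pos[OF \<mu>] by simp
qed

lemma polar_index_pos:
  assumes "rel_compact_base B" "\<mu> \<in> space radon_space" "\<mu> \<noteq> null_measure borel"
  shows "0 < emeasure \<mu> (B (polar_index B \<mu>))" "emeasure \<mu> (B (polar_index B \<mu>)) < \<infinity>"
  using exists_base_emeasure_pos[OF assms]
    LeastI_ex[of "\<lambda>i. 0 < emeasure \<mu> (B i) \<and> emeasure \<mu> (B i) < \<infinity>", folded polar_index_def] by auto

lemma polar_index_finite:
  assumes B: "rel_compact_base B" and \<mu>: "\<mu> \<in> space radon_space" "\<mu> \<noteq> null_measure borel" "emeasure \<mu> UNIV < \<infinity>"
  shows "polar_index B \<mu> = 0"
  unfolding polar_index_def
  using emeasure_UNIV_pos[OF \<mu>(1,2)] \<mu>(3) rel_compact_baseD(5)[OF B] by (intro Least_eq_0) simp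

lemma prob_measures_subset_polar_sphere:
  assumes B: "rel_compact_base B"
  shows "prob_measures \<subseteq> polar_sphere B"
proof
  fix \<mu> :: "'a measure" assume \<mu>: "\<mu> \<in> prob_measures"
  then have rad: "\<mu> \<in> space radon_space" by (rule prob_measures_subset_radon_space)
  have one: "emeasure \<mu> UNIV = 1" using in_space_prob_algebra[OF \<mu>] by simp
  then have "\<mu> \<noteq> null_measure borel" by auto
  then show "\<mu> \<in> polar_sphere B"
    using rad one polar_index_finite[OF B rad] rel_compact_baseD(5)[OF B] by (simp add: polar_sphere_def)
qed

text \<open>A finite nonzero measure has polar index 0, so on the sphere its total mass is 1.
  Support on \<open>prob_measures\<close> thus becomes a condition on total mass, which is invariant
  under scaling.\<close>

lemma polar_sphere_Diff_prob_measures: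
  assumes B: "rel_compact_base B"
  shows "polar_sphere B - prob_measures = {\<mu>\<in>polar_sphere B. emeasure \<mu> UNIV = \<infinity>}"
proof (intro set_eqI iffI)
  fix \<mu> :: "'a measure" assume \<mu>: "\<mu> \<in> polar_sphere B - prob_measures"
  then have rad: "\<mu> \<in> space radon_space" "\<mu> \<noteq> null_measure borel" "emeasure \<mu> (B (polar_index B \<mu>)) = 1"
    and np: "\<mu> \<notin> prob_measures" by (auto simp: polar_sphere_def)
  have sets: "sets \<mu> = sets borel" using rad(1) by (simp add: space_radon_space)
  have "emeasure \<mu> UNIV = \<infinity>"
  proof (rule ccontr)
    assume "emeasure \<mu> UNIV \<noteq> \<infinity>"
    then have "emeasure \<mu> UNIV = 1"
      using rad polar_index_finite[OF B rad(1,2)] rel_compact_baseD(5)[OF B] by (simp add: less_top)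
    then have "\<mu> \<in> prob_measures"
      using sets sets_eq_imp_space_eq[OF sets] by (auto simp: space_prob_algebra intro: prob_spaceI)
    with np show False ..
  qed
  with \<mu> show "\<mu> \<in> {\<mu>\<in>polar_sphere B. emeasure \<mu> UNIV = \<infinity>}" by simp
next
  fix \<mu> :: "'a measure" assume "\<mu> \<in> {\<mu>\<in>polar_sphere B. emeasure \<mu> UNIV = \<infinity>}"
  then show "\<mu> \<in> polar_sphere B - prob_measures" by (auto dest: in_space_prob_algebra)
qed

section \<open>Homogeneity and the equivalence of the support conditions\<close>

lemma polar_index_scale:
  assumes "0 < t"
  shows "polar_index B (scale_measure (ennreal t) \<mu>) = polar_index B \<mu>"
proof -
  have "0 < ennreal t * x \<and> ennreal t * x < \<infinity> \<longleftrightarrow> 0 < x \<and> x < \<infinity>" for x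
    using assms by (auto simp: ennreal_zero_less_mult_iff ennreal_mult_less_top)
  then show ?thesis by (simp add: polar_index_def)
qed

lemma scale_measure_radon:
  assumes "0 < t" "\<mu> \<in> space radon_space" "\<mu> \<noteq> null_measure borel"
  shows "scale_measure (ennreal t) \<mu> \<in> space radon_space" "scale_measure (ennreal t) \<mu> \<noteq> null_measure borel"
proof -
  show "scale_measure (ennreal t) \<mu> \<in> space radon_space"
    using assms by (auto simp: space_radon_space ennreal_mult_less_top)
  have "0 < emeasure (scale_measure (ennreal t) \<mu>) UNIV"
    using assms emeasure_UNIV_pos[OF assms(2,3)] by (simp add: ennreal_zero_less_mult_iff)
  then show "scale_measure (ennreal t) \<mu> \<noteq> null_measure borel"
    by (metis emeasure_null_measure less_irrefl)
qed

lemma scale_measure_cancel: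
  assumes "0 < t"
  shows "scale_measure (ennreal t) (scale_measure (ennreal (1 / t)) \<mu>) = \<mu>"
proof -
  have "ennreal t * ennreal (1 / t) = 1" using assms by (simp add: ennreal_mult[symmetric])
  then show ?thesis by (simp add: scale_scale_measure)
qed

text \<open>Both conditions say that the measures of infinite total mass form a null set.
  \<open>W e\<close> collects those of polar mass at least \<open>e\<close>: the spectral side is a
  positive multiple of the Levy mass of \<open>W 1\<close>, all dilates of \<open>W 1\<close> are
  null together by homogeneity, and they exhaust everything as \<open>e\<close> decreases to
  0.\<close>

lemma supported_by_levy_measure_iff:
  assumes B: "rel_compact_base B" and \<alpha>: "\<alpha> < 1"
    and \<sigma>: "sets \<sigma> = sets (restrict_space radon_space (polar_sphere B))"
    and levy: "levy_measure \<alpha> L \<Lambda>" and polar: "polar_part B \<alpha> \<Lambda> \<sigma>"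
  shows "supported_by \<Lambda> {\<mu>. emeasure \<mu> UNIV < \<infinity>} \<longleftrightarrow> supported_by \<sigma> prob_measures"
proof -
  define W where "W e = {\<mu>\<in>space \<Lambda>. emeasure \<mu> UNIV = \<infinity> \<and> e \<le> emeasure \<mu> (B (polar_index B \<mu>))}" for e
  have sets_\<Lambda> [measurable_cong]: "sets \<Lambda> = sets (restrict_space radon_space (- {null_measure borel}))"
    and scaling: "\<And>t A. 0 < t \<Longrightarrow> A \<in> sets \<Lambda> \<Longrightarrow>
        emeasure \<Lambda> (scale_measure (ennreal t) ` A) = ennreal (t powr (- \<alpha>)) * emeasure \<Lambda> A"
    using levy by (auto simp: levy_measure_def)
  have sp_\<Lambda>: "space \<Lambda> = {\<mu>\<in>space radon_space. \<mu> \<noteq> null_measure borel}"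
    using sets_eq_imp_space_eq[OF sets_\<Lambda>] by (auto simp: space_restrict_space)
  have sp_\<sigma>: "space \<sigma> = polar_sphere B"
    using sets_eq_imp_space_eq[OF \<sigma>] by (auto simp: space_restrict_space polar_sphere_def)
  have em [measurable]: "(\<lambda>\<mu>. emeasure \<mu> A) \<in> borel_measurable \<Lambda>" if "A \<in> sets borel" for A
    unfolding measurable_cong_sets[OF sets_\<Lambda> refl]
    by (intro measurable_restrict_space1 measurable_emeasure_radon_space that)
  have emB [measurable]: "(\<lambda>\<mu>. emeasure \<mu> (B i)) \<in> borel_measurable \<Lambda>" for i
    by (rule em) (rule rel_compact_baseD(2)[OF B])
  have [measurable]: "polar_index B \<in> \<Lambda> \<rightarrow>\<^sub>M count_space UNIV"
    unfolding polar_index_def[abs_def] by measurable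
  have [measurable]: "(\<lambda>\<mu>. emeasure \<mu> (B (polar_index B \<mu>))) \<in> borel_measurable \<Lambda>"
    by (rule measurable_compose_countable[where f="\<lambda>i \<mu>. emeasure \<mu> (B i)"]) measurable
  have [measurable]: "(\<lambda>\<mu>. emeasure \<mu> UNIV) \<in> borel_measurable \<Lambda>" by (rule em) simp
  have W [measurable]: "W e \<in> sets \<Lambda>" for e unfolding W_def by measurable
  have scale_in: "scale_measure (ennreal t) \<mu> \<in> W (ennreal t * e)" if t: "0 < t" and \<mu>: "\<mu> \<in> W e" for t e \<mu>
    using \<mu> t scale_measure_radon[OF t]
    by (auto simp: W_def sp_\<Lambda> polar_index_scale ennreal_mult_top intro: mult_left_mono)
  have image: "scale_measure (ennreal t) ` W 1 = W (ennreal t)" if t: "0 < t" for t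
  proof
    show "scale_measure (ennreal t) ` W 1 \<subseteq> W (ennreal t)" using scale_in[OF t, of _ 1] by auto
    show "W (ennreal t) \<subseteq> scale_measure (ennreal t) ` W 1"
    proof
      fix \<mu> assume "\<mu> \<in> W (ennreal t)"
      moreover have "ennreal (1 / t) * ennreal t = 1" using t by (simp add: ennreal_mult[symmetric])
      ultimately have "scale_measure (ennreal (1 / t)) \<mu> \<in> W 1"
        using scale_in[of "1 / t" \<mu> "ennreal t"] t by simp
      then have "scale_measure (ennreal t) (scale_measure (ennreal (1 / t)) \<mu>) \<in> scale_measure (ennreal t) ` W 1"
        by (rule imageI)
      then show "\<mu> \<in> scale_measure (ennreal t) ` W 1"
        by (simp only: scale_measure_cancel[OF t])
    qed
  qed
  define S where "S = {\<mu>\<in>polar_sphere B. emeasure \<mu> UNIV = \<infinity>}"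
  \<comment> \<open>The radial coordinate of \<open>\<nu>\<close> is its polar mass
    \<open>t\<close>: dividing by it lands on the sphere, and \<open>1 \<le> t\<close> is the
    condition in \<open>W 1\<close>.\<close>
  have cone: "{scale_measure (ennreal t) \<mu> | t \<mu>. \<mu> \<in> S \<and> 1 \<le> t} = W 1"
  proof (intro set_eqI iffI)
    fix \<nu> assume "\<nu> \<in> {scale_measure (ennreal t) \<mu> | t \<mu>. \<mu> \<in> S \<and> 1 \<le> t}"
    then obtain t \<mu> where \<nu>: "\<nu> = scale_measure (ennreal t) \<mu>" "\<mu> \<in> S" "1 \<le> t" by auto
    then have "\<mu> \<in> W 1" by (auto simp: S_def W_def sp_\<Lambda> polar_sphere_def)
    then have "\<nu> \<in> W (ennreal t * 1)" unfolding \<nu>(1) using \<nu>(3) by (intro scale_in) auto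
    moreover have "1 \<le> ennreal t" using \<nu>(3) by simp
    moreover have "1 \<le> x" if "1 \<le> ennreal t" "ennreal t \<le> x" for x
      using that by (rule order_trans)
    ultimately show "\<nu> \<in> W 1" by (simp add: W_def)
  next
    fix \<nu> assume \<nu>: "\<nu> \<in> W 1"
    then have rad: "\<nu> \<in> space radon_space" "\<nu> \<noteq> null_measure borel" by (auto simp: W_def sp_\<Lambda>)
    define t where "t = enn2real (emeasure \<nu> (B (polar_index B \<nu>)))"
    have t: "emeasure \<nu> (B (polar_index B \<nu>)) = ennreal t"
      using polar_index_pos(2)[OF B rad] by (simp add: t_def)
    have "1 \<le> t" using \<nu> by (auto simp: W_def t)
    let ?\<mu> = "scale_measure (ennreal (1 / t)) \<nu>"
    have pos: "0 < 1 / t" using \<open>1 \<le> t\<close> by simp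
    have "ennreal (1 / t) * ennreal t = 1" using \<open>1 \<le> t\<close> by (simp add: ennreal_mult[symmetric])
    then have "?\<mu> \<in> S"
      using scale_measure_radon[OF pos rad] \<nu> pos \<open>1 \<le> t\<close>
      by (simp add: S_def polar_sphere_def polar_index_scale t W_def ennreal_mult_top)
    moreover have "\<nu> = scale_measure (ennreal t) ?\<mu>"
      using \<open>1 \<le> t\<close> by (simp only: scale_measure_cancel)
    ultimately show "\<nu> \<in> {scale_measure (ennreal t) \<mu> | t \<mu>. \<mu> \<in> S \<and> 1 \<le> t}"
      using \<open>1 \<le> t\<close> by blast
  qed
  have S_sets: "S \<in> sets (restrict_space radon_space (polar_sphere B))"
  proof -
    have "{\<mu>\<in>space radon_space. emeasure \<mu> UNIV = \<infinity>} \<in> sets (radon_space :: 'a measure measure)"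
      by measurable
    moreover have "S = polar_sphere B \<inter> {\<mu>\<in>space radon_space. emeasure \<mu> UNIV = \<infinity>}"
      by (auto simp: S_def polar_sphere_def)
    ultimately show ?thesis by (auto simp: sets_restrict_space)
  qed
  have "emeasure \<sigma> S = ennreal (Gamma (1 - \<alpha>)) * emeasure \<Lambda> (W 1)"
    using polar S_sets cone by (simp add: polar_part_def)
  \<comment> \<open>Positivity of the Gamma factor, from \<open>\<alpha> < 1\<close>, lets null sets
    correspond.\<close>
  moreover have "0 < Gamma (1 - \<alpha>)" by (rule Gamma_real_pos) (use \<alpha> in simp)
  ultimately have \<sigma>_iff: "emeasure \<sigma> S = 0 \<longleftrightarrow> emeasure \<Lambda> (W 1) = 0"
    by (simp add: ennreal_eq_0_iff)
  have supp_\<sigma>: "supported_by \<sigma> prob_measures \<longleftrightarrow> emeasure \<sigma> S = 0"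
    using S_sets unfolding supported_by_def sp_\<sigma> polar_sphere_Diff_prob_measures[OF B] S_def[symmetric]
    by (auto simp: null_sets_def \<sigma>)
  define I where "I = {\<mu>\<in>space \<Lambda>. emeasure \<mu> UNIV = \<infinity>}"
  have I [measurable]: "I \<in> sets \<Lambda>" unfolding I_def by measurable
  have "space \<Lambda> - {\<mu>. emeasure \<mu> UNIV < \<infinity>} = I"
    by (auto simp: I_def not_less top_unique)
  then have supp_\<Lambda>: "supported_by \<Lambda> {\<mu>. emeasure \<mu> UNIV < \<infinity>} \<longleftrightarrow> emeasure \<Lambda> I = 0"
    using I by (auto simp: supported_by_def null_sets_def)
  have "emeasure \<Lambda> I = 0 \<longleftrightarrow> emeasure \<Lambda> (W 1) = 0"
  proof
    assume "emeasure \<Lambda> I = 0"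
    moreover have "emeasure \<Lambda> (W 1) \<le> emeasure \<Lambda> I"
      by (rule emeasure_mono) (auto simp: W_def I_def)
    ultimately show "emeasure \<Lambda> (W 1) = 0" by simp
  next
    assume 0: "emeasure \<Lambda> (W 1) = 0"
    have "emeasure \<Lambda> (W (ennreal (1 / real (Suc n)))) = 0" for n
      using scaling[of "1 / real (Suc n)" "W 1"] image[of "1 / real (Suc n)"] 0 by simp
    then have "emeasure \<Lambda> (\<Union>n. W (ennreal (1 / real (Suc n)))) = 0"
      by (intro emeasure_UN_eq_0) auto
    moreover have "I \<subseteq> (\<Union>n. W (ennreal (1 / real (Suc n))))"
    proof
      fix \<mu> assume \<mu>: "\<mu> \<in> I"
      then have rad: "\<mu> \<in> space radon_space" "\<mu> \<noteq> null_measure borel" by (auto simp: I_def sp_\<Lambda>)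
      define t where "t = enn2real (emeasure \<mu> (B (polar_index B \<mu>)))"
      have t: "emeasure \<mu> (B (polar_index B \<mu>)) = ennreal t" "0 < t"
        using polar_index_pos[OF B rad] by (auto simp: t_def enn2real_positive_iff)
      obtain n where "inverse (real (Suc n)) < t" using reals_Archimedean[OF t(2)] by auto
      then have "ennreal (1 / real (Suc n)) \<le> emeasure \<mu> (B (polar_index B \<mu>))"
        unfolding t(1) by (intro ennreal_leI) (simp add: inverse_eq_divide)
      then show "\<mu> \<in> (\<Union>n. W (ennreal (1 / real (Suc n))))" using \<mu> by (auto simp: W_def I_def)
    qed
    then have "emeasure \<Lambda> I \<le> emeasure \<Lambda> (\<Union>n. W (ennreal (1 / real (Suc n))))"
      by (rule emeasure_mono) measurable
    ultimately show "emeasure \<Lambda> I = 0" by simp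
  qed
  then show ?thesis using supp_\<sigma> supp_\<Lambda> \<sigma>_iff by simp
qed

section \<open>The cluster representation\<close>

lemma is_sibuya_Sib:
  fixes B :: "nat \<Rightarrow> 'a::{second_countable_topology, t2_space} set" and \<mu> :: "'a measure"
  assumes "rel_compact_base B" "0 < \<alpha>" "\<alpha> \<le> 1" "\<mu> \<in> prob_measures"
  shows "is_sibuya \<alpha> \<mu> (Sib \<alpha> \<mu>)"
  using is_sibuya_sibuya_kernel[OF assms(2,3,4)] Sib_eq_sibuya_kernel[OF assms] by simp

section \<open>The spectral measure carried by probability measures\<close>

context
  fixes B :: "nat \<Rightarrow> 'a::{second_countable_topology, t2_space} set"
    and \<alpha> :: real and L \<sigma> :: "'a measure measure"
  assumes B: "rel_compact_base B" and \<alpha>: "0 < \<alpha>" "\<alpha> \<le> 1"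
    and L: "L \<in> space (prob_algebra counting_space)"
    and spectral: "spectral_measure B \<alpha> L \<sigma>" and supported: "supported_by \<sigma> prob_measures"
begin

abbreviation (input) "prob_part \<equiv> restrict_space \<sigma> prob_measures"

lemma sets_spectral: "sets \<sigma> = sets (restrict_space radon_space (polar_sphere B))"
  using spectral by (simp add: spectral_measure_def)

lemma space_spectral: "space \<sigma> = polar_sphere B"
  using sets_eq_imp_space_eq[OF sets_spectral] by (auto simp: space_restrict_space polar_sphere_def)

text \<open>Null sets are measurable, so the support hypothesis already contains this
  measurability.\<close>

lemma prob_measures_in_sets: "prob_measures \<inter> space \<sigma> \<in> sets \<sigma>"
proof -
  have "space \<sigma> - (space \<sigma> - prob_measures) \<in> sets \<sigma>"
    by (rule sets.compl_sets) (use supported in \<open>simp add: supported_by_def null_setsD2\<close>)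
  moreover have "space \<sigma> - (space \<sigma> - prob_measures) = prob_measures \<inter> space \<sigma>" by auto
  ultimately show ?thesis by simp
qed

lemma AE_prob_measures: "AE \<mu> in \<sigma>. \<mu> \<in> prob_measures"
  using supported by (intro AE_I') (auto simp: supported_by_def)

lemma space_prob_part: "space prob_part = prob_measures"
  using prob_measures_subset_polar_sphere[OF B] by (auto simp: space_restrict_space space_spectral)

lemma prob_partD:
  assumes "\<mu> \<in> space prob_part"
  shows "sets \<mu> = sets borel" "prob_space \<mu>"
  using assms unfolding space_prob_part by (simp_all add: space_prob_algebra)

lemma nn_integral_prob_part: "(\<integral>\<^sup>+\<mu>. f \<mu> \<partial>prob_part) = (\<integral>\<^sup>+\<mu>. f \<mu> \<partial>\<sigma>)"
proof -
  have "(\<integral>\<^sup>+\<mu>. f \<mu> \<partial>prob_part) = (\<integral>\<^sup>+\<mu>. f \<mu> * indicator prob_measures \<mu> \<partial>\<sigma>)"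
    by (rule nn_integral_restrict_space[OF prob_measures_in_sets])
  also have "\<dots> = (\<integral>\<^sup>+\<mu>. f \<mu> \<partial>\<sigma>)"
    using AE_prob_measures by (intro nn_integral_cong_AE) auto
  finally show ?thesis .
qed

lemma measurable_emeasure_spectral: "A \<in> sets borel \<Longrightarrow> (\<lambda>\<mu>. emeasure \<mu> A) \<in> borel_measurable \<sigma>"
  unfolding measurable_cong_sets[OF sets_spectral refl]
  by (intro measurable_restrict_space1 measurable_emeasure_radon_space)

text \<open>Bridges two evaluation sigma-algebras: \<open>\<sigma>\<close> inherits that of
  \<open>radon_space\<close>, while the Sibuya kernel is measurable on
  \<open>prob_algebra borel\<close>.\<close>

lemma measurable_id_prob_part: "(\<lambda>\<mu>. \<mu>) \<in> prob_part \<rightarrow>\<^sub>M prob_algebra borel"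
proof (rule measurable_prob_algebraI)
  show "(\<lambda>\<mu>. \<mu>) \<in> prob_part \<rightarrow>\<^sub>M subprob_algebra borel"
    by (rule measurable_subprob_algebra)
       (auto simp: prob_partD intro: prob_space_imp_subprob_space measurable_restrict_space1 measurable_emeasure_spectral)
qed (rule prob_partD)

lemma measurable_Sib: "Sib \<alpha> \<in> prob_part \<rightarrow>\<^sub>M prob_algebra counting_space"
proof -
  have "(\<lambda>\<mu>. sibuya_kernel \<alpha> \<mu>) \<in> prob_part \<rightarrow>\<^sub>M prob_algebra counting_space"
    by (rule measurable_compose[OF measurable_id_prob_part measurable_sibuya_kernel])
  moreover have "Sib \<alpha> \<mu> = sibuya_kernel \<alpha> \<mu>" if "\<mu> \<in> space prob_part" for \<mu>
    using that by (intro Sib_eq_sibuya_kernel[OF B \<alpha>]) (simp add: space_prob_part)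
  ultimately show ?thesis by (simp cong: measurable_cong)
qed

lemma spectral_integral_finite:
  "A \<in> sets borel \<Longrightarrow> rel_compact A \<Longrightarrow> (\<integral>\<^sup>+\<mu>. ennreal (measure \<mu> A powr \<alpha>) \<partial>prob_part) < \<infinity>"
  using spectral by (simp add: nn_integral_prob_part spectral_measure_def)

text \<open>\<open>1 - u\<close> is dominated by the indicator of its closed support
  \<open>K\<close>, so the moment condition at \<open>K\<close> bounds the integral.\<close>

lemma spectral_test_function:
  fixes u :: "'a \<Rightarrow> real"
  assumes u: "u \<in> test_functions"
  defines "g \<equiv> \<lambda>\<mu>. (\<integral>x. 1 - u x \<partial>\<mu>) powr \<alpha>"
  shows "g \<in> borel_measurable \<sigma>" "(\<integral>\<^sup>+\<mu>. ennreal (g \<mu>) \<partial>prob_part) < \<infinity>"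
proof -
  note [measurable] = test_functionsD(1)[OF u]
  define K where "K = closure {x. u x \<noteq> 1}"
  have K [measurable]: "K \<in> sets borel" and K_compact: "rel_compact K" and u1: "\<And>x. x \<notin> K \<Longrightarrow> u x = 1"
    using test_functionsD(4,5,6)[OF u] by (auto simp only: K_def)
  have rad: "\<mu> \<in> space radon_space" if "\<mu> \<in> space \<sigma>" for \<mu>
    using that by (auto simp: space_spectral polar_sphere_def)
  have g_eq: "g \<mu> = enn2real (\<integral>\<^sup>+x. ennreal (1 - u x) \<partial>\<mu>) powr \<alpha>" if "\<mu> \<in> space \<sigma>" for \<mu>
  proof -
    have "sets \<mu> = sets borel" using rad[OF that] by (rule sets_radon_space)
    then have "(\<lambda>x. 1 - u x) \<in> borel_measurable \<mu>"
      by (subst measurable_cong_sets[OF _ refl]) measurable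
    then show ?thesis
      unfolding g_def using test_functionsD(3)[OF u] by (subst integral_eq_nn_integral) auto
  qed
  have "(\<lambda>\<mu>. \<integral>\<^sup>+x. ennreal (1 - u x) \<partial>\<mu>) \<in> borel_measurable \<sigma>"
    by (rule measurable_nn_integral_kernel[where N=borel])
       (use rad measurable_emeasure_spectral in \<open>auto simp: sets_radon_space\<close>)
  then have "(\<lambda>\<mu>. enn2real (\<integral>\<^sup>+x. ennreal (1 - u x) \<partial>\<mu>) powr \<alpha>) \<in> borel_measurable \<sigma>"
    by measurable
  then show "g \<in> borel_measurable \<sigma>" by (simp add: g_eq cong: measurable_cong)
  have "g \<mu> \<le> measure \<mu> K powr \<alpha>" if \<mu>: "\<mu> \<in> space \<sigma>" for \<mu>
  proof -
    have "sets \<mu> = sets borel" using rad[OF that] by (rule sets_radon_space)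
    have "(\<integral>\<^sup>+x. ennreal (1 - u x) \<partial>\<mu>) \<le> (\<integral>\<^sup>+x. indicator K x \<partial>\<mu>)"
      using test_functionsD(2)[OF u] u1
      by (intro nn_integral_mono) (auto split: split_indicator simp: less_imp_le)
    also have "\<dots> = emeasure \<mu> K" using \<open>sets \<mu> = sets borel\<close> by simp
    finally have "enn2real (\<integral>\<^sup>+x. ennreal (1 - u x) \<partial>\<mu>) \<le> measure \<mu> K"
      unfolding measure_def using rad[OF \<mu>] K_compact by (intro enn2real_mono) (auto simp: space_radon_space)
    then show ?thesis unfolding g_eq[OF \<mu>] using \<alpha> by (intro powr_mono2) auto
  qed
  then have "(\<integral>\<^sup>+\<mu>. ennreal (g \<mu>) \<partial>prob_part) \<le> (\<integral>\<^sup>+\<mu>. ennreal (measure \<mu> K powr \<alpha>) \<partial>prob_part)"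
    unfolding nn_integral_prob_part by (intro nn_integral_mono ennreal_leI)
  also have "\<dots> < \<infinity>" by (rule spectral_integral_finite[OF K K_compact])
  finally show "(\<integral>\<^sup>+\<mu>. ennreal (g \<mu>) \<partial>prob_part) < \<infinity>" .
qed

text \<open>Finiteness from \<open>spectral_test_function\<close> excludes the default value 0 of a
  divergent Bochner integral, so both formulas can be expressed by the same nonnegative
  integral.\<close>

lemma pgfl_eq_exp_neg_spectral:
  assumes u: "u \<in> test_functions"
  shows "pgfl L u = exp_neg (\<integral>\<^sup>+\<mu>. ennreal ((\<integral>x. 1 - u x \<partial>\<mu>) powr \<alpha>) \<partial>prob_part)"
    and "exp (\<integral>\<mu>. (pgfl (Sib \<alpha> \<mu>) u - 1) \<partial>prob_part) = exp_neg (\<integral>\<^sup>+\<mu>. ennreal ((\<integral>x. 1 - u x \<partial>\<mu>) powr \<alpha>) \<partial>prob_part)"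
proof -
  let ?g = "\<lambda>\<mu>. (\<integral>x. 1 - u x \<partial>\<mu>) powr \<alpha>"
  note g = spectral_test_function[OF u]
  have eq: "exp (- (\<integral>\<mu>. ?g \<mu> \<partial>M)) = exp_neg (\<integral>\<^sup>+\<mu>. ennreal (?g \<mu>) \<partial>prob_part)"
    if "?g \<in> borel_measurable M" "(\<integral>\<^sup>+\<mu>. ennreal (?g \<mu>) \<partial>M) = (\<integral>\<^sup>+\<mu>. ennreal (?g \<mu>) \<partial>prob_part)" for M
    using g(2) that by (simp add: integral_eq_nn_integral exp_neg_def)
  show "pgfl L u = exp_neg (\<integral>\<^sup>+\<mu>. ennreal (?g \<mu>) \<partial>prob_part)"
    using spectral u eq[OF g(1)] by (simp add: spectral_measure_def nn_integral_prob_part)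
  have "(\<integral>\<mu>. (pgfl (Sib \<alpha> \<mu>) u - 1) \<partial>prob_part) = (\<integral>\<mu>. - ?g \<mu> \<partial>prob_part)"
    using is_sibuya_Sib[OF B \<alpha>] u
    by (intro Bochner_Integration.integral_cong refl) (auto simp: space_prob_part is_sibuya_def)
  then show "exp (\<integral>\<mu>. (pgfl (Sib \<alpha> \<mu>) u - 1) \<partial>prob_part) = exp_neg (\<integral>\<^sup>+\<mu>. ennreal (?g \<mu>) \<partial>prob_part)"
    using eq[OF measurable_restrict_space1[OF g(1)]] by simp
qed

lemma measurable_measure_powr_prob_part:
  assumes "A \<in> sets borel"
  shows "(\<lambda>\<mu>. measure \<mu> A powr \<alpha>) \<in> borel_measurable prob_part"
proof -
  have "(\<lambda>\<mu>. emeasure \<mu> A) \<in> borel_measurable prob_part"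
    by (intro measurable_restrict_space1 measurable_emeasure_spectral assms)
  then show ?thesis unfolding measure_def by measurable
qed

lemma sigma_finite_prob_part: "sigma_finite_measure prob_part"
proof -
  \<comment> \<open>Level sets of the moments. \<open>Suc i\<close> skips \<open>B 0\<close>, the
    whole space, whose moment may be infinite.\<close>
  define C where "C = (\<lambda>(i, n). {\<mu>\<in>space prob_part. inverse (real (Suc n)) \<le> measure \<mu> (B (Suc i)) powr \<alpha>})"
  have C_sets: "C p \<in> sets prob_part" for p
  proof -
    note [measurable] = measurable_measure_powr_prob_part[OF rel_compact_baseD(2)[OF B]]
    show ?thesis unfolding C_def by (cases p) simp
  qed
  show ?thesis
  proof (rule sigma_finite_measure.intro, intro exI conjI ballI)
    show "countable (range C)" by simp
    show "range C \<subseteq> sets prob_part" using C_sets by auto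
    show "\<Union> (range C) = space prob_part"
    proof
      show "\<Union> (range C) \<subseteq> space prob_part" by (auto simp: C_def)
      show "space prob_part \<subseteq> \<Union> (range C)"
      proof
        fix \<mu> assume \<mu>: "\<mu> \<in> space prob_part"
        then have p: "\<mu> \<in> prob_measures" by (simp add: space_prob_part)
        then have "\<mu> \<in> space radon_space" "\<mu> \<noteq> null_measure borel"
          using prob_measures_subset_polar_sphere[OF B] by (auto simp: polar_sphere_def)
        from exists_base_emeasure_pos[OF B this] obtain i where "1 \<le> i" "0 < emeasure \<mu> (B i)" "emeasure \<mu> (B i) < \<infinity>"
          by auto
        then obtain j where "0 < measure \<mu> (B (Suc j))"
          by (cases i) (auto simp: measure_def enn2real_positive_iff)
        then have "0 < measure \<mu> (B (Suc j)) powr \<alpha>" by simp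
        then obtain n where "inverse (real (Suc n)) < measure \<mu> (B (Suc j)) powr \<alpha>"
          using reals_Archimedean by blast
        then have "\<mu> \<in> C (j, n)" using \<mu> by (simp add: C_def)
        then show "\<mu> \<in> \<Union> (range C)" by blast
      qed
    qed
    fix a assume "a \<in> range C"
    then obtain i n where a: "a = C (i, n)" by auto
    \<comment> \<open>Markov's inequality bounds the mass of a level set by a finite moment.\<close>
    have "ennreal (inverse (real (Suc n))) * emeasure prob_part a
        = (\<integral>\<^sup>+\<mu>. ennreal (inverse (real (Suc n))) * indicator a \<mu> \<partial>prob_part)"
      using C_sets by (simp add: a nn_integral_cmult_indicator)
    also have "\<dots> \<le> (\<integral>\<^sup>+\<mu>. ennreal (measure \<mu> (B (Suc i)) powr \<alpha>) \<partial>prob_part)"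
      by (intro nn_integral_mono) (auto simp: a C_def split: split_indicator intro!: ennreal_leI)
    also have "\<dots> < \<infinity>"
      by (rule spectral_integral_finite) (use rel_compact_baseD[OF B] in auto)
    finally show "emeasure prob_part a \<noteq> \<infinity>"
      by (auto simp: ennreal_mult_top)
  qed
qed

section \<open>The Poisson cluster process with Sibuya daughters\<close>

lemma exists_cluster_process:
  "\<exists>(P :: (nat \<Rightarrow> nat \<times> 'a measure \<times> 'a measure) measure) Nc N.
     prob_space P \<and> poisson_process P prob_part Nc \<and> cluster_process P prob_part Nc (Sib \<alpha>) N \<and> distr P counting_space N = L"
proof -
  \<comment> \<open>The marked construction asks for a nonempty space of centres, even if the
    intensity vanishes; a Dirac measure is a witness.\<close>
  have "return borel undefined \<in> prob_measures"
    by (simp add: space_prob_algebra prob_space_return)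
  then have ne: "space prob_part \<noteq> {}" unfolding space_prob_part by auto
  obtain P :: "(nat \<Rightarrow> nat \<times> 'a measure \<times> 'a measure) measure"
    and J :: "(nat \<Rightarrow> nat \<times> 'a measure \<times> 'a measure) \<Rightarrow> nat set" and c d where
    P: "prob_space P"
    and J: "\<And>i. {\<omega>\<in>space P. i \<in> J \<omega>} \<in> sets P"
    and c: "\<And>i. c i \<in> P \<rightarrow>\<^sub>M prob_part" and d: "\<And>i. d i \<in> P \<rightarrow>\<^sub>M counting_space"
    and meas: "\<And>h. (\<And>i. h i \<in> borel_measurable P) \<Longrightarrow>
      (\<lambda>\<omega>. \<integral>\<^sup>+i. h i \<omega> \<partial>count_space (J \<omega>)) \<in> borel_measurable P"
    and laplace: "\<And>h. h \<in> borel_measurable (prob_part \<Otimes>\<^sub>M counting_space) \<Longrightarrow>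
      (\<integral>\<^sup>+\<omega>. ennreal (exp_neg (\<integral>\<^sup>+i. h (c i \<omega>, d i \<omega>) \<partial>count_space (J \<omega>))) \<partial>P)
      = ennreal (exp_neg (\<integral>\<^sup>+\<mu>. (\<integral>\<^sup>+\<nu>. ennreal (1 - exp_neg (h (\<mu>, \<nu>))) \<partial>Sib \<alpha> \<mu>) \<partial>prob_part))"
    and independent: "\<And>C n E. C \<in> sets (PiM UNIV (\<lambda>_. count_space UNIV \<Otimes>\<^sub>M prob_part)) \<Longrightarrow> E ` {..<n} \<subseteq> sets counting_space \<Longrightarrow>
      emeasure P {\<omega>\<in>space P. (\<lambda>i. (i \<in> J \<omega>, c i \<omega>)) \<in> C \<and> (\<forall>i<n. d i \<omega> \<in> E i)}
      = (\<integral>\<^sup>+\<omega>. indicator C (\<lambda>i. (i \<in> J \<omega>, c i \<omega>)) * (\<Prod>i<n. emeasure (Sib \<alpha> (c i \<omega>)) (E i)) \<partial>P)"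
    by (rule exists_marked_poisson_process[OF sigma_finite_prob_part ne measurable_Sib]) blast
  interpret P: prob_space P by (rule P)
  define Nc where "Nc \<omega> = dirac_sum prob_part (J \<omega>) (\<lambda>i. c i \<omega>)" for \<omega>
  define S where "S \<omega> = superposition borel (J \<omega>) (\<lambda>i. d i \<omega>)" for \<omega>
  \<comment> \<open>The superposition is locally finite only almost surely; on the exceptional event
    the zero measure keeps \<open>N \<omega>\<close> inside \<open>counting_space\<close>.\<close>
  define N where "N \<omega> = (if S \<omega> \<in> space radon_space then S \<omega> else null_measure borel)" for \<omega>
  have d_in: "d i \<omega> \<in> space counting_space" if "\<omega> \<in> space P" for i \<omega>
    by (rule measurable_space[OF d that])
  have sets_d: "sets (d i \<omega>) = sets borel" if "\<omega> \<in> space P" for i \<omega>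
    by (rule sets_counting_space[OF d_in[OF that]])
  \<comment> \<open>For the centres alone the test function ignores the daughter, and the
    probability measure \<open>Sib \<alpha> \<mu>\<close> integrates to 1.\<close>
  have poisson: "poisson_process P prob_part Nc"
  proof (rule poisson_processI[OF P])
    show "sets (Nc \<omega>) = sets prob_part" for \<omega> by (simp add: Nc_def)
    show "emeasure (Nc \<omega>) A \<in> range of_nat \<union> {\<top>}" if "A \<in> sets prob_part" for \<omega> A
      unfolding Nc_def by (rule emeasure_dirac_sum_range[OF that])
    show "(\<lambda>\<omega>. emeasure (Nc \<omega>) A) \<in> borel_measurable P" if A: "A \<in> sets prob_part" for A
      unfolding Nc_def emeasure_dirac_sum[OF A]
      by (intro meas measurable_compose[OF c borel_measurable_indicator[OF A]])
    fix h :: "'a measure \<Rightarrow> ennreal" assume h: "h \<in> borel_measurable prob_part"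
    have "(\<integral>\<^sup>+\<omega>. ennreal (exp_neg (\<integral>\<^sup>+y. h y \<partial>Nc \<omega>)) \<partial>P)
        = (\<integral>\<^sup>+\<omega>. ennreal (exp_neg (\<integral>\<^sup>+i. h (fst (c i \<omega>, d i \<omega>)) \<partial>count_space (J \<omega>))) \<partial>P)"
      unfolding Nc_def using measurable_space[OF c]
      by (intro nn_integral_cong) (simp add: nn_integral_dirac_sum[OF h])
    also have "\<dots> = ennreal (exp_neg (\<integral>\<^sup>+\<mu>. (\<integral>\<^sup>+\<nu>. ennreal (1 - exp_neg (h (fst (\<mu>, \<nu>)))) \<partial>Sib \<alpha> \<mu>) \<partial>prob_part))"
      by (rule laplace[OF measurable_compose[OF measurable_fst h]])
    also have "(\<integral>\<^sup>+\<mu>. (\<integral>\<^sup>+\<nu>. ennreal (1 - exp_neg (h (fst (\<mu>, \<nu>)))) \<partial>Sib \<alpha> \<mu>) \<partial>prob_part)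
        = (\<integral>\<^sup>+\<mu>. ennreal (1 - exp_neg (h \<mu>)) \<partial>prob_part)"
      using measurable_space[OF measurable_Sib]
      by (intro nn_integral_cong) (auto simp: space_prob_algebra prob_space.emeasure_space_1)
    finally show "(\<integral>\<^sup>+\<omega>. ennreal (exp_neg (\<integral>\<^sup>+y. h y \<partial>Nc \<omega>)) \<partial>P)
        = ennreal (exp_neg (\<integral>\<^sup>+y. ennreal (1 - exp_neg (h y)) \<partial>prob_part))" .
  qed
  \<comment> \<open>For the superposition the test function ignores the centre, and one minus the
    daughter functional is the power with exponent \<open>\<alpha>\<close>.\<close>
  have laplace_S: "(\<integral>\<^sup>+\<omega>. ennreal (exp_neg (\<integral>\<^sup>+x. h x \<partial>S \<omega>)) \<partial>P)
      = ennreal (exp_neg (\<integral>\<^sup>+\<mu>. ennreal ((\<integral>x. 1 - exp_neg (h x) \<partial>\<mu>) powr \<alpha>) \<partial>prob_part))"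
    if h: "h \<in> borel_measurable borel" for h
  proof -
    have m: "(\<lambda>\<nu>. \<integral>\<^sup>+x. h x \<partial>\<nu>) \<in> borel_measurable counting_space"
      by (rule measurable_nn_integral_counting_space[OF h])
    have "(\<integral>\<^sup>+\<omega>. ennreal (exp_neg (\<integral>\<^sup>+x. h x \<partial>S \<omega>)) \<partial>P)
        = (\<integral>\<^sup>+\<omega>. ennreal (exp_neg (\<integral>\<^sup>+i. (\<integral>\<^sup>+x. h x \<partial>snd (c i \<omega>, d i \<omega>)) \<partial>count_space (J \<omega>))) \<partial>P)"
      unfolding S_def by (intro nn_integral_cong) (simp add: nn_integral_superposition sets_d h)
    also have "\<dots> = ennreal (exp_neg (\<integral>\<^sup>+\<mu>. (\<integral>\<^sup>+\<nu>. ennreal (1 - exp_neg (\<integral>\<^sup>+x. h x \<partial>snd (\<mu>, \<nu>))) \<partial>Sib \<alpha> \<mu>) \<partial>prob_part))"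
      by (rule laplace[OF measurable_compose[OF measurable_snd m]])
    also have "(\<integral>\<^sup>+\<mu>. (\<integral>\<^sup>+\<nu>. ennreal (1 - exp_neg (\<integral>\<^sup>+x. h x \<partial>snd (\<mu>, \<nu>))) \<partial>Sib \<alpha> \<mu>) \<partial>prob_part)
        = (\<integral>\<^sup>+\<mu>. ennreal ((\<integral>x. 1 - exp_neg (h x) \<partial>\<mu>) powr \<alpha>) \<partial>prob_part)"
    proof (rule nn_integral_cong)
      fix \<mu> assume \<mu>: "\<mu> \<in> space prob_part"
      then have p: "\<mu> \<in> prob_measures" by (simp add: space_prob_part)
      note k = nn_integral_exp_neg_sibuya_kernel[OF \<alpha> p h]
      have Sib: "Sib \<alpha> \<mu> = sibuya_kernel \<alpha> \<mu>" by (rule Sib_eq_sibuya_kernel[OF B \<alpha> p])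
      have sk: "sets (Sib \<alpha> \<mu>) = sets counting_space" "prob_space (Sib \<alpha> \<mu>)"
        using measurable_space[OF measurable_Sib \<mu>] by (auto simp: space_prob_algebra)
      interpret K: prob_space "Sib \<alpha> \<mu>" by (rule sk)
      have mk [measurable]: "(\<lambda>\<nu>. \<integral>\<^sup>+x. h x \<partial>\<nu>) \<in> borel_measurable (Sib \<alpha> \<mu>)"
        using m unfolding measurable_cong_sets[OF sk(1) refl] .
      have "(\<integral>\<^sup>+\<nu>. ennreal (1 - exp_neg (\<integral>\<^sup>+x. h x \<partial>\<nu>)) \<partial>Sib \<alpha> \<mu>)
          = (\<integral>\<^sup>+\<nu>. 1 - ennreal (exp_neg (\<integral>\<^sup>+x. h x \<partial>\<nu>)) \<partial>Sib \<alpha> \<mu>)"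
        by (intro nn_integral_cong) (simp add: ennreal_minus[symmetric])
      also have "\<dots> = (\<integral>\<^sup>+\<nu>. 1 \<partial>Sib \<alpha> \<mu>) - (\<integral>\<^sup>+\<nu>. ennreal (exp_neg (\<integral>\<^sup>+x. h x \<partial>\<nu>)) \<partial>Sib \<alpha> \<mu>)"
      proof (rule nn_integral_diff)
        have "(\<integral>\<^sup>+\<nu>. ennreal (exp_neg (\<integral>\<^sup>+x. h x \<partial>\<nu>)) \<partial>Sib \<alpha> \<mu>) \<le> (\<integral>\<^sup>+\<nu>. 1 \<partial>Sib \<alpha> \<mu>)"
          by (intro nn_integral_mono) simp
        then show "(\<integral>\<^sup>+\<nu>. ennreal (exp_neg (\<integral>\<^sup>+x. h x \<partial>\<nu>)) \<partial>Sib \<alpha> \<mu>) \<noteq> \<infinity>"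
          by (auto simp: K.emeasure_space_1 top_unique)
      qed auto
      also have "\<dots> = 1 - ennreal (1 - (\<integral>x. 1 - exp_neg (h x) \<partial>\<mu>) powr \<alpha>)"
        using k(1) by (simp add: Sib[symmetric] K.emeasure_space_1)
      also have "\<dots> = ennreal ((\<integral>x. 1 - exp_neg (h x) \<partial>\<mu>) powr \<alpha>)"
        using k(2,3) \<alpha> by (simp add: ennreal_1[symmetric] ennreal_minus powr_le1 del: ennreal_1)
      finally show "(\<integral>\<^sup>+\<nu>. ennreal (1 - exp_neg (\<integral>\<^sup>+x. h x \<partial>snd (\<mu>, \<nu>))) \<partial>Sib \<alpha> \<mu>)
          = ennreal ((\<integral>x. 1 - exp_neg (h x) \<partial>\<mu>) powr \<alpha>)" by simp
    qed
    finally show ?thesis .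
  qed
  have S_meas: "(\<lambda>\<omega>. emeasure (S \<omega>) A) \<in> borel_measurable P" if A: "A \<in> sets borel" for A
  proof -
    have "(\<lambda>\<omega>. \<integral>\<^sup>+i. emeasure (d i \<omega>) A \<partial>count_space (J \<omega>)) \<in> borel_measurable P"
      by (intro meas measurable_compose[OF d measurable_emeasure_counting_space[OF A]])
    moreover have "emeasure (S \<omega>) A = (\<integral>\<^sup>+i. emeasure (d i \<omega>) A \<partial>count_space (J \<omega>))" if "\<omega> \<in> space P" for \<omega>
      unfolding S_def using sets_d[OF that] A by (intro emeasure_superposition) auto
    ultimately show ?thesis by (simp cong: measurable_cong)
  qed
  have finite_B: "AE \<omega> in P. emeasure (S \<omega>) (B i) < \<top>" if i: "1 \<le> i" for i
  proof -
    have Bi: "B i \<in> sets borel" "rel_compact (B i)"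
      using rel_compact_baseD(2,4)[OF B] i by auto
    note [measurable] = S_meas[OF Bi(1)]
    have "(\<integral>\<^sup>+\<mu>. ennreal (measure \<mu> (B i) powr \<alpha>) \<partial>prob_part) < \<infinity>"
      by (rule spectral_integral_finite[OF Bi])
    then obtain m where m: "(\<integral>\<^sup>+\<mu>. ennreal (measure \<mu> (B i) powr \<alpha>) \<partial>prob_part) = ennreal m" "0 \<le> m"
      by (cases "\<integral>\<^sup>+\<mu>. ennreal (measure \<mu> (B i) powr \<alpha>) \<partial>prob_part") auto
    let ?A = "{\<omega>\<in>space P. emeasure (S \<omega>) (B i) < \<top>}"
    \<comment> \<open>For \<open>h\<close> equal to \<open>r\<close> times the indicator of
      \<open>B i\<close>, \<open>1 - exp_neg h\<close> is \<open>1 - exp (- r)\<close> times that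
      indicator. The functional of \<open>S \<omega>\<close> at \<open>h\<close> vanishes on
      infinite counts, so its mean is a lower bound for the probability of a finite one.\<close>
    have le: "exp (- ((1 - exp (- r)) powr \<alpha> * m)) \<le> P.prob ?A" if r: "0 < r" for r
    proof -
      have pos: "0 \<le> 1 - exp (- r)" using r by simp
      have "(\<integral>x. 1 - exp_neg (ennreal r * indicator (B i) x) \<partial>\<mu>) = (1 - exp (- r)) * measure \<mu> (B i)"
        if "\<mu> \<in> space prob_part" for \<mu>
      proof -
        have "sets \<mu> = sets borel" by (rule prob_partD[OF that])
        moreover have "1 - exp_neg (ennreal r * indicator (B i) x) = (1 - exp (- r)) * indicator (B i) x" for x
          using r by (auto simp: exp_neg_ennreal split: split_indicator)
        ultimately show ?thesis
          using Bi(1) sets_eq_imp_space_eq[of \<mu> borel] by simp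
      qed
      then have "(\<integral>\<^sup>+\<mu>. ennreal ((\<integral>x. 1 - exp_neg (ennreal r * indicator (B i) x) \<partial>\<mu>) powr \<alpha>) \<partial>prob_part)
          = (\<integral>\<^sup>+\<mu>. ennreal ((1 - exp (- r)) powr \<alpha>) * ennreal (measure \<mu> (B i) powr \<alpha>) \<partial>prob_part)"
        using pos by (intro nn_integral_cong) (simp add: powr_mult ennreal_mult)
      also have "\<dots> = ennreal ((1 - exp (- r)) powr \<alpha>) * ennreal m"
        unfolding m(1)[symmetric]
        by (intro nn_integral_cmult measurable_compose[OF measurable_measure_powr_prob_part[OF Bi(1)] measurable_ennreal])
      also have "\<dots> = ennreal ((1 - exp (- r)) powr \<alpha> * m)"
        using m by (simp add: ennreal_mult)
      finally have "ennreal (exp (- ((1 - exp (- r)) powr \<alpha> * m)))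
          = (\<integral>\<^sup>+\<omega>. ennreal (exp_neg (\<integral>\<^sup>+x. ennreal r * indicator (B i) x \<partial>S \<omega>)) \<partial>P)"
        using m Bi(1) by (subst laplace_S) (auto simp: exp_neg_ennreal)
      also have "\<dots> = (\<integral>\<^sup>+\<omega>. ennreal (exp_neg (ennreal r * emeasure (S \<omega>) (B i))) \<partial>P)"
        using Bi(1) by (intro nn_integral_cong) (simp add: nn_integral_cmult_indicator S_def)
      also have "\<dots> \<le> (\<integral>\<^sup>+\<omega>. indicator ?A \<omega> \<partial>P)"
        using r by (intro nn_integral_mono) (auto split: split_indicator simp: ennreal_mult_top not_less top_unique)
      also have "\<dots> = ennreal (P.prob ?A)"
        by (simp add: P.emeasure_eq_measure)
      finally show ?thesis by simp
    qed
    \<comment> \<open>As \<open>m\<close> is finite and \<open>0 < \<alpha>\<close>, the lower bound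
      tends to 1.\<close>
    have "((\<lambda>r. exp (- ((1 - exp (- r)) powr \<alpha> * m))) \<longlongrightarrow> exp (- (0 * m))) (at_right 0)"
    proof (intro tendsto_exp tendsto_minus tendsto_mult tendsto_const)
      have "((\<lambda>r::real. 1 - exp (- r)) \<longlongrightarrow> 1 - exp (- 0)) (at_right 0)"
        by (intro tendsto_intros)
      then show "((\<lambda>r. (1 - exp (- r)) powr \<alpha>) \<longlongrightarrow> 0) (at_right (0::real))"
        using \<alpha> by (intro tendsto_zero_powrI[where b=\<alpha>])
          (auto intro!: tendsto_const eventually_at_rightI[of 0 1])
    qed
    then have "exp (- (0 * m)) \<le> P.prob ?A"
      by (rule tendsto_upperbound) (auto intro!: eventually_at_rightI[of 0 1] le)
    then have "P.prob ?A = 1" using P.prob_le_1[of ?A] by simp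
    then show ?thesis by (subst (asm) P.prob_Collect_eq_1) auto
  qed
  have AE_radon: "AE \<omega> in P. S \<omega> \<in> space radon_space"
  proof -
    have "AE \<omega> in P. \<forall>i. 1 \<le> i \<longrightarrow> emeasure (S \<omega>) (B i) < \<top>"
      unfolding AE_all_countable using finite_B by auto
    then show ?thesis
      by eventually_elim (simp add: radon_space_iff_finite_on_base[OF B] S_def)
  qed
  have N_in: "N \<omega> \<in> space counting_space" if "\<omega> \<in> space P" for \<omega>
    unfolding N_def S_def
    using superposition_in_counting_space[of "J \<omega>" "\<lambda>i. d i \<omega>"] d_in[OF that] null_measure_in_counting_space by auto
  have N_meas: "N \<in> P \<rightarrow>\<^sub>M counting_space"
  proof (rule measurable_counting_space[OF N_in])
    fix A :: "'a set" assume A: "A \<in> sets borel"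
    have em: "(\<lambda>\<omega>. emeasure (S \<omega>) (B i)) \<in> borel_measurable P" for i
      by (intro S_meas rel_compact_baseD(2)[OF B])
    note [measurable] = S_meas[OF A] em
    \<comment> \<open>Membership in \<open>radon_space\<close> quantifies over all relatively
      compact Borel sets; the base replaces it by countably many measurable conditions.\<close>
    have "emeasure (N \<omega>) A = (if \<forall>i. 1 \<le> i \<longrightarrow> emeasure (S \<omega>) (B i) < \<top> then emeasure (S \<omega>) A else 0)" for \<omega>
    proof -
      have "S \<omega> \<in> space radon_space \<longleftrightarrow> (\<forall>i. 1 \<le> i \<longrightarrow> emeasure (S \<omega>) (B i) < \<top>)"
        unfolding radon_space_iff_finite_on_base[OF B] by (simp add: S_def)
      then show ?thesis by (simp only: N_def if_distrib[of "\<lambda>\<mu>. emeasure \<mu> A"] emeasure_null_measure)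
    qed
    then show "(\<lambda>\<omega>. emeasure (N \<omega>) A) \<in> borel_measurable P" by simp
  qed
  have AE_N: "AE \<omega> in P. N \<omega> = S \<omega>"
    using AE_radon by eventually_elim (simp add: N_def)
  have "distr P counting_space N = L"
  proof (rule counting_measure_eqI[OF B _ L])
    show D: "distr P counting_space N \<in> space (prob_algebra counting_space)"
      using P.prob_space_distr[OF N_meas] by (simp add: space_prob_algebra)
    fix u :: "'a \<Rightarrow> real" assume u: "u \<in> test_functions"
    note [measurable] = test_functionsD(1)[OF u]
    have h: "(\<lambda>x. ennreal (- ln (u x))) \<in> borel_measurable borel" by measurable
    show "pgfl (distr P counting_space N) u = pgfl L u"
    proof (rule pgfl_eqI[OF D u])
      have "(\<integral>\<^sup>+\<mu>. ennreal (exp_neg (\<integral>\<^sup>+x. ennreal (- ln (u x)) \<partial>\<mu>)) \<partial>distr P counting_space N)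
          = (\<integral>\<^sup>+\<omega>. ennreal (exp_neg (\<integral>\<^sup>+x. ennreal (- ln (u x)) \<partial>N \<omega>)) \<partial>P)"
        by (rule nn_integral_distr[OF N_meas]) measurable
      also have "\<dots> = (\<integral>\<^sup>+\<omega>. ennreal (exp_neg (\<integral>\<^sup>+x. ennreal (- ln (u x)) \<partial>S \<omega>)) \<partial>P)"
        using AE_N by (intro nn_integral_cong_AE) auto
      also have "\<dots> = ennreal (pgfl L u)"
        using test_functionsD(2,3)[OF u]
        by (simp add: laplace_S[OF h] pgfl_eq_exp_neg_spectral(1)[OF u] exp_neg_minus_ln)
      finally show "(\<integral>\<^sup>+\<mu>. ennreal (exp_neg (\<integral>\<^sup>+x. ennreal (- ln (u x)) \<partial>\<mu>)) \<partial>distr P counting_space N)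
          = ennreal (pgfl L u)" .
    qed (rule pgfl_eq_nn_integral_exp_neg(2)[OF L u])
  qed
  moreover have "cluster_process P prob_part Nc (Sib \<alpha>) N"
    unfolding cluster_process_def
  proof (intro conjI exI)
    show "Sib \<alpha> \<in> prob_part \<rightarrow>\<^sub>M prob_algebra counting_space" by (rule measurable_Sib)
    show "N \<in> P \<rightarrow>\<^sub>M counting_space" by (rule N_meas)
    show "\<forall>i. {\<omega>\<in>space P. i \<in> J \<omega>} \<in> sets P" "\<forall>i. c i \<in> P \<rightarrow>\<^sub>M prob_part" "\<forall>i. d i \<in> P \<rightarrow>\<^sub>M counting_space"
      using J c d by auto
    show "\<forall>\<omega>\<in>space P. Nc \<omega> = dirac_sum prob_part (J \<omega>) (\<lambda>i. c i \<omega>)" by (simp add: Nc_def)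
    show "AE \<omega> in P. N \<omega> = superposition borel (J \<omega>) (\<lambda>i. d i \<omega>)"
      using AE_N by (simp add: S_def)
  qed (use independent in blast)
  ultimately show ?thesis using P poisson by blast
qed

end

theorem theorem24:
  fixes B :: "nat \<Rightarrow> 'a::{second_countable_topology, t2_space} set"
    and P :: "'w measure" and \<Phi> :: "'w \<Rightarrow> 'a measure"
    and \<alpha> :: real and \<sigma> :: "'a measure measure"
  defines "L \<equiv> distr P counting_space \<Phi>"
    and "\<sigma>\<^sub>1 \<equiv> restrict_space \<sigma> prob_measures"
  assumes "locally_compact_space (euclidean :: 'a topology)"
    and "rel_compact_base B"
    and "0 < \<alpha>" "\<alpha> \<le> 1"
    and "prob_space P" "\<Phi> \<in> P \<rightarrow>\<^sub>M counting_space"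
    and "discrete_stable \<alpha> L"
    and "spectral_measure B \<alpha> L \<sigma>"
    and "supported_by \<sigma> prob_measures \<or>
         \<alpha> < 1 \<and> (\<exists>\<Lambda>. levy_measure \<alpha> L \<Lambda> \<and> polar_part B \<alpha> \<Lambda> \<sigma> \<and>
                      supported_by \<Lambda> {\<mu>. emeasure \<mu> UNIV < \<infinity>})"
  shows "(\<forall>\<Lambda>. \<alpha> < 1 \<and> levy_measure \<alpha> L \<Lambda> \<and> polar_part B \<alpha> \<Lambda> \<sigma> \<longrightarrow>
             (supported_by \<Lambda> {\<mu>. emeasure \<mu> UNIV < \<infinity>} \<longleftrightarrow> supported_by \<sigma> prob_measures))
       \<and> (\<forall>\<mu>\<in>prob_measures. is_sibuya \<alpha> \<mu> (Sib \<alpha> \<mu> :: 'a measure measure))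
       \<and> (\<exists>(P' :: (nat \<Rightarrow> nat \<times> 'a measure \<times> 'a measure) measure) Nc N.
            prob_space P' \<and>
            poisson_process P' \<sigma>\<^sub>1 Nc \<and>
            cluster_process P' \<sigma>\<^sub>1 Nc (Sib \<alpha>) N \<and>
            distr P' counting_space N = L)
       \<and> (\<forall>u\<in>test_functions. pgfl L u = exp (\<integral>\<mu>. (pgfl (Sib \<alpha> \<mu>) u - 1) \<partial>\<sigma>\<^sub>1))"
proof -
  note B = \<open>rel_compact_base B\<close> and \<alpha> = \<open>0 < \<alpha>\<close> \<open>\<alpha> \<le> 1\<close> and spectral = \<open>spectral_measure B \<alpha> L \<sigma>\<close>
  have L: "L \<in> space (prob_algebra counting_space)"
    using prob_space.prob_space_distr[OF \<open>prob_space P\<close> \<open>\<Phi> \<in> P \<rightarrow>\<^sub>M counting_space\<close>]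
    by (simp add: L_def space_prob_algebra)
  have equiv: "supported_by \<Lambda> {\<mu>. emeasure \<mu> UNIV < \<infinity>} \<longleftrightarrow> supported_by \<sigma> prob_measures"
    if "\<alpha> < 1" "levy_measure \<alpha> L \<Lambda>" "polar_part B \<alpha> \<Lambda> \<sigma>" for \<Lambda>
    using spectral by (intro supported_by_levy_measure_iff[OF B that(1) _ that(2,3)]) (simp add: spectral_measure_def)
  \<comment> \<open>For \<open>\<alpha> < 1\<close> the alternative in terms of the Levy measure is
    reduced to the one on \<open>\<sigma>\<close>.\<close>
  have supported: "supported_by \<sigma> prob_measures"
    using assms(11) equiv by blast
  note hyps = B \<alpha> L spectral supported
  show ?thesis
    unfolding \<sigma>\<^sub>1_def
    using equiv is_sibuya_Sib[OF B \<alpha>]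
      exists_cluster_process[OF hyps] pgfl_eq_exp_neg_spectral[OF hyps]
    by (intro conjI allI impI ballI) simp_all
qed

end
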